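(* Let $n\ge3$ and $\beta\in\mathbb R$, and consider the equation $$-\Delta_{\mathbb S^n}v+\beta v=v^{\frac{n+2}{n-2}}\quad\text{and}\quad v>0\quad\text{on }\mathbb S^n\setminus\{\mathbf n,\mathbf s\}.\qquad( * )$$ (i) If $\beta<n(n-2)/4$, then any solution $v\in C^2(\mathbb S^n\setminus\{\mathbf n,\mathbf s\})$ of $( * )$ is rotationally symmetric about the line through $\mathbf n$ and $\mathbf s$. (ii) If $\beta\le0$, then $( * )$ has no solution $v\in C^2(\mathbb S^n\setminus\{\mathbf n,\mathbf s\})$. (iii) If $(n-2)/2<\beta<n(n-2)/4$, then $( * )$ has infinitely many solutions in $C^2(\mathbb S^n\setminus\{\mathbf n,\mathbf s\})$ which have exactly two singularities (namely $\mathbf n$ and $\mathbf s$).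
   Context: $\mathbb S^n\subset\mathbb R^{n+1}$ is the unit sphere with its standard metric; $\mathbf n=(0,\dots,0,1)$, $\mathbf s=(0,\dots,0,-1)$; $\Delta_{\mathbb S^n}$ is the Laplace–Beltrami operator. A solution $v$ has a singularity at a point $\mathbf q\in\{\mathbf n,\mathbf s\}$ if $v$ does not extend to a $C^2$ function in a neighborhood of $\mathbf q$. *)

theory Defs
  imports "HOL-Analysis.Analysis"
begin

text \<open>
  The space \<open>\<real>\<^sup>n\<^sup>+\<^sup>1\<close> is rendered as \<open>(real ^ 'n) \<times> real\<close> with \<open>n = CARD('n)\<close>; its library inner
  product is the standard one, and the second component is the last coordinate.
\<close>

type_synonym 'n ambient = "(real ^ 'n) \<times> real"

definition unit_sphere :: "'n::finite ambient set" where
  "unit_sphere = sphere 0 1"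

definition north :: "'n::finite ambient" where
  "north = (0, 1)"

definition south :: "'n::finite ambient" where
  "south = (0, -1)"

definition punctured_sphere :: "'n::finite ambient set" where
  "punctured_sphere = unit_sphere - {north, south}"

text \<open>
  The inverses of the stereographic projections from the north and from the south pole. They map
  \<open>\<real>\<^sup>n\<close> bijectively onto the sphere without the respective pole, and form the standard atlas.
\<close>

definition stereo_north :: "real ^ 'n::finite \<Rightarrow> 'n ambient" where
  "stereo_north y = ((2 / (y \<bullet> y + 1)) *\<^sub>R y, (y \<bullet> y - 1) / (y \<bullet> y + 1))"

definition stereo_south :: "real ^ 'n::finite \<Rightarrow> 'n ambient" where
  "stereo_south y = ((2 / (y \<bullet> y + 1)) *\<^sub>R y, (1 - y \<bullet> y) / (y \<bullet> y + 1))"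

definition C2_on :: "'a::real_normed_vector set \<Rightarrow> ('a \<Rightarrow> real) \<Rightarrow> bool" where
  "C2_on U f \<longleftrightarrow> open U \<and>
     (\<exists>(f' :: 'a \<Rightarrow> 'a \<Rightarrow>\<^sub>L real) (f'' :: 'a \<Rightarrow> 'a \<Rightarrow>\<^sub>L 'a \<Rightarrow>\<^sub>L real).
        (\<forall>x\<in>U. (f has_derivative blinfun_apply (f' x)) (at x)) \<and>
        (\<forall>x\<in>U. (f' has_derivative blinfun_apply (f'' x)) (at x)) \<and>
        continuous_on U f'')"

definition C2_on_sphere :: "'n::finite ambient set \<Rightarrow> ('n ambient \<Rightarrow> real) \<Rightarrow> bool" where
  "C2_on_sphere U v \<longleftrightarrow> openin (top_of_set unit_sphere) U \<and>
     C2_on (stereo_north -` U) (v \<circ> stereo_north) \<and>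
     C2_on (stereo_south -` U) (v \<circ> stereo_south)"

definition partial_deriv ::
    "'n::finite \<Rightarrow> (real ^ 'n \<Rightarrow> 'b::real_normed_vector) \<Rightarrow> real ^ 'n \<Rightarrow> 'b" where
  "partial_deriv i f x = frechet_derivative f (at x) (axis i 1)"

text \<open>
  The coefficients \<open>g\<^sub>i\<^sub>j = \<langle>\<partial>\<^sub>i\<phi>, \<partial>\<^sub>j\<phi>\<rangle>\<close> of the Riemannian metric induced by the ambient space, in the
  local coordinates given by a parametrization \<open>\<phi>\<close>.
\<close>

definition metric_coeffs :: "(real ^ 'n::finite \<Rightarrow> 'n ambient) \<Rightarrow> real ^ 'n \<Rightarrow> real ^ 'n ^ 'n" where
  "metric_coeffs \<phi> x = (\<chi> i j. partial_deriv i \<phi> x \<bullet> partial_deriv j \<phi> x)"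

text \<open>
  The Laplace--Beltrami operator in local coordinates,
  \<open>(det g)\<^sup>-\<^sup>1\<^sup>/\<^sup>2 \<Sum>\<^sub>i \<partial>\<^sub>i ((det g)\<^sup>1\<^sup>/\<^sup>2 \<Sum>\<^sub>j g\<^sup>i\<^sup>j \<partial>\<^sub>j (v \<circ> \<phi>))\<close>,
  where \<open>g\<^sup>i\<^sup>j\<close> are the entries of the inverse matrix of \<open>g\<close>.
\<close>

definition laplace_beltrami_coords ::
    "(real ^ 'n::finite \<Rightarrow> 'n ambient) \<Rightarrow> ('n ambient \<Rightarrow> real) \<Rightarrow> real ^ 'n \<Rightarrow> real" where
  "laplace_beltrami_coords \<phi> v x =
     (1 / sqrt (det (metric_coeffs \<phi> x))) *
     (\<Sum>i\<in>UNIV. partial_deriv i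
        (\<lambda>y. sqrt (det (metric_coeffs \<phi> y)) *
             (\<Sum>j\<in>UNIV. matrix_inv (metric_coeffs \<phi> y) $ i $ j * partial_deriv j (v \<circ> \<phi>) y)) x)"

text \<open>
  The operator does not depend on the coordinates, so at each point any one chart around it
  can be used. Only the north pole lies outside the first chart.
\<close>

definition laplace_sphere :: "('n::finite ambient \<Rightarrow> real) \<Rightarrow> 'n ambient \<Rightarrow> real" where
  "laplace_sphere v q =
     (if q = north then laplace_beltrami_coords stereo_south v (inv stereo_south q)
      else laplace_beltrami_coords stereo_north v (inv stereo_north q))"

definition solution :: "real \<Rightarrow> ('n::finite ambient \<Rightarrow> real) \<Rightarrow> bool" where
  "solution \<beta> v \<longleftrightarrow> C2_on_sphere punctured_sphere v \<and>
     (\<forall>q\<in>punctured_sphere. v q > 0 \<and>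
        - laplace_sphere v q + \<beta> * v q =
          v q powr ((real CARD('n) + 2) / (real CARD('n) - 2)))"

text \<open>
  The rotations of \<open>\<real>\<^sup>n\<^sup>+\<^sup>1\<close> about the line through the poles, i.e. those fixing it pointwise, are the
  maps \<open>(x, t) \<mapsto> (A x, t)\<close> with \<open>A \<in> SO(n)\<close>.
\<close>

definition rotationally_symmetric :: "('n::finite ambient \<Rightarrow> real) \<Rightarrow> bool" where
  "rotationally_symmetric v \<longleftrightarrow>
     (\<forall>A :: real ^ 'n ^ 'n. rotation_matrix A \<longrightarrow>
        (\<forall>x t. (x, t) \<in> punctured_sphere \<longrightarrow> v (A *v x, t) = v (x, t)))"

text \<open>
  A function on the punctured sphere is a total function here whose values at the poles (and off
  the sphere) are meaningless; hence the extension \<open>w\<close> need not agree with it there.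
\<close>

definition has_singularity :: "('n::finite ambient \<Rightarrow> real) \<Rightarrow> 'n ambient \<Rightarrow> bool" where
  "has_singularity v q \<longleftrightarrow>
     \<not> (\<exists>U w. q \<in> U \<and> C2_on_sphere U w \<and> (\<forall>x \<in> U \<inter> punctured_sphere. w x = v x))"

end

theory Submission
  imports Defs "HOL-Real_Asymp.Real_Asymp"
begin

text \<open>
  Stereographic projection from the north pole identifies the punctured sphere with \<open>\<real>\<^sup>n - {0}\<close>.
  Put \<open>k = (n - 2) / 2\<close>, let \<open>\<psi>(y) = 2 / (1 + |y|\<^sup>2)\<close> be the conformal factor and \<open>u = \<psi>\<^sup>k v\<close>.
  Since \<open>-\<Delta> + n (n - 2) / 4\<close> on the sphere is conformally covariant, the equation for \<open>v\<close> becomes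
  \<open>-\<Delta>u = u\<^sup>p + c \<psi>\<^sup>2 u\<close> with \<open>p = (n + 2) / (n - 2)\<close> and \<open>c = n (n - 2) / 4 - \<beta>\<close> (\<open>flatten_lap\<close>,
  \<open>solution_imp_flat_solution\<close>). All three claims are read off from this flat equation.

  Symmetry (\<open>c > 0\<close>) is proved by moving spheres. For a unit vector \<open>e\<close> and \<open>R > 1\<close> take the
  sphere with centre \<open>R e\<close> that is orthogonal to the unit sphere, and compare \<open>u\<close> inside it with
  its Kelvin transform, which solves the same equation except that \<open>\<psi>\<close> is replaced by something
  larger (\<open>conf_factor_reflect\<close>). The difference, called \<open>excess\<close>, vanishes on the sphere and
  satisfies a linear differential inequality inside which is strict because \<open>c > 0\<close>
  (\<open>excess_lap\<close>). It is nonnegative for \<open>R\<close> near \<open>1\<close>, where the ball is small, and the set of all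
  \<open>R\<close> for which it is nonnegative is open and closed (\<open>excess_nonneg\<close>); the strict inequality
  takes the place of the strong maximum principle and of Hopf's lemma. For \<open>R \<rightarrow> \<infinity>\<close> the balls
  exhaust the half-space \<open>e \<bullet> y > 0\<close> and the inversions tend to the reflection in its boundary, so
  \<open>u\<close> at \<open>y\<close> is at most \<open>u\<close> at the mirror image of \<open>y\<close>. As \<open>e\<close> is arbitrary, \<open>u\<close> depends on \<open>|y|\<close>
  only.

  The images of \<open>0\<close> and \<open>\<infinity>\<close> under the inversion lie inside the ball, and nothing is known about
  the Kelvin transform there except its sign. The minimum principle \<open>quotient_minimum_principle\<close>
  therefore divides by a barrier that is infinite at these two points.

  Nonexistence (\<open>c \<ge> n (n - 2) / 4\<close>): here \<open>v\<close> is strictly superharmonic and positive. Adding a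
  small multiple of a barrier that is infinite at both poles produces a function that attains its
  minimum but is still strictly superharmonic (\<open>coupling_below_conformal\<close>).

  Existence (\<open>0 < c < k\<^sup>2\<close>, which is the assumed range of \<open>\<beta>\<close>): the ansatz \<open>u = |y|\<^sup>-\<^sup>k w(ln |y|)\<close>
  leads to \<open>w'' = (k\<^sup>2 - c / cosh\<^sup>2 t) w - w\<^sup>p\<close>. Start at \<open>w(0) = \<alpha>\<close>, \<open>w'(0) = 0\<close> with \<open>\<alpha>\<close> so
  small that the energy is negative. The energy decreases for \<open>t > 0\<close>, whereas it would be
  nonnegative at a zero of \<open>w\<close>; so \<open>w\<close> stays above a positive constant (\<open>emden_fowler_half_line\<close>).
  Then \<open>v = cosh\<^sup>k w\<close> tends to infinity at both poles, and different \<open>\<alpha>\<close> give different values of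
  \<open>v\<close> on the equator.
\<close>

section \<open>Gradients, Hessians and the Laplacian\<close>

definition lin_trace :: "('a::euclidean_space \<Rightarrow> 'a) \<Rightarrow> real" where
  "lin_trace H = (\<Sum>b\<in>Basis. H b \<bullet> b)"

text \<open>
  A gradient near the point and a Hessian at the point: this is just enough for the product and
  chain rules and for the second derivative test. Keeping the Hessian as a linear map, with the
  Laplacian as its trace, avoids coordinates in the computation for the Kelvin transform.
\<close>

definition has_hess ::
    "('a::euclidean_space \<Rightarrow> real) \<Rightarrow> ('a \<Rightarrow> 'a) \<Rightarrow> ('a \<Rightarrow> 'a) \<Rightarrow> 'a \<Rightarrow> bool" where
  "has_hess f G H x \<longleftrightarrow>
     (\<forall>\<^sub>F y in nhds x. (f has_derivative (\<lambda>h. G y \<bullet> h)) (at y)) \<and> (G has_derivative H) (at x)"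

definition has_lap :: "('a::euclidean_space \<Rightarrow> real) \<Rightarrow> real \<Rightarrow> 'a \<Rightarrow> bool" where
  "has_lap f L x \<longleftrightarrow> (\<exists>G H. has_hess f G H x \<and> lin_trace H = L)"

lemma lin_trace_add: "lin_trace (\<lambda>h. A h + B h) = lin_trace A + lin_trace B"
  by (simp add: lin_trace_def inner_add_left sum.distrib)

lemma lin_trace_diff: "lin_trace (\<lambda>h. A h - B h) = lin_trace A - lin_trace B"
  by (simp add: lin_trace_def inner_diff_left sum_subtractf)

lemma lin_trace_scaleR: "lin_trace (\<lambda>h. c *\<^sub>R A h) = c * lin_trace A"
  by (simp add: lin_trace_def sum_distrib_left)

lemma lin_trace_id: "lin_trace (\<lambda>h. h :: 'a::euclidean_space) = DIM('a)"
  by (simp add: lin_trace_def)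

lemma lin_trace_rank1: "lin_trace (\<lambda>h. (a \<bullet> h) *\<^sub>R v) = a \<bullet> v"
  by (simp add: lin_trace_def euclidean_inner[of a v] inner_commute)

lemma lin_trace_rank1': "lin_trace (\<lambda>h. (c * (a \<bullet> h)) *\<^sub>R v) = c * (a \<bullet> v)"
  using lin_trace_scaleR[of c "\<lambda>h. (a \<bullet> h) *\<^sub>R v"] by (simp add: lin_trace_rank1)

lemma linear_inner_adjoint:
  fixes H :: "'a::euclidean_space \<Rightarrow> 'a"
  assumes "linear H"
  shows "v \<bullet> H h = (\<Sum>b\<in>Basis. (v \<bullet> H b) *\<^sub>R b) \<bullet> h"
proof -
  have "v \<bullet> H h = v \<bullet> H (\<Sum>b\<in>Basis. (h \<bullet> b) *\<^sub>R b)"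
    by (simp add: euclidean_representation)
  also have "\<dots> = (\<Sum>b\<in>Basis. (h \<bullet> b) * (v \<bullet> H b))"
    using assms by (simp add: linear_sum linear_scale inner_sum_right)
  finally show ?thesis
    by (simp add: inner_sum_left inner_commute[of h] mult.commute)
qed

text \<open>
  Conjugating a linear map by the reflection along \<open>d\<close> changes it by maps of this rank one form.
\<close>

lemma lin_trace_rank1_linear:
  fixes H :: "'a::euclidean_space \<Rightarrow> 'a"
  assumes "linear H"
  shows "lin_trace (\<lambda>h. (v \<bullet> H h) *\<^sub>R w) = v \<bullet> H w"
proof -
  define a where "a = (\<Sum>b\<in>Basis. (v \<bullet> H b) *\<^sub>R b)"
  have "v \<bullet> H h = a \<bullet> h" for h
    unfolding a_def by (rule linear_inner_adjoint[OF assms])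
  then show ?thesis
    by (simp add: lin_trace_rank1)
qed

lemma has_hess_imp_has_derivative:
  "has_hess f G H x \<Longrightarrow> (f has_derivative (\<lambda>h. G x \<bullet> h)) (at x)"
  unfolding has_hess_def by (meson eventually_nhds_x_imp_x)

lemma has_lap_imp_isCont: "has_lap f L x \<Longrightarrow> isCont f x"
  unfolding has_lap_def using has_hess_imp_has_derivative has_derivative_continuous by blast

lemma has_hess_cong:
  assumes "has_hess f G H x" "\<forall>\<^sub>F y in nhds x. g y = f y"
  shows "has_hess g G H x"
proof -
  have "\<forall>\<^sub>F y in nhds x. \<forall>\<^sub>F z in nhds y. g z = f z"
    using assms(2) by (simp add: eventually_eventually)
  with conjunct1[OF assms(1)[unfolded has_hess_def]]
  have "\<forall>\<^sub>F y in nhds x. (g has_derivative (\<lambda>h. G y \<bullet> h)) (at y)"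
  proof eventually_elim
    case (elim y)
    from elim(2) have "\<forall>\<^sub>F z in at y. f z = g z"
      unfolding eventually_at_filter by eventually_elim auto
    with elim eventually_nhds_x_imp_x[OF elim(2)] show ?case
      by (auto intro: has_derivative_transform_eventually)
  qed
  with assms(1) show ?thesis
    by (simp add: has_hess_def)
qed

lemma has_lap_cong:
  assumes "has_lap f L x" "\<forall>\<^sub>F y in nhds x. g y = f y"
  shows "has_lap g L x"
  using assms has_hess_cong unfolding has_lap_def by blast

lemma has_hess_add:
  assumes "has_hess f G H x" "has_hess f2 G2 H2 x"
  shows "has_hess (\<lambda>y. f y + f2 y) (\<lambda>y. G y + G2 y) (\<lambda>h. H h + H2 h) x"
proof -
  have "\<forall>\<^sub>F y in nhds x. ((\<lambda>y. f y + f2 y) has_derivative (\<lambda>h. (G y + G2 y) \<bullet> h)) (at y)"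
    using conjunct1[OF assms(1)[unfolded has_hess_def]] conjunct1[OF assms(2)[unfolded has_hess_def]]
    by eventually_elim (auto intro!: derivative_eq_intros simp: inner_add_left)
  with assms show ?thesis
    by (auto simp: has_hess_def intro!: derivative_eq_intros)
qed

lemma has_hess_cmul:
  assumes "has_hess f G H x"
  shows "has_hess (\<lambda>y. c * f y) (\<lambda>y. c *\<^sub>R G y) (\<lambda>h. c *\<^sub>R H h) x"
  using assms unfolding has_hess_def
  by (auto elim!: eventually_mono intro!: derivative_eq_intros)

lemma has_lap_add:
  assumes "has_lap f L x" "has_lap f2 L2 x"
  shows "has_lap (\<lambda>y. f y + f2 y) (L + L2) x"
  using assms has_hess_add lin_trace_add unfolding has_lap_def by metis

lemma has_lap_cmul:
  assumes "has_lap f L x"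
  shows "has_lap (\<lambda>y. c * f y) (c * L) x"
  using assms has_hess_cmul lin_trace_scaleR unfolding has_lap_def by metis

lemma has_lap_diff:
  assumes "has_lap f L x" "has_lap f2 L2 x"
  shows "has_lap (\<lambda>y. f y - f2 y) (L - L2) x"
  using has_lap_add[OF assms(1) has_lap_cmul[OF assms(2), of "-1"]] by simp

lemma has_hess_const: "has_hess (\<lambda>y. c) (\<lambda>y. 0) (\<lambda>h. 0) x"
  by (simp add: has_hess_def always_eventually)

lemma has_lap_const: "has_lap (\<lambda>y. c) 0 x"
  unfolding has_lap_def using has_hess_const by (force simp: lin_trace_def)

lemma has_hess_mult:
  assumes f: "has_hess f G H x" and g: "has_hess f2 G2 H2 x"
  shows "has_hess (\<lambda>y. f y * f2 y) (\<lambda>y. f y *\<^sub>R G2 y + f2 y *\<^sub>R G y)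
           (\<lambda>h. (G x \<bullet> h) *\<^sub>R G2 x + f x *\<^sub>R H2 h + (G2 x \<bullet> h) *\<^sub>R G x + f2 x *\<^sub>R H h) x"
proof -
  have "\<forall>\<^sub>F y in nhds x. ((\<lambda>y. f y * f2 y) has_derivative
          (\<lambda>h. (f y *\<^sub>R G2 y + f2 y *\<^sub>R G y) \<bullet> h)) (at y)"
    using conjunct1[OF f[unfolded has_hess_def]] conjunct1[OF g[unfolded has_hess_def]]
    by eventually_elim (auto intro!: derivative_eq_intros simp: inner_add_left algebra_simps)
  moreover have "((\<lambda>y. f y *\<^sub>R G2 y + f2 y *\<^sub>R G y) has_derivative
      (\<lambda>h. (G x \<bullet> h) *\<^sub>R G2 x + f x *\<^sub>R H2 h + (G2 x \<bullet> h) *\<^sub>R G x + f2 x *\<^sub>R H h)) (at x)"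
    using f g has_hess_imp_has_derivative[OF f] has_hess_imp_has_derivative[OF g]
    unfolding has_hess_def
    by (auto intro!: derivative_eq_intros simp: algebra_simps)
  ultimately show ?thesis by (simp add: has_hess_def)
qed

lemma lin_trace_mult:
  "lin_trace (\<lambda>h. (G \<bullet> h) *\<^sub>R G2 + a *\<^sub>R H2 h + (G2 \<bullet> h) *\<^sub>R G + b *\<^sub>R H h)
     = a * lin_trace H2 + 2 * (G \<bullet> G2) + b * lin_trace H"
  by (simp add: lin_trace_add lin_trace_scaleR lin_trace_rank1 inner_commute[of G2 G])

lemma has_lap_mult:
  assumes "has_hess f G H x" "has_hess f2 G2 H2 x"
  shows "has_lap (\<lambda>y. f y * f2 y) (f x * lin_trace H2 + 2 * (G x \<bullet> G2 x) + f2 x * lin_trace H) x"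
  using has_hess_mult[OF assms] lin_trace_mult unfolding has_lap_def by blast

lemma has_hess_compose:
  fixes \<phi> \<phi>' :: "real \<Rightarrow> real"
  assumes f: "has_hess f G H x"
    and 1: "\<forall>\<^sub>F t in nhds (f x). (\<phi> has_real_derivative \<phi>' t) (at t)"
    and 2: "(\<phi>' has_real_derivative c) (at (f x))"
  shows "has_hess (\<lambda>y. \<phi> (f y)) (\<lambda>y. \<phi>' (f y) *\<^sub>R G y)
           (\<lambda>h. (c * (G x \<bullet> h)) *\<^sub>R G x + \<phi>' (f x) *\<^sub>R H h) x"
proof -
  note df = has_hess_imp_has_derivative[OF f]
  have "isCont f x"
    using df has_derivative_continuous by blast
  then have "\<forall>\<^sub>F y in nhds x. (\<phi> has_real_derivative \<phi>' (f y)) (at (f y))"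
    using eventually_compose_filterlim[OF 1] by (simp add: isCont_def tendsto_at_iff_tendsto_nhds)
  then have "\<forall>\<^sub>F y in nhds x. ((\<lambda>y. \<phi> (f y)) has_derivative (\<lambda>h. (\<phi>' (f y) *\<^sub>R G y) \<bullet> h)) (at y)"
    using conjunct1[OF f[unfolded has_hess_def]]
    by eventually_elim
      (auto simp: has_field_derivative_def mult.commute dest: has_derivative_compose)
  moreover have "((\<lambda>y. \<phi>' (f y)) has_derivative (\<lambda>h. c * (G x \<bullet> h))) (at x)"
    using has_derivative_compose[OF df] 2 by (auto simp: has_field_derivative_def)
  then have "((\<lambda>y. \<phi>' (f y) *\<^sub>R G y) has_derivative
      (\<lambda>h. (c * (G x \<bullet> h)) *\<^sub>R G x + \<phi>' (f x) *\<^sub>R H h)) (at x)"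
    using f unfolding has_hess_def by (auto intro!: derivative_eq_intros)
  ultimately show ?thesis by (simp add: has_hess_def)
qed

abbreviation sq_dist :: "'a::real_inner \<Rightarrow> 'a \<Rightarrow> real" where
  "sq_dist a y \<equiv> (y - a) \<bullet> (y - a)"

lemma has_hess_sq_dist:
  "has_hess (\<lambda>y. sq_dist a y) (\<lambda>y. 2 *\<^sub>R (y - a)) (\<lambda>h. 2 *\<^sub>R h) x"
  unfolding has_hess_def
  by (auto intro!: derivative_eq_intros always_eventually simp: inner_commute)

lemma has_hess_radial:
  fixes \<phi> \<phi>' :: "real \<Rightarrow> real"
  assumes "\<forall>\<^sub>F t in nhds (sq_dist a x). (\<phi> has_real_derivative \<phi>' t) (at t)"
    and "(\<phi>' has_real_derivative c) (at (sq_dist a x))"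
  shows "has_hess (\<lambda>y. \<phi> (sq_dist a y)) (\<lambda>y. (2 * \<phi>' (sq_dist a y)) *\<^sub>R (y - a))
           (\<lambda>h. (4 * c * ((x - a) \<bullet> h)) *\<^sub>R (x - a) + (2 * \<phi>' (sq_dist a x)) *\<^sub>R h) x"
  using has_hess_compose[OF has_hess_sq_dist assms] by (simp add: mult_ac)

lemma has_lap_radial:
  fixes x :: "'a::euclidean_space" and \<phi> \<phi>' :: "real \<Rightarrow> real"
  assumes "\<forall>\<^sub>F t in nhds (sq_dist a x). (\<phi> has_real_derivative \<phi>' t) (at t)"
    and "(\<phi>' has_real_derivative c) (at (sq_dist a x))"
  shows "has_lap (\<lambda>y. \<phi> (sq_dist a y))
     (4 * c * (sq_dist a x) + 2 * DIM('a) * \<phi>' (sq_dist a x)) x"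
proof -
  have "lin_trace (\<lambda>h. (4 * c * ((x - a) \<bullet> h)) *\<^sub>R (x - a) + (2 * \<phi>' (sq_dist a x)) *\<^sub>R h)
      = 4 * c * (sq_dist a x) + 2 * DIM('a) * \<phi>' (sq_dist a x)"
    by (simp add: lin_trace_add lin_trace_scaleR lin_trace_rank1' lin_trace_id)
  with has_hess_radial[OF assms] show ?thesis
    unfolding has_lap_def by blast
qed

text \<open>
  The second derivative test on the line through \<open>x\<close> in direction \<open>h\<close>: if \<open>H h \<bullet> h\<close> were negative,
  the derivative along the line would be negative just after \<open>x\<close>.
\<close>

lemma has_hess_local_min:
  fixes x :: "'a::euclidean_space"
  assumes f: "has_hess f G H x" and min: "\<forall>\<^sub>F y in nhds x. f x \<le> f y"
  shows "0 \<le> H h \<bullet> h"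
proof (rule ccontr)
  assume neg: "\<not> 0 \<le> H h \<bullet> h"
  have lim: "((\<lambda>s. x + s *\<^sub>R h) \<longlongrightarrow> x) (nhds (0::real))"
  proof -
    have "isCont (\<lambda>s. x + s *\<^sub>R h) 0"
      by (intro continuous_intros)
    then show ?thesis
      using tendsto_at_iff_tendsto_nhds[of "\<lambda>s. x + s *\<^sub>R h" 0] by (simp add: isCont_def)
  qed
  from f have "\<forall>\<^sub>F y in nhds x. (f has_derivative (\<lambda>h. G y \<bullet> h)) (at y) \<and> f x \<le> f y"
    unfolding has_hess_def using min by (simp add: eventually_conj)
  with lim have "\<forall>\<^sub>F s in nhds (0::real). (f has_derivative (\<lambda>k. G (x + s *\<^sub>R h) \<bullet> k)) (at (x + s *\<^sub>R h))
      \<and> f x \<le> f (x + s *\<^sub>R h)"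
    by (rule eventually_compose_filterlim[rotated])
  then obtain d where d: "d > 0" and dd: "\<And>s. \<bar>s\<bar> < d \<Longrightarrow>
      (f has_derivative (\<lambda>k. G (x + s *\<^sub>R h) \<bullet> k)) (at (x + s *\<^sub>R h)) \<and> f x \<le> f (x + s *\<^sub>R h)"
    unfolding eventually_nhds_metric by (auto simp: dist_real_def)
  have der: "((\<lambda>s. f (x + s *\<^sub>R h)) has_real_derivative G (x + s *\<^sub>R h) \<bullet> h) (at s)" if "\<bar>s\<bar> < d" for s
  proof -
    have "((\<lambda>s. x + s *\<^sub>R h) has_derivative (\<lambda>t. t *\<^sub>R h)) (at s)"
      by (auto intro!: derivative_eq_intros)
    from has_derivative_compose[OF this conjunct1[OF dd[OF that]]] show ?thesis
      by (rule has_derivative_imp_has_field_derivative) simp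
  qed
  have G0: "G x \<bullet> h = 0"
    using DERIV_local_min[OF der[of 0] d] d dd by simp
  have "((\<lambda>s. x + s *\<^sub>R h) has_derivative (\<lambda>t. t *\<^sub>R h)) (at (0::real))"
    by (auto intro!: derivative_eq_intros)
  from has_derivative_compose[OF this, of G H]
  have "((\<lambda>s. G (x + s *\<^sub>R h)) has_derivative (\<lambda>t. H (t *\<^sub>R h))) (at 0)"
    using f by (simp add: has_hess_def)
  from has_derivative_inner_left[OF this, of h]
  have "((\<lambda>s. G (x + s *\<^sub>R h) \<bullet> h) has_derivative (\<lambda>t. H (t *\<^sub>R h) \<bullet> h)) (at 0)" .
  moreover have "linear H"
    using f has_derivative_linear unfolding has_hess_def by blast
  ultimately have "((\<lambda>s. G (x + s *\<^sub>R h) \<bullet> h) has_derivative (\<lambda>t. t * (H h \<bullet> h))) (at 0)"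
    by (simp add: linear_scale)
  then have "((\<lambda>s. G (x + s *\<^sub>R h) \<bullet> h) has_real_derivative (H h \<bullet> h)) (at 0)"
    by (rule has_derivative_imp_has_field_derivative) simp
  from DERIV_neg_dec_right[OF this] neg obtain e where e: "e > 0"
    and ee: "\<And>s. 0 < s \<Longrightarrow> s < e \<Longrightarrow> G (x + s *\<^sub>R h) \<bullet> h < 0"
    using G0 by auto
  define r where "r = min d e / 2"
  have r: "0 < r" "r < d" "r < e" using d e by (auto simp: r_def)
  have "f (x + r *\<^sub>R h) < f (x + 0 *\<^sub>R h)"
  proof (rule DERIV_neg_imp_decreasing_open[OF \<open>0 < r\<close>, of "\<lambda>s. f (x + s *\<^sub>R h)"])
    show "\<exists>y. ((\<lambda>s. f (x + s *\<^sub>R h)) has_real_derivative y) (at s) \<and> y < 0" if "0 < s" "s < r" for s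
      using der[of s] ee[of s] that r by (intro exI[of _ "G (x + s *\<^sub>R h) \<bullet> h"]) auto
    show "continuous_on {0..r} (\<lambda>s. f (x + s *\<^sub>R h))"
    proof (intro continuous_at_imp_continuous_on ballI)
      fix s assume "s \<in> {0..r}"
      then show "isCont (\<lambda>s. f (x + s *\<^sub>R h)) s"
        using der[of s] r by (intro DERIV_isCont) auto
    qed
  qed
  with dd[of r] r show False by auto
qed

lemma has_lap_local_min:
  assumes "has_lap f L x" "\<forall>\<^sub>F y in nhds x. f x \<le> f y"
  shows "0 \<le> L"
proof -
  obtain G H where H: "has_hess f G H x" "lin_trace H = L"
    using assms(1) by (auto simp: has_lap_def)
  have "0 \<le> lin_trace H"
    unfolding lin_trace_def using has_hess_local_min[OF H(1) assms(2)] by (intro sum_nonneg) auto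
  with H show ?thesis by simp
qed

section \<open>Inversions and the Kelvin transform\<close>

lemma has_hess_powr_dist:
  fixes x a :: "'a::euclidean_space"
  assumes "x \<noteq> a"
  shows "has_hess (\<lambda>y. (sq_dist a y) powr s)
      (\<lambda>y. (2 * (s * (sq_dist a y) powr (s - 1))) *\<^sub>R (y - a))
      (\<lambda>h. (4 * (s * ((s - 1) * (sq_dist a x) powr (s - 2))) * ((x - a) \<bullet> h)) *\<^sub>R (x - a)
        + (2 * (s * (sq_dist a x) powr (s - 1))) *\<^sub>R h) x"
proof (rule has_hess_radial)
  have pos: "0 < sq_dist a x" using assms by simp
  show "((\<lambda>t. s * t powr (s - 1)) has_real_derivative s * ((s - 1) * (sq_dist a x) powr (s - 2)))
      (at (sq_dist a x))"
    using DERIV_cmult[OF has_real_derivative_powr[OF pos, of "s - 1"], of s] by simp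
  have "\<forall>\<^sub>F t in nhds (sq_dist a x). 0 < t"
    using pos by (simp add: eventually_nhds_in_open[of "{0<..}", simplified])
  then show "\<forall>\<^sub>F t in nhds (sq_dist a x). ((\<lambda>t. t powr s) has_real_derivative s * t powr (s - 1)) (at t)"
    by eventually_elim (rule has_real_derivative_powr)
qed

text \<open>
  The factor \<open>2 s - 2 + n\<close> vanishes for the exponent of the fundamental solution, and its sign
  decides which negative powers of the distance are superharmonic.
\<close>

lemma lin_trace_powr_dist:
  fixes d :: "'a::euclidean_space"
  assumes "d \<noteq> 0"
  shows "lin_trace (\<lambda>h. (4 * (s * ((s - 1) * (d \<bullet> d) powr (s - 2))) * (d \<bullet> h)) *\<^sub>R d
        + (2 * (s * (d \<bullet> d) powr (s - 1))) *\<^sub>R h)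
     = 2 * s * (2 * s - 2 + real DIM('a)) * (d \<bullet> d) powr (s - 1)"
proof -
  have "(d \<bullet> d) powr (s - 1) = (d \<bullet> d) powr (s - 2) * (d \<bullet> d)"
    using assms powr_add[of "d \<bullet> d" "s - 2" 1] by simp
  moreover have "lin_trace (\<lambda>h. (4 * (s * ((s - 1) * (d \<bullet> d) powr (s - 2))) * (d \<bullet> h)) *\<^sub>R d
        + (2 * (s * (d \<bullet> d) powr (s - 1))) *\<^sub>R h)
     = 4 * (s * ((s - 1) * (d \<bullet> d) powr (s - 2))) * (d \<bullet> d) + 2 * (s * (d \<bullet> d) powr (s - 1)) * real DIM('a)"
    by (simp only: lin_trace_add lin_trace_scaleR lin_trace_rank1' lin_trace_id)
  ultimately show ?thesis
    by (simp add: algebra_simps)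
qed

lemma has_lap_powr_dist:
  fixes x a :: "'a::euclidean_space"
  assumes "x \<noteq> a"
  shows "has_lap (\<lambda>y. (sq_dist a y) powr s)
      (2 * s * (2 * s - 2 + real DIM('a)) * (sq_dist a x) powr (s - 1)) x"
  using has_hess_powr_dist[OF assms, of s] lin_trace_powr_dist[of "x - a" s] assms
  unfolding has_lap_def by auto

definition inversion :: "'a::euclidean_space \<Rightarrow> real \<Rightarrow> 'a \<Rightarrow> 'a" where
  "inversion a l y = a + (l / (sq_dist a y)) *\<^sub>R (y - a)"

lemma inversion_has_derivative:
  fixes a x :: "'a::euclidean_space"
  assumes "x \<noteq> a"
  shows "(inversion a l has_derivative
     (\<lambda>h. (l / (sq_dist a x)) *\<^sub>R (h - (2 * ((x - a) \<bullet> h) / (sq_dist a x)) *\<^sub>R (x - a)))) (at x)"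
proof -
  have s: "sq_dist a x \<noteq> 0" using assms by simp
  have "((\<lambda>y. y - a) has_derivative (\<lambda>h. h)) (at x)"
    by (auto intro!: derivative_eq_intros)
  moreover have "((\<lambda>y. l / (sq_dist a y)) has_derivative
      (\<lambda>h. (- 2 * (l / (sq_dist a x)) / (sq_dist a x)) * ((x - a) \<bullet> h))) (at x)"
    using s by (auto intro!: derivative_eq_intros simp: inner_commute field_simps power2_eq_square)
  ultimately have "((\<lambda>y. a + (l / (sq_dist a y)) *\<^sub>R (y - a)) has_derivative
     (\<lambda>h. 0 + ((l / (sq_dist a x)) *\<^sub>R h
       + ((- 2 * (l / (sq_dist a x)) / (sq_dist a x)) * ((x - a) \<bullet> h)) *\<^sub>R (x - a)))) (at x)"
    by (intro has_derivative_add has_derivative_const has_derivative_scaleR)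
  then show ?thesis
    unfolding inversion_def[abs_def]
    by (rule has_derivative_eq_rhs) (simp add: scaleR_diff_right[of _ _ "_ *\<^sub>R _"] fun_eq_iff mult_ac)
qed

text \<open>
  The differential of the inversion at \<open>x\<close> is \<open>\<rho>\<close> times the reflection along \<open>x - a\<close>. Conjugation
  by a reflection preserves the trace, which gives the term \<open>\<rho>\<^sup>2 tr H\<close>; the first order term comes
  from the variation of this differential with the point.
\<close>

lemma has_hess_inversion:
  fixes a x :: "'a::euclidean_space" and l \<rho> :: real
  defines "\<rho> \<equiv> l / (sq_dist a x)"
  assumes u: "has_hess u G H (inversion a l x)" and x: "x \<noteq> a"
  obtains H' where "has_hess (\<lambda>y. u (inversion a l y))
      (\<lambda>y. (l / (sq_dist a y)) *\<^sub>R (G (inversion a l y)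
              - (2 * ((y - a) \<bullet> G (inversion a l y)) / (sq_dist a y)) *\<^sub>R (y - a))) H' x"
    and "lin_trace H' = \<rho>\<^sup>2 * lin_trace H
      + (4 - 2 * real DIM('a)) * \<rho> * ((x - a) \<bullet> G (inversion a l x)) / (sq_dist a x)"
proof -
  define J where "J = inversion a l"
  define D where "D = (\<lambda>y h. (l / (sq_dist a y)) *\<^sub>R (h - (2 * ((y - a) \<bullet> h) / (sq_dist a y)) *\<^sub>R (y - a)))"
  have dJ: "(J has_derivative D y) (at y)" if "y \<noteq> a" for y
    unfolding J_def D_def using inversion_has_derivative[OF that] .
  have ev: "\<forall>\<^sub>F y in nhds x. y \<noteq> a"
    using x eventually_nhds_in_open[of "- {a}" x] by auto
  have "isCont J x"
    using dJ[OF x] has_derivative_continuous by blast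
  then have limJ: "(J \<longlongrightarrow> J x) (nhds x)"
    by (simp add: isCont_def tendsto_at_iff_tendsto_nhds)
  have "\<forall>\<^sub>F y in nhds x. (u has_derivative (\<lambda>h. G (J y) \<bullet> h)) (at (J y))"
    using u eventually_compose_filterlim[OF _ limJ] unfolding has_hess_def J_def by auto
  then have 1: "\<forall>\<^sub>F y in nhds x. ((\<lambda>y. u (J y)) has_derivative (\<lambda>h. D y (G (J y)) \<bullet> h)) (at y)"
    using ev
  proof eventually_elim
    case (elim y)
    have "(c *\<^sub>R (v - (2 * (e \<bullet> v) / t) *\<^sub>R e)) \<bullet> h = v \<bullet> (c *\<^sub>R (h - (2 * (e \<bullet> h) / t) *\<^sub>R e))"
      for c t and e v h :: 'a
      by (simp add: inner_diff_left inner_diff_right inner_commute)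
    then have "D y (G (J y)) \<bullet> h = G (J y) \<bullet> D y h" for h
      unfolding D_def .
    with has_derivative_compose[OF dJ[OF elim(2)] elim(1)] show ?case by simp
  qed
  define d where "d = x - a"
  define s where "s = d \<bullet> d"
  define g where "g = G (J x)"
  have s: "s > 0" using x by (simp add: s_def d_def)
  have linH: "linear H"
    using u has_derivative_linear unfolding has_hess_def by blast
  have dG: "((\<lambda>y. G (J y)) has_derivative (\<lambda>h. H (D x h))) (at x)"
    using has_derivative_compose[OF dJ[OF x]] u unfolding has_hess_def J_def by blast
  define H' where "H' = (\<lambda>h. 
      ((- 2 * \<rho> / s) * (d \<bullet> h)) *\<^sub>R (g - (2 * (d \<bullet> g) / s) *\<^sub>R d)
      + \<rho> *\<^sub>R (H (D x h) - (2 / s) *\<^sub>R ((g \<bullet> h) *\<^sub>R d) - (2 / s) *\<^sub>R ((d \<bullet> H (D x h)) *\<^sub>R d)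
        + ((4 * (d \<bullet> g) / s\<^sup>2) * (d \<bullet> h)) *\<^sub>R d - (2 * (d \<bullet> g) / s) *\<^sub>R h))"
  have d1: "((\<lambda>y. y - a) has_derivative (\<lambda>h. h)) (at x)"
    by (auto intro!: derivative_eq_intros)
  have d2: "((\<lambda>y. l / (sq_dist a y)) has_derivative (\<lambda>h. (- 2 * \<rho> / s) * (d \<bullet> h))) (at x)"
    using s unfolding \<rho>_def s_def d_def
    by (auto intro!: derivative_eq_intros simp: inner_commute field_simps power2_eq_square)
  have d3: "((\<lambda>y. (y - a) \<bullet> G (J y)) has_derivative (\<lambda>h. d \<bullet> H (D x h) + h \<bullet> g)) (at x)"
    using has_derivative_inner[OF d1 dG] by (simp add: d_def g_def)
  have d4: "((\<lambda>y. 2 * ((y - a) \<bullet> G (J y)) / (sq_dist a y)) has_derivative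
      (\<lambda>h. 2 / s * (d \<bullet> H (D x h) + h \<bullet> g) - (4 * (d \<bullet> g) / s\<^sup>2) * (d \<bullet> h))) (at x)"
  proof -
    have i: "((\<lambda>y. 1 / (sq_dist a y)) has_derivative (\<lambda>h. (- 2 / s\<^sup>2) * (d \<bullet> h))) (at x)"
      using s unfolding s_def d_def
      by (auto intro!: derivative_eq_intros simp: inner_commute field_simps power2_eq_square)
    have "((\<lambda>y. (2 * ((y - a) \<bullet> G (J y))) * (1 / (sq_dist a y))) has_derivative
      (\<lambda>h. (2 * ((x - a) \<bullet> G (J x))) * ((- 2 / s\<^sup>2) * (d \<bullet> h)) + (2 * (d \<bullet> H (D x h) + h \<bullet> g)) * (1 / (sq_dist a x)))) (at x)"
      by (rule has_derivative_mult[OF has_derivative_mult_right[OF d3] i])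
    then have "((\<lambda>y. (2 * ((y - a) \<bullet> G (J y))) * (1 / (sq_dist a y))) has_derivative
      (\<lambda>h. 2 / s * (d \<bullet> H (D x h) + h \<bullet> g) - (4 * (d \<bullet> g) / s\<^sup>2) * (d \<bullet> h))) (at x)"
      by (rule has_derivative_eq_rhs)
        (simp add: d_def[symmetric] s_def[symmetric] g_def[symmetric] algebra_simps)
    then show ?thesis by simp
  qed
  have "((\<lambda>y. D y (G (J y))) has_derivative
      (\<lambda>h. \<rho> *\<^sub>R (H (D x h) - ((2 * (d \<bullet> g) / s) *\<^sub>R h + (2 / s * (d \<bullet> H (D x h) + h \<bullet> g) - (4 * (d \<bullet> g) / s\<^sup>2) * (d \<bullet> h)) *\<^sub>R d))
         + ((- 2 * \<rho> / s) * (d \<bullet> h)) *\<^sub>R (g - (2 * (d \<bullet> g) / s) *\<^sub>R d))) (at x)"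
    using has_derivative_scaleR[OF d2 has_derivative_diff[OF dG has_derivative_scaleR[OF d4 d1]]]
    unfolding D_def[abs_def] \<rho>_def s_def d_def g_def by simp
  then have 2: "((\<lambda>y. D y (G (J y))) has_derivative H') (at x)"
    by (rule has_derivative_eq_rhs)
       (auto simp: H'_def fun_eq_iff inner_commute[of g] algebra_simps)
  have D0: "D x h = \<rho> *\<^sub>R (h - (2 * (d \<bullet> h) / s) *\<^sub>R d)" for h
    by (simp only: D_def \<rho>_def d_def s_def)
  have Dd: "D x d = - \<rho> *\<^sub>R d"
    using s by (simp add: D0 s_def[symmetric] algebra_simps scaleR_2)
  have Dx: "D x h = \<rho> *\<^sub>R h - (2 * \<rho> / s) *\<^sub>R ((d \<bullet> h) *\<^sub>R d)" for h
    by (simp add: D0 algebra_simps)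
  have HD: "H (D x h) = \<rho> *\<^sub>R H h - (2 * \<rho> / s) *\<^sub>R ((d \<bullet> h) *\<^sub>R H d)" for h
    unfolding Dx by (simp add: linear_diff[OF linH] linear_scale[OF linH])
  have t1: "lin_trace (\<lambda>h. H (D x h)) = \<rho> * lin_trace H - (2 * \<rho> / s) * (d \<bullet> H d)"
    unfolding HD by (simp only: lin_trace_diff lin_trace_scaleR lin_trace_rank1)
  have linHD: "linear (\<lambda>h. H (D x h))"
    using has_derivative_linear[OF dG] .
  have t2: "lin_trace (\<lambda>h. (d \<bullet> H (D x h)) *\<^sub>R d) = - \<rho> * (d \<bullet> H d)"
    using lin_trace_rank1_linear[OF linHD, of d d] Dd by (simp add: linear_scale[OF linH] linear_neg[OF linH])
  have "lin_trace H' = (- 2 * \<rho> / s) * (d \<bullet> (g - (2 * (d \<bullet> g) / s) *\<^sub>R d))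
      + \<rho> * (\<rho> * lin_trace H - (2 * \<rho> / s) * (d \<bullet> H d) - (2 / s) * (g \<bullet> d)
          - (2 / s) * (- \<rho> * (d \<bullet> H d)) + (4 * (d \<bullet> g) / s\<^sup>2) * (d \<bullet> d) - (2 * (d \<bullet> g) / s) * real DIM('a))"
    unfolding H'_def
    by (simp only: lin_trace_add lin_trace_diff lin_trace_scaleR lin_trace_rank1 lin_trace_rank1' t1 t2 lin_trace_id)
  also have "\<dots> = \<rho>\<^sup>2 * lin_trace H + (4 - 2 * real DIM('a)) * \<rho> * (d \<bullet> g) / s"
    using s by (simp add: inner_diff_right inner_commute[of g] s_def[symmetric] field_simps power2_eq_square)
  finally have "lin_trace H' = \<rho>\<^sup>2 * lin_trace H
      + (4 - 2 * real DIM('a)) * \<rho> * ((x - a) \<bullet> G (inversion a l x)) / (sq_dist a x)"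
    by (simp add: s_def d_def g_def J_def)
  with 1 2 show thesis
    by (intro that[of H']) (auto simp: has_hess_def D_def J_def)
qed

text \<open>
  The factor in front is harmonic, and the cross term of the product rule cancels the first order
  term of \<open>has_hess_inversion\<close>; only \<open>\<rho>\<^sup>2 tr H\<close> is left.
\<close>

theorem has_lap_kelvin:
  fixes a x :: "'a::euclidean_space" and k :: real
  defines "k \<equiv> (real DIM('a) - 2) / 2"
  assumes u: "has_lap u L (inversion a l x)" and x: "x \<noteq> a" and l: "l > 0"
  shows "has_lap (\<lambda>y. (l / (sq_dist a y)) powr k * u (inversion a l y))
           ((l / (sq_dist a x)) powr (k + 2) * L) x"
proof -
  obtain G H where GH: "has_hess u G H (inversion a l x)" "lin_trace H = L"
    using u by (auto simp: has_lap_def)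
  define d where "d = x - a"
  define s where "s = d \<bullet> d"
  define \<rho> where "\<rho> = l / s"
  define g where "g = G (inversion a l x)"
  have s: "s > 0" using x by (simp add: s_def d_def)
  obtain H' where H': "has_hess (\<lambda>y. u (inversion a l y))
      (\<lambda>y. (l / (sq_dist a y)) *\<^sub>R (G (inversion a l y)
              - (2 * ((y - a) \<bullet> G (inversion a l y)) / (sq_dist a y)) *\<^sub>R (y - a))) H' x"
    "lin_trace H' = \<rho>\<^sup>2 * L + (4 - 2 * real DIM('a)) * \<rho> * (d \<bullet> g) / s"
    by (rule has_hess_inversion[OF GH(1) x]) (auto simp: GH d_def s_def \<rho>_def g_def)
  have "lin_trace (\<lambda>h. (4 * (- k * ((- k - 1) * (d \<bullet> d) powr (- k - 2))) * (d \<bullet> h)) *\<^sub>R d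
        + (2 * (- k * (d \<bullet> d) powr (- k - 1))) *\<^sub>R h) = 0"
    using lin_trace_powr_dist[of d "- k"] s by (simp add: k_def s_def field_simps)
  note N = has_hess_powr_dist[OF x, of "- k"] this
  have "has_lap (\<lambda>y. (sq_dist a y) powr (- k) * u (inversion a l y))
     (s powr (- k) * (\<rho>\<^sup>2 * L + (4 - 2 * real DIM('a)) * \<rho> * (d \<bullet> g) / s)
      + 2 * ((2 * (- k * s powr (- k - 1))) *\<^sub>R d \<bullet> \<rho> *\<^sub>R (g - (2 * (d \<bullet> g) / s) *\<^sub>R d))) x"
    using has_lap_mult[OF N(1) H'(1)] N(2) H'(2)
    by (simp only: d_def[symmetric] s_def[symmetric] \<rho>_def[symmetric] g_def[symmetric]
        mult_zero_right add_0_right)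
  also have "s powr (- k) * (\<rho>\<^sup>2 * L + (4 - 2 * real DIM('a)) * \<rho> * (d \<bullet> g) / s)
      + 2 * ((2 * (- k * s powr (- k - 1))) *\<^sub>R d \<bullet> \<rho> *\<^sub>R (g - (2 * (d \<bullet> g) / s) *\<^sub>R d))
     = s powr (- k) * \<rho>\<^sup>2 * L"
  proof -
    have 1: "s powr (- k - 1) = s powr (- k) / s" using s powr_diff[of s "- k" 1] by simp
    have 2: "4 - 2 * real DIM('a) = - 4 * k" by (simp add: k_def)
    show ?thesis
      unfolding 1 2 using s by (simp add: inner_diff_right s_def[symmetric] field_simps)
  qed
  finally have "has_lap (\<lambda>y. l powr k * ((sq_dist a y) powr (- k) * u (inversion a l y)))
     (l powr k * (s powr (- k) * \<rho>\<^sup>2 * L)) x"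
    by (rule has_lap_cmul)
  moreover have "l powr k * t powr (- k) = (l / t) powr k" if "t \<ge> 0" for t
    using l that by (simp add: powr_divide powr_minus_divide)
  moreover have "\<rho> powr (k + 2) = \<rho> powr k * \<rho>\<^sup>2"
    using s l by (simp add: \<rho>_def powr_add)
  ultimately show ?thesis
    using s by (simp add: mult.assoc[symmetric] \<rho>_def s_def d_def)
qed

section \<open>A minimum principle with a barrier\<close>

text \<open>
  If \<open>D\<close> were negative somewhere, the quotient \<open>D / h\<close> would attain a negative minimum \<open>r\<close>, and
  this happens away from \<open>S\<close> because \<open>h\<close> dominates the negative part of \<open>D\<close> near \<open>S\<close>. There
  \<open>D - r h\<close> has a local minimum with value zero, but the two differential inequalities make its
  Laplacian negative. In general a maximum principle for \<open>\<Delta> + q\<close> with positive \<open>q\<close> holds on small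
  domains only; the smallness is hidden in the existence of \<open>h\<close>.
\<close>

lemma quotient_minimum_principle:
  fixes D h :: "'a::euclidean_space \<Rightarrow> real"
  assumes C: "compact C" and S: "closed S"
    and contD: "continuous_on (C - S) D" and conth: "continuous_on (C - S) h"
    and hpos: "\<And>y. y \<in> C - S \<Longrightarrow> 0 < h y"
    and sing: "\<And>\<epsilon>. \<epsilon> > 0 \<Longrightarrow> \<exists>V. open V \<and> S \<inter> C \<subseteq> V \<and> (\<forall>y\<in>V \<inter> (C - S). - \<epsilon> * h y \<le> D y)"
    and neg: "\<And>y. y \<in> C - S \<Longrightarrow> D y < 0 \<Longrightarrow>
      y \<in> interior C \<and> (\<exists>L M q. has_lap D L y \<and> has_lap h M y \<and> L \<le> - q * D y \<and> M + q * h y < 0)"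
    and y: "y \<in> C - S"
  shows "0 \<le> D y"
proof (rule ccontr)
  assume "\<not> 0 \<le> D y"
  define m where "m = D y / h y"
  have m: "m < 0" using hpos[OF y] \<open>\<not> 0 \<le> D y\<close> by (simp add: m_def divide_neg_pos)
  then obtain V where V: "open V" "S \<inter> C \<subseteq> V" "\<And>z. z \<in> V \<inter> (C - S) \<Longrightarrow> m / 2 * h z \<le> D z"
    using sing[of "- m / 2"] by auto
  have Vq: "m < D z / h z" if "z \<in> V \<inter> (C - S)" for z
  proof -
    have "m * h z < m / 2 * h z" using hpos[of z] that m by simp
    with V(3)[OF that] have "m * h z < D z" by simp
    then show ?thesis using hpos[of z] that by (simp add: pos_less_divide_eq)
  qed
  have "y \<in> C - V" using y Vq[of y] by (auto simp: m_def)
  have sub: "C - V \<subseteq> C - S" using V(2) by auto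
  have "continuous_on (C - V) (\<lambda>z. D z / h z)"
    using hpos sub by (intro continuous_on_divide continuous_on_subset[OF contD] continuous_on_subset[OF conth]) (auto, force)
  moreover have "compact (C - V)" using C V(1) by (rule compact_diff)
  ultimately obtain z where z: "z \<in> C - V" and zmin: "\<And>w. w \<in> C - V \<Longrightarrow> D z / h z \<le> D w / h w"
    using continuous_attains_inf[of "C - V" "\<lambda>z. D z / h z"] \<open>y \<in> C - V\<close> by blast
  define r where "r = D z / h z"
  have "r \<le> m" using zmin[OF \<open>y \<in> C - V\<close>] by (simp add: r_def m_def)
  with m have r: "r < 0" by simp
  have zCS: "z \<in> C - S" using z sub by auto
  have min: "r \<le> D w / h w" if "w \<in> C - S" for w
    using zmin[of w] Vq[of w] \<open>r \<le> m\<close> that by (cases "w \<in> V") (auto simp: r_def)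
  have Dz: "D z = r * h z" using hpos[OF zCS] by (simp add: r_def)
  then have "D z < 0" using hpos[OF zCS] r by (simp add: mult_neg_pos)
  from neg[OF zCS this] obtain L M q where
    int: "z \<in> interior C" and lap: "has_lap D L z" "has_lap h M z" and LM: "L \<le> - q * D z" "M + q * h z < 0"
    by blast
  have "open (interior C - S)" using S by (simp add: open_Diff)
  then have ev: "\<forall>\<^sub>F w in nhds z. w \<in> interior C - S"
    using int zCS by (intro eventually_nhds_in_open) auto
  have "\<forall>\<^sub>F w in nhds z. D z - r * h z \<le> D w - r * h w"
    using ev
  proof eventually_elim
    case (elim w)
    then have "w \<in> C - S" using interior_subset by blast
    with min[OF this] hpos[OF this] Dz show ?case by (simp add: pos_le_divide_eq)
  qed
  from has_lap_local_min[OF has_lap_diff[OF lap(1) has_lap_cmul[OF lap(2)]] this]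
  have "0 \<le> L - r * M" .
  also have "\<dots> \<le> - r * (M + q * h z)" using LM(1) Dz by (simp add: algebra_simps)
  also have "\<dots> < 0" using LM(2) r by (simp add: mult_neg_neg mult_less_0_iff)
  finally show False by simp
qed

lemma annulus_norm_le:
  fixes y :: "'a::real_inner"
  assumes "B > 0" "y \<bullet> y + 1 \<le> 2 * B * norm y"
  shows "norm y \<le> 2 * B"
proof (cases "y = 0")
  case False
  have "norm y * norm y \<le> 2 * B * norm y"
    using assms(2) by (simp add: dot_square_norm power2_eq_square)
  with False show ?thesis by simp
qed (use assms in simp)

lemma compact_annulus:
  assumes "B > 0"
  shows "compact {y :: 'a::euclidean_space. y \<bullet> y + 1 \<le> 2 * B * norm y}" (is "compact ?W")
proof -
  have "bounded ?W" using annulus_norm_le[OF assms] by (auto simp: bounded_iff)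
  moreover have "closed ?W" by (intro closed_Collect_le continuous_intros)
  ultimately show ?thesis by (simp add: compact_eq_bounded_closed)
qed

lemma powr_tangent_le:
  fixes x y p :: real
  assumes "x > 0" "y > 0" "p \<ge> 1"
  shows "x powr p + p * x powr (p - 1) * (y - x) \<le> y powr p"
proof -
  have "y powr p - x powr p \<ge> (p * x powr (p - 1)) * (y - x)"
    using assms
    by (intro convex_on_imp_above_tangent[of "{0<..}"] powr_convex)
       (auto intro!: has_field_derivative_at_within has_real_derivative_powr simp: interior_open)
  then show ?thesis by simp
qed

section \<open>Moving spheres\<close>

text \<open>
  In the stereographic chart the round metric is the square of this factor times the flat metric.
\<close>

definition conf_factor :: "'a::real_inner \<Rightarrow> real" where
  "conf_factor y = 2 / (y \<bullet> y + 1)"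

lemma inner_plus_one_pos: "0 < y \<bullet> y + (1 :: real)"
  by (simp add: add_nonneg_pos)

lemma conf_factor_pos: "conf_factor y > 0"
  by (simp add: conf_factor_def inner_plus_one_pos)

text \<open>
  The equation in the stereographic chart. The values of \<open>k\<close> and \<open>p\<close> give \<open>k p = k + 2\<close>, which
  makes the power nonlinearity invariant under Kelvin transforms.
\<close>

locale flat_solution =
  fixes u :: "'a::euclidean_space \<Rightarrow> real" and c k p :: real
  assumes dim: "3 \<le> DIM('a)"
    and k_def: "k = (real DIM('a) - 2) / 2"
    and p_def: "p = (real DIM('a) + 2) / (real DIM('a) - 2)"
    and c_pos: "0 < c"
    and pos: "y \<noteq> 0 \<Longrightarrow> 0 < u y"
    and lap: "y \<noteq> 0 \<Longrightarrow> has_lap u (- (u y powr p + c * (conf_factor y)\<^sup>2 * u y)) y"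
begin

lemma k_ge_half: "k \<ge> 1 / 2" and p_gt_1: "p > 1" and kp: "k * p = k + 2"
  using dim by (auto simp: k_def p_def field_simps)

lemma cont_u: "continuous_on (- {0}) u"
  by (auto intro!: continuous_at_imp_continuous_on has_lap_imp_isCont[OF lap])

text \<open>
  The zeroth order coefficient of the equation linearized at \<open>u\<close>.
\<close>

definition lin_coeff :: "'a \<Rightarrow> real" where
  "lin_coeff y = p * u y powr (p - 1) + c * (conf_factor y)\<^sup>2"

lemma cont_lin_coeff: "continuous_on (- {0}) lin_coeff"
proof -
  have "y \<bullet> y + 1 \<noteq> 0" for y :: 'a using inner_plus_one_pos[of y] by simp
  then show ?thesis
    unfolding lin_coeff_def[abs_def] conf_factor_def using pos
    by (intro continuous_intros cont_u) (auto simp: less_imp_neq[symmetric] dest: less_imp_neq)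
qed

end

locale moving_spheres = flat_solution +
  fixes e :: 'a
  assumes e: "e \<bullet> e = 1"
begin

definition rho :: "real \<Rightarrow> 'a \<Rightarrow> real" where
  "rho R y = (R\<^sup>2 - 1) / (sq_dist (R *\<^sub>R e) y)"

definition reflect :: "real \<Rightarrow> 'a \<Rightarrow> 'a" where
  "reflect R y = inversion (R *\<^sub>R e) (R\<^sup>2 - 1) y"

definition kelvin :: "real \<Rightarrow> 'a \<Rightarrow> real" where
  "kelvin R y = rho R y powr k * u (reflect R y)"

definition excess :: "real \<Rightarrow> 'a \<Rightarrow> real" where
  "excess R y = kelvin R y - u y"

text \<open>
  The closed ball with centre \<open>R e\<close> and squared radius \<open>R\<^sup>2 - 1\<close> (see \<open>dist_centre\<close>). In this form
  it is evident that the balls avoid the origin and exhaust the half-space \<open>e \<bullet> y > 0\<close> as \<open>R\<close>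
  grows.
\<close>

definition moving_ball :: "real \<Rightarrow> 'a set" where
  "moving_ball R = {y. y \<bullet> y + 1 \<le> 2 * R * (e \<bullet> y)}"

text \<open>
  The points that the inversion sends to infinity and to the origin.
\<close>

definition poles :: "real \<Rightarrow> 'a set" where
  "poles R = {R *\<^sub>R e, (1 / R) *\<^sub>R e}"

lemma dist_centre: "sq_dist (R *\<^sub>R e) y = (R\<^sup>2 - 1) + (y \<bullet> y + 1 - 2 * R * (e \<bullet> y))"
  using e by (simp add: inner_diff_left inner_diff_right inner_commute power2_eq_square algebra_simps)

lemma inner_e_pos:
  assumes "y \<in> moving_ball R" "R > 0" shows "e \<bullet> y > 0"
proof -
  have "0 < y \<bullet> y + 1" by (simp add: add_nonneg_pos)
  with assms have "0 < 2 * R * (e \<bullet> y)" by (simp add: moving_ball_def)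
  with assms show ?thesis by (simp add: zero_less_mult_iff)
qed

lemma moving_ball_nonzero: "y \<in> moving_ball R \<Longrightarrow> R > 0 \<Longrightarrow> y \<noteq> 0"
  using inner_e_pos by force

lemma reflect_eq: "reflect R y = R *\<^sub>R e + rho R y *\<^sub>R (y - R *\<^sub>R e)"
  by (simp add: reflect_def inversion_def rho_def)

lemma reflect_nonzero:
  assumes "y \<notin> poles R" "R > 1"
  shows "reflect R y \<noteq> 0"
proof
  assume 0: "reflect R y = 0"
  define d where "d = y - R *\<^sub>R e"
  define t where "t = rho R y"
  have dd: "d \<bullet> d > 0" using assms by (simp add: d_def poles_def)
  have R: "R\<^sup>2 - 1 > 0" using assms by (simp add: one_less_power)
  have t: "t * (d \<bullet> d) = R\<^sup>2 - 1" using dd by (simp add: t_def rho_def d_def[symmetric])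
  with R dd have "t > 0" by (metis zero_less_mult_pos2)
  have eq: "R *\<^sub>R e = - t *\<^sub>R d" using 0 unfolding reflect_eq t_def[symmetric] d_def[symmetric]
    by (simp add: eq_neg_iff_add_eq_0)
  then have "R\<^sup>2 = t * (t * (d \<bullet> d))"
    using e by (metis (no_types, lifting) inner_scaleR_left inner_scaleR_right minus_mult_minus mult.left_commute mult.right_neutral power2_eq_square)
  with t have "R\<^sup>2 = t * (R\<^sup>2 - 1)" by simp
  then have tt: "t = R\<^sup>2 / (R\<^sup>2 - 1)" using R by (simp add: field_simps)
  have "d = - (1 / t) *\<^sub>R (R *\<^sub>R e)" using eq \<open>t > 0\<close> by simp
  then have "y = (R - R / t) *\<^sub>R e" unfolding d_def by (simp add: algebra_simps)
  also have "R - R / t = 1 / R"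
  proof -
    have "R / t = (R\<^sup>2 - 1) / R" unfolding tt using assms by (simp add: power2_eq_square)
    then show ?thesis using assms by (simp add: field_simps power2_eq_square)
  qed
  finally show False using assms by (simp add: poles_def)
qed

lemma excess_boundary:
  assumes "y \<bullet> y + 1 = 2 * R * (e \<bullet> y)" "R > 1"
  shows "excess R y = 0"
proof -
  have "R\<^sup>2 - 1 > 0" using assms by (simp add: one_less_power)
  then have "R\<^sup>2 \<noteq> 1" by simp
  then have "rho R y = 1" using assms by (simp add: rho_def dist_centre)
  then show ?thesis by (simp add: excess_def kelvin_def reflect_eq)
qed

lemma rho_pos: "y \<notin> poles R \<Longrightarrow> R > 1 \<Longrightarrow> rho R y > 0"
  by (simp add: rho_def poles_def one_less_power)

lemma kelvin_pos: "y \<notin> poles R \<Longrightarrow> R > 1 \<Longrightarrow> kelvin R y > 0"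
  using pos[OF reflect_nonzero, of y R] rho_pos[of y R] by (simp add: kelvin_def)

text \<open>
  The sphere of inversion is orthogonal to the unit sphere, so on the sphere \<open>S\<^sup>n\<close> the inversion
  is the conformal map that exchanges the two sides of the parallel \<open>z \<bullet> e = 1 / R\<close>. It enlarges
  the smaller cap. In coordinates, the reciprocals of the two sides of the claim differ by
  \<open>1 - |y - R e|\<^sup>2 / (R\<^sup>2 - 1)\<close>.
\<close>

lemma conf_factor_reflect:
  assumes "y \<notin> poles R" "R > 1" "y \<bullet> y + 1 < 2 * R * (e \<bullet> y)"
  shows "conf_factor y < rho R y * conf_factor (reflect R y)"
proof -
  define d where "d = y - R *\<^sub>R e"
  define l where "l = R\<^sup>2 - 1"
  define s where "s = d \<bullet> d"
  define a where "a = e \<bullet> d"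
  have s: "s > 0" using assms by (simp add: s_def d_def poles_def)
  have l: "l > 0" using assms by (simp add: l_def one_less_power)
  have sl: "s < l" using assms dist_centre[of y R] by (simp add: s_def d_def l_def)
  have y: "y = R *\<^sub>R e + d" by (simp add: d_def)
  have yy: "y \<bullet> y + 1 = (l + 2) + 2 * R * a + s"
    unfolding y using e by (simp add: inner_add_left inner_add_right inner_commute[of d e] a_def s_def l_def power2_eq_square algebra_simps)
  have rr: "reflect R y \<bullet> reflect R y + 1 = (l + 2) + 2 * R * (l / s) * a + l\<^sup>2 / s"
  proof -
    have "reflect R y = R *\<^sub>R e + (l / s) *\<^sub>R d" by (simp add: reflect_eq rho_def l_def s_def d_def)
    then show ?thesis using e s
      by (simp add: inner_add_left inner_add_right inner_commute[of d e] a_def[symmetric] s_def[symmetric] l_def power2_eq_square field_simps)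
  qed
  have "s / l * (reflect R y \<bullet> reflect R y + 1) = (y \<bullet> y + 1) - 2 * (1 - s / l)"
    unfolding yy rr using s l by (simp add: field_simps power2_eq_square)
  also have "\<dots> < y \<bullet> y + 1" using sl l by (simp add: pos_divide_less_eq)
  finally have less: "s / l * (reflect R y \<bullet> reflect R y + 1) < y \<bullet> y + 1" .
  have p: "reflect R y \<bullet> reflect R y + 1 > 0" by (simp add: add_nonneg_pos)
  have "conf_factor y < 2 / (s / l * (reflect R y \<bullet> reflect R y + 1))"
    unfolding conf_factor_def
  proof (rule divide_strict_left_mono[OF less])
    have "0 < y \<bullet> y + 1" by (simp add: add_nonneg_pos)
    moreover have "0 < s / l * (reflect R y \<bullet> reflect R y + 1)" using p s l by simp
    ultimately show "0 < (y \<bullet> y + 1) * (s / l * (reflect R y \<bullet> reflect R y + 1))" by (rule mult_pos_pos)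
  qed simp
  also have "\<dots> = rho R y * conf_factor (reflect R y)"
    using s l p by (simp add: rho_def conf_factor_def l_def[symmetric] d_def[symmetric] s_def[symmetric] field_simps)
  finally show ?thesis .
qed

lemma kelvin_lap:
  assumes "y \<notin> poles R" "R > 1"
  shows "has_lap (kelvin R) (- (kelvin R y powr p + c * (rho R y * conf_factor (reflect R y))\<^sup>2 * kelvin R y)) y"
proof -
  have r: "rho R y > 0" and J: "reflect R y \<noteq> 0" using rho_pos reflect_nonzero assms by auto
  have main: "has_lap (kelvin R) (rho R y powr (k + 2) *
      - (u (reflect R y) powr p + c * (conf_factor (reflect R y))\<^sup>2 * u (reflect R y))) y"
    using has_lap_kelvin[of u _ "R *\<^sub>R e" "R\<^sup>2 - 1" y, OF lap[OF J, unfolded reflect_def]] assms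
    by (simp add: kelvin_def[abs_def] rho_def reflect_def k_def[symmetric] poles_def one_less_power)
  have 1: "rho R y powr (k + 2) * u (reflect R y) powr p = kelvin R y powr p"
    using pos[OF J] r by (simp add: kelvin_def powr_mult powr_powr kp)
  have 2: "rho R y powr (k + 2) * u (reflect R y) = (rho R y)\<^sup>2 * kelvin R y"
    using r by (simp add: kelvin_def powr_add)
  have "rho R y powr (k + 2) * - (u (reflect R y) powr p + c * (conf_factor (reflect R y))\<^sup>2 * u (reflect R y))
     = - (rho R y powr (k + 2) * u (reflect R y) powr p
        + c * (conf_factor (reflect R y))\<^sup>2 * (rho R y powr (k + 2) * u (reflect R y)))"
    by (simp add: algebra_simps)
  also have "\<dots> = - (kelvin R y powr p + c * (rho R y * conf_factor (reflect R y))\<^sup>2 * kelvin R y)"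
    unfolding 1 2 by (simp add: power_mult_distrib)
  finally have "rho R y powr (k + 2) * - (u (reflect R y) powr p + c * (conf_factor (reflect R y))\<^sup>2 * u (reflect R y))
     = - (kelvin R y powr p + c * (rho R y * conf_factor (reflect R y))\<^sup>2 * kelvin R y)" .
  with main show ?thesis by simp
qed

text \<open>
  By convexity of the power, the nonlinear terms differ by at least their linearization at \<open>u\<close>.
  What is left over is \<open>c\<close> times the gain in the conformal factor, hence the strict inequality.
\<close>

lemma excess_lap:
  assumes "y \<notin> poles R" "R > 1" "y \<bullet> y + 1 < 2 * R * (e \<bullet> y)"
  obtains L where "has_lap (excess R) L y" "L < - lin_coeff y * excess R y"
proof -
  have y0: "y \<noteq> 0" using moving_ball_nonzero[of y R] assms by (auto simp: moving_ball_def)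
  define K where "K = kelvin R y"
  define U where "U = u y"
  define s where "s = rho R y * conf_factor (reflect R y)"
  have K: "K > 0" and U: "U > 0" using kelvin_pos pos y0 assms by (auto simp: K_def U_def)
  have s: "conf_factor y < s" using conf_factor_reflect assms by (simp add: s_def)
  define L where "L = - (K powr p + c * s\<^sup>2 * K) - - (U powr p + c * (conf_factor y)\<^sup>2 * U)"
  have "has_lap (excess R) L y"
    using has_lap_diff[OF kelvin_lap[OF assms(1,2)] lap[OF y0]]
    by (simp add: excess_def[abs_def] L_def K_def U_def s_def)
  moreover have "(conf_factor y)\<^sup>2 * K < s\<^sup>2 * K"
    using s conf_factor_pos[of y] K by (simp add: power_strict_mono less_imp_le)
  then have "c * ((conf_factor y)\<^sup>2 * K) < c * (s\<^sup>2 * K)" using c_pos by simp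
  then have "L < - lin_coeff y * excess R y"
    using powr_tangent_le[OF U K less_imp_le[OF p_gt_1]]
    by (simp add: L_def lin_coeff_def excess_def K_def[symmetric] U_def[symmetric] algebra_simps)
  ultimately show thesis by (rule that)
qed

end

text \<open>
  The distance to \<open>a\<close> raised to the power \<open>-1/2\<close>. This exponent lies strictly between \<open>2 - n\<close> and
  \<open>0\<close> for every \<open>n \<ge> 3\<close>, so that the barrier is infinite at \<open>a\<close> and its Laplacian is more singular
  than the barrier itself, with a negative sign.
\<close>

definition pole_barrier :: "'a::euclidean_space \<Rightarrow> 'a \<Rightarrow> real" where
  "pole_barrier a y = (sq_dist a y) powr (- 1 / 4)"

text \<open>
  The bound that \<open>pole_barrier_lap\<close> gives for \<open>\<Delta>h + Q h\<close>, where \<open>h\<close> is the pole barrier.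
\<close>

abbreviation pole_term :: "real \<Rightarrow> 'a::euclidean_space \<Rightarrow> 'a \<Rightarrow> real" where
  "pole_term Q a y \<equiv> (Q - 1 / (4 * (sq_dist a y))) * pole_barrier a y"

lemma pole_barrier_lap:
  fixes a y :: "'a::euclidean_space"
  assumes "y \<noteq> a" "3 \<le> DIM('a)"
  obtains L where "has_lap (pole_barrier a) L y"
    "L \<le> - (1 / (4 * (sq_dist a y))) * pole_barrier a y"
proof -
  define t where "t = sq_dist a y"
  have t: "t > 0" using assms by (simp add: t_def)
  define L where "L = 2 * (- 1 / 4) * (2 * (- 1 / 4) - 2 + real DIM('a)) * t powr (- 1 / 4 - 1)"
  have "has_lap (pole_barrier a) L y"
    using has_lap_powr_dist[OF assms(1), of "- 1 / 4"] by (simp only: pole_barrier_def[abs_def] t_def L_def)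
  moreover have "t powr (- 1 / 4 - 1) = t powr (- 1 / 4) / t"
    using t powr_diff[of t "- 1 / 4" 1] by simp
  then have "L = - (real DIM('a) - 5 / 2) / 2 * (t powr (- 1 / 4) / t)"
    unfolding L_def by (simp only:) (simp add: field_simps)
  moreover have "- (real DIM('a) - 5 / 2) / 2 * (t powr (- 1 / 4) / t) \<le> - 1 / 4 * (t powr (- 1 / 4) / t)"
    using assms(2) t by (intro mult_right_mono) auto
  ultimately show thesis
    by (intro that) (auto simp: pole_barrier_def t_def[symmetric])
qed

context moving_spheres begin

text \<open>
  All balls with \<open>R \<le> R2\<close> lie in one compact set that avoids the origin, where \<open>u\<close> is continuous.
\<close>

lemma moving_ball_bounds:
  assumes "R2 > 1"
  obtains Q M where "Q \<ge> 1"
    "\<And>R y. 1 < R \<Longrightarrow> R \<le> R2 \<Longrightarrow> y \<in> moving_ball R \<Longrightarrow> lin_coeff y \<le> Q"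
    "\<And>R y. 1 < R \<Longrightarrow> R \<le> R2 \<Longrightarrow> y \<in> moving_ball R \<Longrightarrow> u y \<le> M"
    "\<And>R y. 1 < R \<Longrightarrow> R \<le> R2 \<Longrightarrow> y \<in> moving_ball R \<Longrightarrow> norm y \<le> 2 * R2"
proof -
  define W where "W = {y :: 'a. y \<bullet> y + 1 \<le> 2 * R2 * norm y}"
  have nW: "norm y \<le> 2 * R2" if "y \<in> W" for y
    using annulus_norm_le[of R2 y] that assms by (simp add: W_def)
  have "compact W" unfolding W_def using assms by (intro compact_annulus) simp
  have W0: "W \<subseteq> - {0}" by (auto simp: W_def)
  have sub: "moving_ball R \<subseteq> W" if "1 < R" "R \<le> R2" for R
  proof
    fix y assume y: "y \<in> moving_ball R"
    have "norm e = 1" using e by (simp add: norm_eq_sqrt_inner)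
    then have "e \<bullet> y \<le> norm y" using norm_cauchy_schwarz[of e y] by simp
    then have "R * (e \<bullet> y) \<le> R2 * norm y"
      using that inner_e_pos[OF y] by (intro mult_mono) auto
    with y show "y \<in> W" by (simp add: moving_ball_def W_def)
  qed
  have "bounded (lin_coeff ` W)" "bounded (u ` W)"
    using compact_continuous_image[OF continuous_on_subset[OF cont_lin_coeff W0] \<open>compact W\<close>]
      compact_continuous_image[OF continuous_on_subset[OF cont_u W0] \<open>compact W\<close>]
    by (auto intro: compact_imp_bounded)
  then obtain Q M where "\<And>y. y \<in> W \<Longrightarrow> \<bar>lin_coeff y\<bar> \<le> Q" "\<And>y. y \<in> W \<Longrightarrow> \<bar>u y\<bar> \<le> M"
    by (auto simp: bounded_iff)
  then show thesis
    using sub nW by (intro that[of "max 1 Q" M]) (auto, (fastforce simp: abs_le_iff le_max_iff_disj)+)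
qed

text \<open>
  The minimum principle for the barrier that consists of the two pole barriers and a regular part
  \<open>g\<close>. The excess is bounded below by \<open>-u\<close>, hence by a constant, and so it is dominated by the
  pole barriers near the poles. On the boundary sphere it vanishes, so negative values occur in
  the interior only.
\<close>

lemma excess_nonneg_criterion:
  fixes g M :: "'a \<Rightarrow> real"
  assumes R: "R > 1"
    and Q: "\<And>y. y \<in> moving_ball R \<Longrightarrow> lin_coeff y \<le> Q"
    and gcont: "continuous_on (moving_ball R) g" and gpos: "\<And>y. y \<in> moving_ball R \<Longrightarrow> 0 \<le> g y"
    and glap: "\<And>y. has_lap g (M y) y"
    and neg: "\<And>y. y \<in> moving_ball R - poles R \<Longrightarrow> excess R y < 0 \<Longrightarrow>
      M y + Q * g y
      + pole_term Q (R *\<^sub>R e) y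
      + pole_term Q ((1 / R) *\<^sub>R e) y < 0"
    and y: "y \<in> moving_ball R - poles R"
  shows "0 \<le> excess R y"
proof -
  define h where "h = (\<lambda>y. pole_barrier (R *\<^sub>R e) y + pole_barrier ((1 / R) *\<^sub>R e) y + g y)"
  obtain Mu where Mu: "\<And>y. y \<in> moving_ball R \<Longrightarrow> u y \<le> Mu" "\<And>y. y \<in> moving_ball R \<Longrightarrow> norm y \<le> 2 * R"
    using moving_ball_bounds[OF R] R by (metis order_refl)
  have ppos: "pole_barrier a z > 0" if "z \<noteq> a" for a z :: 'a
    using that by (simp add: pole_barrier_def)
  have "compact (moving_ball R)"
  proof -
    have "closed (moving_ball R)"
      unfolding moving_ball_def by (intro closed_Collect_le continuous_intros)
    then show ?thesis using Mu(2) by (auto simp: compact_eq_bounded_closed bounded_iff)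
  qed
  moreover have "closed (poles R)" by (simp add: poles_def)
  moreover have exc: "isCont (excess R) z" if z: "z \<in> moving_ball R - poles R" for z
    using has_lap_imp_isCont[OF kelvin_lap[of z R]] has_lap_imp_isCont[OF lap[of z]] z R
      moving_ball_nonzero[of z R] unfolding excess_def[abs_def] by (intro continuous_intros) auto
  then have "continuous_on (moving_ball R - poles R) (excess R)"
    by (intro continuous_at_imp_continuous_on) auto
  moreover have "continuous_on (moving_ball R - poles R) h"
    unfolding h_def pole_barrier_def
    by (intro continuous_intros continuous_on_subset[OF gcont]) (auto simp: poles_def)
  moreover have hpos: "0 < h z" if "z \<in> moving_ball R - poles R" for z
    using gpos[of z] ppos[of z "R *\<^sub>R e"] ppos[of z "(1 / R) *\<^sub>R e"] that by (auto simp: h_def poles_def)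
  moreover have "\<exists>V. open V \<and> poles R \<inter> moving_ball R \<subseteq> V \<and>
       (\<forall>z\<in>V \<inter> (moving_ball R - poles R). - \<epsilon> * h z \<le> excess R z)" if eps: "\<epsilon> > 0" for \<epsilon>
  proof -
    define B where "B = max 1 (Mu / \<epsilon>)"
    have B: "B \<ge> 1" "Mu \<le> \<epsilon> * B" using eps by (auto simp: B_def field_simps max_def)
    define V where "V = {z :: 'a. sq_dist (R *\<^sub>R e) z < B powr (-4)}
        \<union> {z. sq_dist ((1 / R) *\<^sub>R e) z < B powr (-4)}"
    have big: "B \<le> pole_barrier a z" if "z \<noteq> a" "sq_dist a z < B powr (-4)" for a z :: 'a
    proof -
      have "(B powr (-4)) powr (- 1 / 4) \<le> (sq_dist a z) powr (- 1 / 4)"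
        using that by (intro powr_mono2') auto
      then show ?thesis using B by (simp add: powr_powr pole_barrier_def)
    qed
    have "open V" unfolding V_def
      by (intro open_Un open_Collect_less continuous_intros)
    moreover have "poles R \<subseteq> V" using B by (auto simp: poles_def V_def)
    moreover have "- \<epsilon> * h z \<le> excess R z" if z: "z \<in> V \<inter> (moving_ball R - poles R)" for z
    proof -
      have "B \<le> h z"
        using z big[of z "R *\<^sub>R e"] big[of z "(1 / R) *\<^sub>R e"] gpos[of z]
          ppos[of z "R *\<^sub>R e"] ppos[of z "(1 / R) *\<^sub>R e"] by (auto simp: V_def h_def poles_def)
      then have "\<epsilon> * B \<le> \<epsilon> * h z" using eps by simp
      with B(2) Mu(1)[of z] kelvin_pos[of z R] z R show ?thesis by (simp add: excess_def)
    qed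
    ultimately show ?thesis by (intro exI[of _ V]) auto
  qed
  moreover have "z \<in> interior (moving_ball R) \<and>
      (\<exists>L M q. has_lap (excess R) L z \<and> has_lap h M z \<and> L \<le> - q * excess R z \<and> M + q * h z < 0)"
    if z: "z \<in> moving_ball R - poles R" and zneg: "excess R z < 0" for z
  proof -
    have strict: "z \<bullet> z + 1 < 2 * R * (e \<bullet> z)"
      using z zneg excess_boundary[OF _ R, of z] by (force simp: moving_ball_def)
    have "z \<in> interior (moving_ball R)"
    proof (rule interiorI)
      show "open {z. z \<bullet> z + 1 < 2 * R * (e \<bullet> z)}" by (intro open_Collect_less continuous_intros)
    qed (use strict in \<open>auto simp: moving_ball_def\<close>)
    moreover obtain L where L: "has_lap (excess R) L z" "L < - lin_coeff z * excess R z"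
      using excess_lap[OF _ R strict] z by blast
    moreover obtain L1 where L1: "has_lap (pole_barrier (R *\<^sub>R e)) L1 z"
      "L1 \<le> - (1 / (4 * (sq_dist (R *\<^sub>R e) z))) * pole_barrier (R *\<^sub>R e) z"
      using pole_barrier_lap[OF _ dim, of z "R *\<^sub>R e"] z by (auto simp: poles_def)
    moreover obtain L2 where L2: "has_lap (pole_barrier ((1 / R) *\<^sub>R e)) L2 z"
      "L2 \<le> - (1 / (4 * (sq_dist ((1 / R) *\<^sub>R e) z))) * pole_barrier ((1 / R) *\<^sub>R e) z"
      using pole_barrier_lap[OF _ dim, of z "(1 / R) *\<^sub>R e"] z by (auto simp: poles_def)
    moreover have "has_lap h (L1 + L2 + M z) z"
      unfolding h_def by (intro has_lap_add L1(1) L2(1) glap)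
    moreover have "(L1 + L2 + M z) + lin_coeff z * h z < 0"
    proof -
      have "lin_coeff z * h z \<le> Q * h z"
        using Q[of z] hpos[OF z] z by (intro mult_right_mono) auto
      with neg[OF z zneg] L1(2) L2(2) show ?thesis by (simp add: h_def algebra_simps)
    qed
    ultimately show ?thesis by (meson less_imp_le)
  qed
  ultimately show ?thesis using y by (rule quotient_minimum_principle)
qed

text \<open>
  At an interior zero, which is a minimum, the strict inequality of \<open>excess_lap\<close> would make the
  Laplacian negative.
\<close>

lemma excess_strict:
  assumes R: "R > 1" and nonneg: "\<And>y. y \<in> moving_ball R - poles R \<Longrightarrow> 0 \<le> excess R y"
    and y: "y \<notin> poles R" "y \<bullet> y + 1 < 2 * R * (e \<bullet> y)"
  shows "0 < excess R y"
proof (rule ccontr)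
  assume "\<not> 0 < excess R y"
  with nonneg[of y] y have 0: "excess R y = 0" by (force simp: moving_ball_def)
  have "open ({z. z \<bullet> z + 1 < 2 * R * (e \<bullet> z)} - poles R)"
    by (intro open_Diff open_Collect_less continuous_intros) (simp add: poles_def)
  then have "\<forall>\<^sub>F z in nhds y. z \<in> {z. z \<bullet> z + 1 < 2 * R * (e \<bullet> z)} - poles R"
    by (rule eventually_nhds_in_open) (use y in auto)
  then have "\<forall>\<^sub>F z in nhds y. excess R y \<le> excess R z"
    by eventually_elim (use nonneg 0 in \<open>auto simp: moving_ball_def\<close>)
  moreover obtain L where "has_lap (excess R) L y" "L < - lin_coeff y * excess R y"
    using excess_lap[OF y(1) R y(2)] .
  ultimately show False using has_lap_local_min 0 by fastforce
qed

text \<open>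
  For \<open>R\<close> close to \<open>1\<close> the ball has a radius so small that the pole barriers satisfy the required
  inequality on all of it.
\<close>

lemma excess_nonneg_start: "\<exists>R>1. \<forall>y\<in>moving_ball R - poles R. 0 \<le> excess R y"
proof -
  obtain Q M where Q: "Q \<ge> 1" "\<And>R y. 1 < R \<Longrightarrow> R \<le> 2 \<Longrightarrow> y \<in> moving_ball R \<Longrightarrow> lin_coeff y \<le> Q"
    using moving_ball_bounds[of 2] by (metis one_less_numeral_iff semiring_norm(76))
  (* Every point of the ball is within twice the radius of both poles, and the squared distance
     has to stay below 1 / (4 Q). *)
  define l where "l = 1 / (32 * Q)"
  have l: "l > 0" "l \<le> 1" "4 * l * Q < 1 / 4" using Q(1) by (auto simp: l_def field_simps)
  define R where "R = sqrt (1 + l)"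
  have R2: "R\<^sup>2 = 1 + l" using l by (simp add: R_def)
  have R: "R > 1" using l by (simp add: R_def)
  have "R \<le> 2" unfolding R_def using l by (intro real_le_lsqrt) auto
  have cond: "pole_term Q a y < 0"
    if "y \<noteq> a" "norm (y - a) \<le> 2 * sqrt l" for y a :: 'a
  proof -
    have "(norm (y - a))\<^sup>2 \<le> (2 * sqrt l)\<^sup>2" using that by (intro power_mono) auto
    then have "sq_dist a y \<le> 4 * l" using l by (simp add: dot_square_norm power_mult_distrib)
    then have "sq_dist a y * Q \<le> 4 * l * Q" using Q(1) by (intro mult_right_mono) auto
    then have "sq_dist a y * Q < 1 / 4" using l by simp
    then have "Q < 1 / (4 * (sq_dist a y))" using that by (simp add: pos_less_divide_eq mult_ac)
    moreover have "pole_barrier a y > 0" using that by (simp add: pole_barrier_def)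
    ultimately show ?thesis by (simp add: mult_neg_pos)
  qed
  have "0 \<le> excess R y" if y: "y \<in> moving_ball R - poles R" for y
  proof (rule excess_nonneg_criterion[OF R, of Q "\<lambda>_. 0" "\<lambda>_. 0"])
    show "lin_coeff z \<le> Q" if "z \<in> moving_ball R" for z using Q(2)[OF R \<open>R \<le> 2\<close> that] .
    fix z assume z: "z \<in> moving_ball R - poles R"
    have ne: "norm e = 1" using e by (simp add: norm_eq_sqrt_inner)
    have "(norm (z - R *\<^sub>R e))\<^sup>2 \<le> l"
      using z dist_centre[of z R] R2 by (simp add: dot_square_norm moving_ball_def)
    then have n1: "norm (z - R *\<^sub>R e) \<le> sqrt l" by (simp add: real_le_rsqrt)
    have "norm (R *\<^sub>R e - (1 / R) *\<^sub>R e) = \<bar>R - 1 / R\<bar>" 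
      by (simp add: scaleR_diff_left[symmetric] ne del: scaleR_diff_left)
    also have "R - 1 / R = l / R" using R R2 by (simp add: field_simps power2_eq_square)
    also have "\<bar>l / R\<bar> \<le> sqrt l"
    proof -
      have "sqrt l \<le> R" unfolding R_def using l by simp
      then have "sqrt l * sqrt l \<le> sqrt l * R" by (intro mult_left_mono) (use l in auto)
      then show ?thesis using R l by (simp add: field_simps)
    qed
    finally have n2: "norm (z - (1 / R) *\<^sub>R e) \<le> 2 * sqrt l"
      using n1 norm_triangle_ineq[of "z - R *\<^sub>R e" "R *\<^sub>R e - (1 / R) *\<^sub>R e"] by simp
    have "sqrt l \<ge> 0" using l by simp
    with n1 have "norm (z - R *\<^sub>R e) \<le> 2 * sqrt l" by linarith
    from cond[OF _ this] cond[OF _ n2] z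
    show "0 + Q * 0 + pole_term Q (R *\<^sub>R e) z
      + pole_term Q ((1 / R) *\<^sub>R e) z < 0"
      by (force simp: poles_def)
  qed (use y in \<open>auto intro: has_lap_const\<close>)
  with R show ?thesis by blast
qed

end

context moving_spheres begin

lemma excess_continuous_on:
  assumes "\<And>R y. (R, y) \<in> W \<Longrightarrow> 1 < R \<and> y \<notin> poles R \<and> y \<noteq> 0"
  shows "continuous_on W (\<lambda>(R, y). excess R y)"
proof -
  have "continuous_on W (\<lambda>z. u (reflect (fst z) (snd z)))"
  proof (rule continuous_on_compose2[OF cont_u])
    show "continuous_on W (\<lambda>z. reflect (fst z) (snd z))"
      unfolding reflect_eq rho_def using assms
      by (intro continuous_intros) (force simp: poles_def)
    show "(\<lambda>z. reflect (fst z) (snd z)) ` W \<subseteq> - {0}"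
      using assms reflect_nonzero by (force)
  qed
  moreover have "continuous_on W (\<lambda>z. rho (fst z) (snd z) powr k)"
  proof -
    have "(fst z) > 1 \<and> snd z \<notin> poles (fst z)" if "z \<in> W" for z
      using assms[of "fst z" "snd z"] that by simp
    then have pos: "rho (fst z) (snd z) > 0" if "z \<in> W" for z
      using rho_pos that by blast
    have "continuous_on W (\<lambda>z. rho (fst z) (snd z))"
      unfolding rho_def using assms by (intro continuous_intros) (force simp: poles_def)
    with pos show ?thesis by (intro continuous_intros) force+
  qed
  moreover have "continuous_on W (\<lambda>z. u (snd z))"
    using assms by (intro continuous_on_compose2[OF cont_u] continuous_intros) force
  ultimately show ?thesis
    unfolding excess_def kelvin_def split_def by (intro continuous_on_diff continuous_on_mult)
qed

text \<open>
  A function that takes values in \<open>[1, 2]\<close> on the ball with boundary \<open>|y - a|\<^sup>2 = l\<close> and is, for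
  large \<open>\<gamma>\<close>, as strongly superharmonic as desired in a thin shell at the boundary, where the pole
  barriers are of no use.
\<close>

lemma boundary_barrier_lap:
  fixes a y :: 'a
  shows "has_lap (\<lambda>y. 2 - exp (\<gamma> * (sq_dist a y - l)))
    (- (4 * \<gamma>\<^sup>2 * (sq_dist a y) + 2 * real DIM('a) * \<gamma>) * exp (\<gamma> * (sq_dist a y - l))) y"
proof -
  have "has_lap (\<lambda>y. (\<lambda>t. 2 - exp (\<gamma> * (t - l))) (sq_dist a y))
     (4 * (- \<gamma>\<^sup>2 * exp (\<gamma> * (sq_dist a y - l))) * (sq_dist a y)
      + 2 * DIM('a) * (\<lambda>t. - \<gamma> * exp (\<gamma> * (t - l))) (sq_dist a y)) y"
    by (rule has_lap_radial)
       (auto intro!: derivative_eq_intros always_eventually simp: power2_eq_square)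
  then show ?thesis by (simp add: algebra_simps)
qed

text \<open>
  The ball is split into a thin shell at its boundary, two small balls around the poles, and the
  rest. On the rest, which is compact and free of poles, the excess for \<open>R0\<close> is positive by
  \<open>excess_strict\<close>, and positivity persists for nearby \<open>R\<close>. Negative values could therefore occur
  only in the shell, where the boundary barrier satisfies the inequality needed for the minimum
  principle, or near a pole, where a pole barrier does.
\<close>

lemma excess_nonneg_open:
  assumes R0: "R0 > 1" and nonneg: "\<And>y. y \<in> moving_ball R0 - poles R0 \<Longrightarrow> 0 \<le> excess R0 y"
  shows "\<forall>\<^sub>F R in nhds R0. \<forall>y\<in>moving_ball R - poles R. 0 \<le> excess R y"
proof -
  define R1 where "R1 = (1 + R0) / 2"
  define R2 where "R2 = R0 + 1"
  have R12: "1 < R1" "R1 < R0" "R0 < R2" "1 < R2" using R0 by (auto simp: R1_def R2_def)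
  obtain Q M where Q1: "Q \<ge> 1"
    and Q: "\<And>R y. 1 < R \<Longrightarrow> R \<le> R2 \<Longrightarrow> y \<in> moving_ball R \<Longrightarrow> lin_coeff y \<le> Q"
    and nrm: "\<And>R y. 1 < R \<Longrightarrow> R \<le> R2 \<Longrightarrow> y \<in> moving_ball R \<Longrightarrow> norm y \<le> 2 * R2"
    using moving_ball_bounds[OF \<open>1 < R2\<close>] by metis
  define l1 where "l1 = R1\<^sup>2 - 1"
  have l1: "l1 > 0" using R12 by (simp add: l1_def one_less_power)
  define \<gamma> where "\<gamma> = 1 + (2 * Q + 1) / l1"
  have \<gamma>: "\<gamma> \<ge> 1" "2 * Q + 1 \<le> \<gamma> * l1" using l1 Q1 by (auto simp: \<gamma>_def field_simps)
  have \<gamma>2: "2 * Q + 1 \<le> \<gamma>\<^sup>2 * l1"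
  proof -
    have "\<gamma> * l1 \<le> \<gamma>\<^sup>2 * l1" using \<gamma>(1) l1 by (intro mult_right_mono) (auto simp: power2_eq_square)
    with \<gamma>(2) show ?thesis by linarith
  qed
  define \<delta> where "\<delta> = min (l1 / 2) (ln 2 / \<gamma>)"
  have \<delta>: "\<delta> > 0" "\<delta> \<le> l1 / 2" "\<gamma> * \<delta> \<le> ln 2"
    using l1 \<gamma>(1) by (auto simp: \<delta>_def min_def field_simps split: if_splits)
  (* An upper bound for a pole term that is valid at every distance from the pole. *)
  define C1 where "C1 = Q * (4 * Q) powr (1 / 4)"
  have C1: "C1 \<ge> 0" using Q1 by (simp add: C1_def)
  (* In the shell the boundary barrier contributes at most -A, which must outweigh 2 C1 from the poles. *)
  define A where "A = 2 * C1 + 1"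
  (* Within squared distance \<tau> of one pole its barrier outweighs the other one and the boundary barrier. *)
  define \<tau> where "\<tau> = 1 / (4 * (Q + C1 + 2 * Q * A + 1))"
  have den: "Q + C1 + 2 * Q * A + 1 \<ge> 1" using Q1 C1 by (simp add: A_def)
  have \<tau>: "\<tau> > 0" "\<tau> \<le> 1" using den by (auto simp: \<tau>_def field_simps)
  have pole_le: "pole_term Q a y \<le> C1" if "y \<noteq> a" for y a :: 'a
  proof -
    define t where "t = sq_dist a y"
    have t: "t > 0" using that by (simp add: t_def)
    show ?thesis
    proof (cases "1 / (4 * Q) \<le> t")
      case True
      have "(Q - 1 / (4 * t)) * t powr (- 1 / 4) \<le> Q * t powr (- 1 / 4)"
        using t by (intro mult_right_mono) auto
      also have "t powr (- 1 / 4) \<le> (1 / (4 * Q)) powr (- 1 / 4)"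
        using True Q1 by (intro powr_mono2') auto
      also have "(1 / (4 * Q)) powr (- 1 / 4) = (4 * Q) powr (1 / 4)"
        using Q1 by (simp add: powr_minus_divide powr_divide)
      finally show ?thesis using Q1 by (simp add: pole_barrier_def t_def C1_def)
    next
      case False
      then have "Q - 1 / (4 * t) \<le> 0" using t Q1 by (simp add: field_simps)
      then have "(Q - 1 / (4 * t)) * t powr (- 1 / 4) \<le> 0" by (simp add: mult_nonpos_nonneg)
      with C1 show ?thesis by (simp add: pole_barrier_def t_def)
    qed
  qed
  have pole_near: "pole_term Q a y < - (C1 + 2 * Q * A)"
    if "y \<noteq> a" "sq_dist a y < \<tau>" for y a :: 'a
  proof -
    define t where "t = sq_dist a y"
    have t: "t > 0" "t < \<tau>" using that by (auto simp: t_def)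
    have "1 / (4 * \<tau>) = Q + C1 + 2 * Q * A + 1" by (simp add: \<tau>_def)
    moreover have "1 / (4 * \<tau>) < 1 / (4 * t)" using t by (simp add: frac_less2)
    ultimately have neg: "Q - 1 / (4 * t) < - (C1 + 2 * Q * A)" by linarith
    have "1 powr (- 1 / 4) \<le> t powr (- 1 / 4)"
      using t \<tau> by (intro powr_mono2') auto
    then have "1 \<le> t powr (- 1 / 4)" by simp
    moreover have "Q - 1 / (4 * t) \<le> 0" using neg C1 Q1 by (simp add: A_def) (smt (verit) mult_nonneg_nonneg)
    ultimately have "(Q - 1 / (4 * t)) * t powr (- 1 / 4) \<le> (Q - 1 / (4 * t)) * 1"
      by (intro mult_left_mono_neg)
    with neg show ?thesis by (simp add: pole_barrier_def t_def)
  qed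
  define cl where "cl = (\<lambda>(z :: real \<times> 'a). (snd z - fst z *\<^sub>R e) \<bullet> (snd z - fst z *\<^sub>R e))"
  (* All pairs of a parameter and a point of the rest. The distance to the second pole is multiplied
     by R, which makes the condition polynomial and the set visibly closed. *)
  define W where "W = ({R1..R2} \<times> cball 0 (2 * R2)) \<inter>
      ({z. snd z \<bullet> snd z + 1 \<le> 2 * fst z * (e \<bullet> snd z)} \<inter> {z. cl z \<le> (fst z)\<^sup>2 - 1 - \<delta>}
       \<inter> {z. \<tau> \<le> cl z} \<inter> {z. \<tau> * (fst z)\<^sup>2 \<le> (fst z *\<^sub>R snd z - e) \<bullet> (fst z *\<^sub>R snd z - e)})"
  have "compact W"
    unfolding W_def cl_def
    by (intro compact_Int_closed compact_Times closed_Int closed_Collect_le continuous_intros) auto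
  have pole2: "R\<^sup>2 * (sq_dist ((1 / R) *\<^sub>R e) y) = (R *\<^sub>R y - e) \<bullet> (R *\<^sub>R y - e)"
    if "R > 1" for R y
  proof -
    have "R *\<^sub>R y - e = R *\<^sub>R (y - (1 / R) *\<^sub>R e)" using that by (simp add: scaleR_diff_right)
    then show ?thesis by (simp add: power2_eq_square)
  qed
  have W: "1 < R \<and> R \<le> R2 \<and> y \<in> moving_ball R \<and> y \<notin> poles R \<and> y \<bullet> y + 1 < 2 * R * (e \<bullet> y)"
    if "(R, y) \<in> W" for R y
  proof -
    have R: "R > 1" "R \<le> R2" using that R12 by (auto simp: W_def)
    have b: "y \<in> moving_ball R" using that by (auto simp: W_def moving_ball_def)
    have "y \<noteq> R *\<^sub>R e" using that \<tau>(1) by (auto simp: W_def cl_def)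
    moreover have "y \<noteq> (1 / R) *\<^sub>R e"
      using that \<tau>(1) R pole2[OF R(1), of y] by (auto simp: W_def mult_le_0_iff)
    moreover have "y \<bullet> y + 1 < 2 * R * (e \<bullet> y)"
      using that \<delta>(1) dist_centre[of y R] by (auto simp: W_def cl_def)
    ultimately show ?thesis using R b by (simp add: poles_def)
  qed
  define Z where "Z = W \<inter> (\<lambda>(R, y). excess R y) -` {..0}"
  have "continuous_on W (\<lambda>(R, y). excess R y)"
  proof (rule excess_continuous_on)
    fix R y assume "(R, y) \<in> W"
    from W[OF this] show "1 < R \<and> y \<notin> poles R \<and> y \<noteq> 0" using moving_ball_nonzero[of y R] by auto
  qed
  then have "closed Z"
    unfolding Z_def using \<open>compact W\<close> by (intro continuous_closed_preimage) (auto simp: compact_imp_closed)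
  then have "compact Z"
    using \<open>compact W\<close> by (metis Z_def closed_Int_compact compact_Int_closed inf.orderE inf_le1)
  then have "compact (fst ` Z)"
    by (intro compact_continuous_image continuous_intros)
  then have "closed (fst ` Z)" by (rule compact_imp_closed)
  moreover have "R0 \<notin> fst ` Z"
  proof
    assume "R0 \<in> fst ` Z"
    then obtain y where y: "(R0, y) \<in> W" "excess R0 y \<le> 0" by (auto simp: Z_def)
    from W[OF y(1)] excess_strict[OF R0 nonneg, of y] y(2) show False by auto
  qed
  ultimately have "\<forall>\<^sub>F R in nhds R0. R \<in> - (fst ` Z)"
    by (intro eventually_nhds_in_open) auto
  moreover have "\<forall>\<^sub>F R in nhds R0. R \<in> {R1<..<R2}"
    using R12 by (intro eventually_nhds_in_open) auto
  ultimately show ?thesis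
  proof eventually_elim
    case (elim R)
    have R: "1 < R" "R1 \<le> R" "R \<le> R2" using elim R12 by auto
    define l where "l = R\<^sup>2 - 1"
    have l: "l1 \<le> l" using R R12 by (auto simp: l_def l1_def intro: power_mono)
    define g0 where "g0 = (\<lambda>y. 2 - exp (\<gamma> * (sq_dist (R *\<^sub>R e) y - l)))"
    define M0 where "M0 = (\<lambda>y. - (4 * \<gamma>\<^sup>2 * (sq_dist (R *\<^sub>R e) y) + 2 * real DIM('a) * \<gamma>)
        * exp (\<gamma> * (sq_dist (R *\<^sub>R e) y - l)))"
    have g0lap: "has_lap g0 (M0 y) y" for y
      unfolding g0_def M0_def by (rule boundary_barrier_lap)
    have g0: "0 \<le> g0 y" "g0 y \<le> 2" if "y \<in> moving_ball R" for y
    proof -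
      have "sq_dist (R *\<^sub>R e) y - l \<le> 0"
        using that dist_centre[of y R] by (simp add: moving_ball_def l_def)
      then have "exp (\<gamma> * (sq_dist (R *\<^sub>R e) y - l)) \<le> exp 0"
        using \<gamma>(1) by (subst exp_le_cancel_iff) (simp add: mult_nonneg_nonpos)
      then show "0 \<le> g0 y" unfolding g0_def exp_zero by linarith
      show "g0 y \<le> 2" by (simp add: g0_def)
    qed
    have M0: "M0 y \<le> 0" for y
    proof -
      have "0 \<le> 4 * \<gamma>\<^sup>2 * (sq_dist (R *\<^sub>R e) y) + 2 * real DIM('a) * \<gamma>"
        using \<gamma>(1) by simp
      then show ?thesis unfolding M0_def by (intro mult_nonpos_nonneg) (linarith, simp)
    qed
    show ?case
    proof
      fix y assume y: "y \<in> moving_ball R - poles R"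
      show "0 \<le> excess R y"
      proof (rule excess_nonneg_criterion[OF R(1), of Q "\<lambda>y. A * g0 y" "\<lambda>y. A * M0 y", OF _ _ _ _ _ y])
        fix z assume z: "z \<in> moving_ball R"
        show "lin_coeff z \<le> Q" using Q[OF R(1,3) z] .
        show "0 \<le> A * g0 z" using g0[OF z] C1 by (simp add: A_def)
      next
        show "continuous_on (moving_ball R) (\<lambda>y. A * g0 y)"
          unfolding g0_def by (intro continuous_intros)
        show "has_lap (\<lambda>y. A * g0 y) (A * M0 z) z" for z using has_lap_cmul[OF g0lap] .
        fix z assume z: "z \<in> moving_ball R - poles R" and neg: "excess R z < 0"
        define s where "s = sq_dist (R *\<^sub>R e) z"
        define t where "t = sq_dist ((1 / R) *\<^sub>R e) z"
        define h1 where "h1 = (Q - 1 / (4 * s)) * pole_barrier (R *\<^sub>R e) z"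
        define h2 where "h2 = (Q - 1 / (4 * t)) * pole_barrier ((1 / R) *\<^sub>R e) z"
        have zp: "z \<noteq> R *\<^sub>R e" "z \<noteq> (1 / R) *\<^sub>R e" using z by (auto simp: poles_def)
        have h: "h1 \<le> C1" "h2 \<le> C1" using pole_le zp by (auto simp: h1_def h2_def s_def t_def)
        have "A > 0" using C1 by (simp add: A_def)
        then have AQ: "A * M0 z \<le> 0" "Q * (A * g0 z) \<le> 2 * Q * A"
          using M0[of z] g0[of z] z Q1 mult_left_mono[of "g0 z" 2 "Q * A"]
          by (auto simp: mult_nonneg_nonpos mult_ac)
        have "(R, z) \<notin> W"
        proof
          assume "(R, z) \<in> W"
          then have "(R, z) \<in> Z" using neg by (auto simp: Z_def)
          with elim(1) show False by force
        qed
        moreover have "norm z \<le> 2 * R2" using nrm[OF R(1,3)] z by auto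
        moreover have "t < \<tau>" if "(R *\<^sub>R z - e) \<bullet> (R *\<^sub>R z - e) < \<tau> * R\<^sup>2"
        proof -
          have "R\<^sup>2 * t < R\<^sup>2 * \<tau>" using that pole2[OF R(1), of z] by (simp add: t_def mult.commute)
          then show ?thesis using R(1) by simp
        qed
        ultimately consider "l - \<delta> < s" | "s < \<tau>" | "t < \<tau>"
          using z R by (auto simp: W_def cl_def moving_ball_def s_def l_def not_le mult.commute)
        then have "A * M0 z + Q * (A * g0 z) + h1 + h2 < 0"
        proof cases
          case 1
          have s0: "0 \<le> s" by (simp add: s_def)
          have "exp (- ln 2) \<le> exp (\<gamma> * (s - l))"
          proof (subst exp_le_cancel_iff)
            have "\<gamma> * (l - s) \<le> \<gamma> * \<delta>" using 1 \<gamma>(1) by (intro mult_left_mono) auto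
            with \<delta>(3) show "- ln 2 \<le> \<gamma> * (s - l)" by (simp add: algebra_simps)
          qed
          then have E: "1 / 2 \<le> exp (\<gamma> * (s - l))" by (simp add: exp_minus)
          have "2 * \<gamma>\<^sup>2 * l1 \<le> 4 * \<gamma>\<^sup>2 * s"
            using 1 \<delta>(2) l mult_left_mono[of "l1 / 2" s "4 * \<gamma>\<^sup>2"] by simp
          then have "2 * \<gamma>\<^sup>2 * l1 \<le> 4 * \<gamma>\<^sup>2 * s + 2 * real DIM('a) * \<gamma>" using \<gamma>(1) by (simp add: add_increasing2)
          then have "2 * \<gamma>\<^sup>2 * l1 * (1 / 2) \<le> (4 * \<gamma>\<^sup>2 * s + 2 * real DIM('a) * \<gamma>) * exp (\<gamma> * (s - l))"
            using E l1 \<gamma>(1) s0 by (intro mult_mono) auto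
          with \<gamma>2 have "M0 z \<le> - (2 * Q + 1)" unfolding M0_def s_def[symmetric] by linarith
          then have "A * M0 z \<le> A * (- (2 * Q + 1))" using C1 by (intro mult_left_mono) (auto simp: A_def)
          with AQ(2) h show ?thesis by (simp add: algebra_simps A_def)
        next
          case 2
          then have "h1 < - (C1 + 2 * Q * A)" using pole_near zp(1) by (simp add: h1_def s_def)
          with AQ h show ?thesis by linarith
        next
          case 3
          then have "h2 < - (C1 + 2 * Q * A)" using pole_near zp(2) by (simp add: h2_def t_def)
          with AQ h show ?thesis by linarith
        qed
        then show "A * M0 z + Q * (A * g0 z)
          + pole_term Q (R *\<^sub>R e) z
          + pole_term Q ((1 / R) *\<^sub>R e) z < 0"
          by (simp add: h1_def h2_def s_def t_def)
      qed
    qed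
  qed
qed

text \<open>
  The good parameters form a subset of \<open>(1, \<infinity>)\<close> that is open, nonempty and has an open complement:
  a negative value at one point persists for nearby parameters.
\<close>

lemma excess_nonneg:
  assumes "R > 1" "y \<in> moving_ball R - poles R"
  shows "0 \<le> excess R y"
proof -
  define T where "T = {R. R > 1 \<and> (\<forall>y\<in>moving_ball R - poles R. 0 \<le> excess R y)}"
  have "open T"
  proof (rule openI)
    fix R assume 1: "R \<in> T"
    have "\<forall>\<^sub>F R' in nhds R. R' \<in> {1<..}" using 1 by (intro eventually_nhds_in_open) (auto simp: T_def)
    moreover have "\<forall>\<^sub>F R' in nhds R. \<forall>y\<in>moving_ball R' - poles R'. 0 \<le> excess R' y"
      using 1 by (intro excess_nonneg_open) (auto simp: T_def)
    ultimately have "\<forall>\<^sub>F R' in nhds R. R' \<in> T" by eventually_elim (auto simp: T_def)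
    then show "\<exists>\<epsilon>>0. ball R \<epsilon> \<subseteq> T" by (auto simp: eventually_nhds_metric subset_eq dist_commute)
  qed
  moreover have "open ({1<..} - T)"
  proof (rule openI)
    fix R assume 1: "R \<in> {1<..} - T"
    then obtain y where y: "y \<in> moving_ball R" "y \<notin> poles R" "excess R y < 0" and R: "R > 1"
      by (auto simp: T_def not_le)
    have strict: "y \<bullet> y + 1 < 2 * R * (e \<bullet> y)"
      using y excess_boundary[OF _ R, of y] by (force simp: moving_ball_def)
    define W where "W = {R'. R' > 1 \<and> y \<notin> poles R'}"
    have y0: "y \<noteq> 0" using moving_ball_nonzero[OF y(1)] R by simp
    have "y = (1 / R') *\<^sub>R e \<longleftrightarrow> e = R' *\<^sub>R y" if "R' > 1" for R'
      using that by auto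
    then have "W = {1<..} \<inter> {R'. R' *\<^sub>R e \<noteq> y} \<inter> {R'. e \<noteq> R' *\<^sub>R y}"
      by (auto simp: W_def poles_def)
    then have "open W"
      by (auto intro!: open_Int open_Collect_neq continuous_intros)
    have "continuous_on W (\<lambda>R'. excess R' y)"
    proof -
      have "continuous_on ((\<lambda>R'. (R', y)) ` W) (\<lambda>(R, y). excess R y)"
        by (rule excess_continuous_on) (use y0 in \<open>auto simp: W_def\<close>)
      from continuous_on_compose2[OF this, of W "\<lambda>R'. (R', y)"] show ?thesis
        by (simp add: continuous_on_Pair continuous_on_id)
    qed
    then have "isCont (\<lambda>R'. excess R' y) R"
      using \<open>open W\<close> y R continuous_on_eq_continuous_at[of W] unfolding W_def by blast
    then have "\<forall>\<^sub>F R' in nhds R. excess R' y < 0"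
      using y(3) order_tendstoD(2)[of "\<lambda>R'. excess R' y" "excess R y" "nhds R" 0]
        tendsto_at_iff_tendsto_nhds[of "\<lambda>R'. excess R' y" R]
      by (simp add: isCont_def)
    moreover have "\<forall>\<^sub>F R' in nhds R. R' \<in> {R'. y \<bullet> y + 1 < 2 * R' * (e \<bullet> y)}"
      by (rule eventually_nhds_in_open) (use strict in \<open>auto intro!: open_Collect_less continuous_intros\<close>)
    moreover have "\<forall>\<^sub>F R' in nhds R. R' \<in> W"
      using \<open>open W\<close> y R by (intro eventually_nhds_in_open) (auto simp: W_def)
    ultimately have "\<forall>\<^sub>F R' in nhds R. R' \<in> {1<..} - T"
      by eventually_elim (force simp: T_def W_def moving_ball_def)
    then show "\<exists>\<epsilon>>0. ball R \<epsilon> \<subseteq> {1<..} - T" by (auto simp: eventually_nhds_metric subset_eq dist_commute)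
  qed
  moreover have "connected {1 :: real<..}" by simp
  moreover have "T \<inter> {1<..} \<noteq> {}" using excess_nonneg_start by (auto simp: T_def)
  ultimately have "({1<..} - T) \<inter> {1<..} = {}"
    using connectedD[of "{1 :: real<..}" T "{1<..} - T"] by (auto simp: T_def)
  with assms show ?thesis by (auto simp: T_def)
qed

text \<open>
  As \<open>R \<rightarrow> \<infinity>\<close>, the spheres converge to the hyperplane through the origin orthogonal to \<open>e\<close>, the
  inversions to the reflection in it, and the Kelvin factor to \<open>1\<close>.
\<close>

lemma le_hyperplane_reflection:
  assumes ey: "e \<bullet> y > 0"
  shows "u y \<le> u (y - (2 * (e \<bullet> y)) *\<^sub>R e)"
proof -
  define a where "a = e \<bullet> y"
  define b where "b = y \<bullet> y"
  have a: "a > 0" using ey by (simp add: a_def)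
  have y0: "y \<noteq> 0" using ey by auto
  have rho: "rho R y = (R\<^sup>2 - 1) / (R\<^sup>2 - 2 * R * a + b)" for R
    unfolding rho_def dist_centre a_def b_def by (simp add: algebra_simps)
  have "((\<lambda>R. (R\<^sup>2 - 1) / (R\<^sup>2 - 2 * R * a + b)) \<longlongrightarrow> 1) at_top"
    by real_asymp
  then have lim1: "((\<lambda>R. rho R y) \<longlongrightarrow> 1) at_top" by (simp add: rho)
  have "((\<lambda>R. R * (1 - (R\<^sup>2 - 1) / (R\<^sup>2 - 2 * R * a + b))) \<longlongrightarrow> - 2 * a) at_top"
    using a by real_asymp
  then have lim2: "((\<lambda>R. R * (1 - rho R y)) \<longlongrightarrow> - 2 * a) at_top" by (simp add: rho)
  have eq: "reflect R y = (R * (1 - rho R y)) *\<^sub>R e + rho R y *\<^sub>R y" for R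
    by (simp add: reflect_eq algebra_simps)
  have "((\<lambda>R. reflect R y) \<longlongrightarrow> (- 2 * a) *\<^sub>R e + 1 *\<^sub>R y) at_top"
    unfolding eq by (intro tendsto_intros lim1 lim2)
  then have lim3: "((\<lambda>R. reflect R y) \<longlongrightarrow> y - (2 * a) *\<^sub>R e) at_top" by simp
  have "(y - (2 * a) *\<^sub>R e) \<bullet> (y - (2 * a) *\<^sub>R e) = y \<bullet> y"
    using e by (simp add: inner_diff_left inner_diff_right inner_commute[of y e] a_def)
  then have "y - (2 * a) *\<^sub>R e \<noteq> 0" using y0 by (metis inner_eq_zero_iff)
  then have "isCont u (y - (2 * a) *\<^sub>R e)" by (rule has_lap_imp_isCont[OF lap])
  from isCont_tendsto_compose[OF this lim3]
  have "((\<lambda>R. rho R y powr k * u (reflect R y)) \<longlongrightarrow> 1 powr k * u (y - (2 * a) *\<^sub>R e)) at_top"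
    by (intro tendsto_intros lim1) auto
  then have "((\<lambda>R. kelvin R y) \<longlongrightarrow> u (y - (2 * a) *\<^sub>R e)) at_top" by (simp add: kelvin_def)
  moreover have "\<forall>\<^sub>F R in at_top. u y \<le> kelvin R y"
  proof -
    have "\<forall>\<^sub>F R in at_top. R > max (max 1 ((b + 1) / (2 * a))) (max a (1 / a))"
      by (rule eventually_gt_at_top)
    then show ?thesis
    proof eventually_elim
      case (elim R)
      then have R: "R > 1" "(b + 1) / (2 * a) < R" "a < R" "1 / a < R" by auto
      have "y \<in> moving_ball R"
        using R(2) a by (simp add: moving_ball_def a_def[symmetric] b_def[symmetric] field_simps)
      moreover have "y \<noteq> R *\<^sub>R e" using R(3) e by (auto simp: a_def)
      moreover have "y \<noteq> (1 / R) *\<^sub>R e"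
      proof
        assume "y = (1 / R) *\<^sub>R e"
        then have "a = 1 / R" using e by (simp add: a_def)
        with R(1,4) show False by simp
      qed
      ultimately show ?case using excess_nonneg[OF R(1), of y] by (simp add: poles_def excess_def)
    qed
  qed
  ultimately show ?thesis unfolding a_def by (rule tendsto_lowerbound) simp
qed

end

context flat_solution begin

text \<open>
  Two points of equal norm are mirror images in the hyperplane orthogonal to their difference.
\<close>

lemma radial_le:
  assumes "norm y = norm z" "y \<noteq> 0"
  shows "u y \<le> u z"
proof (cases "y = z")
  case False
  define e where "e = (1 / norm (y - z)) *\<^sub>R (y - z)"
  have n: "norm (y - z) > 0" using False by simp
  have ee: "e \<bullet> e = 1"
    using n by (simp add: e_def dot_square_norm power2_eq_square)
  interpret moving_spheres u c k p e by unfold_locales (rule ee)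
  have yz: "y \<bullet> y = z \<bullet> z" using assms(1) by (simp add: dot_square_norm)
  have "(norm (y - z))\<^sup>2 = 2 * ((y - z) \<bullet> y)"
    using yz by (simp add: dot_square_norm[symmetric] inner_diff_left inner_diff_right inner_commute)
  then have "(y - z) \<bullet> y = norm (y - z) * norm (y - z) / 2" by (simp add: power2_eq_square)
  then have ey: "e \<bullet> y = norm (y - z) / 2"
    using n unfolding e_def inner_scaleR_left by simp
  have "y - (2 * (e \<bullet> y)) *\<^sub>R e = z" unfolding ey using n by (simp add: e_def)
  moreover have "0 < e \<bullet> y" using ey n by linarith
  ultimately show ?thesis using le_hyperplane_reflection[of y] by metis
qed simp

theorem radial:
  assumes "norm y = norm z" "y \<noteq> 0"
  shows "u y = u z"
  using radial_le[of y z] radial_le[of z y] assms by (metis norm_eq_zero order_antisym)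

end

section \<open>The Laplace--Beltrami operator in the stereographic chart\<close>

lemma has_hess_unique:
  fixes x :: "'a::euclidean_space"
  assumes "has_hess f G H x" "has_hess f G2 H2 x"
  shows "G x = G2 x" "H = H2"
proof -
  have "\<forall>\<^sub>F y in nhds x. G y = G2 y"
    using conjunct1[OF assms(1)[unfolded has_hess_def]] conjunct1[OF assms(2)[unfolded has_hess_def]]
  proof eventually_elim
    case (elim y)
    from has_derivative_unique[OF elim] have "G y \<bullet> h = G2 y \<bullet> h" for h by metis
    then show ?case by (metis vector_eq_rdot)
  qed
  then show "G x = G2 x" by (rule eventually_nhds_x_imp_x)
  from \<open>\<forall>\<^sub>F y in nhds x. G y = G2 y\<close> have "\<forall>\<^sub>F y in at x. G y = G2 y"
    unfolding eventually_at_filter by eventually_elim simp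
  then have "(G2 has_derivative H) (at x)"
    using assms(1) \<open>G x = G2 x\<close> unfolding has_hess_def
    by (blast intro: has_derivative_transform_eventually)
  then show "H = H2" using assms(2) has_derivative_unique unfolding has_hess_def by blast
qed

lemma has_lap_unique: "has_lap f L x \<Longrightarrow> has_lap f M x \<Longrightarrow> L = M"
  unfolding has_lap_def using has_hess_unique by metis

lemma C2_on_imp_has_hess:
  fixes f :: "'a::euclidean_space \<Rightarrow> real"
  assumes "C2_on U f" "x \<in> U"
  obtains G H where "has_hess f G H x"
proof -
  obtain f' :: "'a \<Rightarrow> 'a \<Rightarrow>\<^sub>L real" and f'' :: "'a \<Rightarrow> 'a \<Rightarrow>\<^sub>L 'a \<Rightarrow>\<^sub>L real" where "open U"
    and d1: "\<And>x. x \<in> U \<Longrightarrow> (f has_derivative blinfun_apply (f' x)) (at x)"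
    and d2: "\<And>x. x \<in> U \<Longrightarrow> (f' has_derivative blinfun_apply (f'' x)) (at x)"
    using assms(1) unfolding C2_on_def by metis
  define G where "G = (\<lambda>y. \<Sum>b\<in>Basis. f' y b *\<^sub>R b)"
  define H where "H = (\<lambda>h. \<Sum>b\<in>Basis. f'' x h b *\<^sub>R b)"
  have G: "blinfun_apply (f' y) = (\<lambda>h. G y \<bullet> h)" for y
  proof
    fix h
    have "f' y h = f' y (\<Sum>b\<in>Basis. (h \<bullet> b) *\<^sub>R b)" by (simp add: euclidean_representation)
    also have "\<dots> = (\<Sum>b\<in>Basis. (h \<bullet> b) * f' y b)"
      by (simp only: blinfun.sum_right blinfun.scaleR_right real_scaleR_def)
    finally show "f' y h = G y \<bullet> h" by (simp add: G_def inner_sum_left inner_commute[of h] mult.commute)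
  qed
  have "\<forall>\<^sub>F y in nhds x. y \<in> U" using \<open>open U\<close> assms(2) by (rule eventually_nhds_in_open)
  then have "\<forall>\<^sub>F y in nhds x. (f has_derivative (\<lambda>h. G y \<bullet> h)) (at y)"
    by eventually_elim (use d1 G in auto)
  moreover have "(G has_derivative H) (at x)"
    unfolding G_def H_def using d2[OF assms(2)]
    by (auto intro!: derivative_eq_intros)
  ultimately show thesis by (intro that[of G H]) (simp add: has_hess_def)
qed

lemma sum_Basis_vec: "(\<Sum>b\<in>(Basis :: (real ^ 'n::finite) set). F b) = (\<Sum>i\<in>UNIV. F (axis i 1))"
proof -
  have B: "(Basis :: (real ^ 'n) set) = range (\<lambda>i. axis i 1)" by (auto simp: Basis_vec_def)
  have "sum F (range (\<lambda>i. axis i 1 :: real ^ 'n)) = sum (F \<circ> (\<lambda>i. axis i 1)) UNIV"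
    by (rule sum.reindex) (simp add: inj_on_def axis_eq_axis)
  then show ?thesis unfolding B by (simp add: o_def)
qed

lemma stereo_north_conf: "stereo_north y = (conf_factor y *\<^sub>R y, 1 - conf_factor y)"
proof -
  have "y \<bullet> y + 1 > 0" by (simp add: add_nonneg_pos)
  then show ?thesis by (simp add: stereo_north_def conf_factor_def field_simps)
qed

lemma conf_factor_sq: "conf_factor y * (y \<bullet> y + 1) = 2"
proof -
  have "y \<bullet> y + 1 > 0" by (simp add: add_nonneg_pos)
  then show ?thesis unfolding conf_factor_def by (metis less_irrefl nonzero_divide_eq_eq)
qed

lemma inj_stereo_north: "inj (stereo_north :: real ^ 'n::finite \<Rightarrow> 'n ambient)"
proof (rule injI)
  fix x y :: "real ^ 'n" assume "stereo_north x = stereo_north y"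
  then have "conf_factor x *\<^sub>R x = conf_factor y *\<^sub>R y" "conf_factor x = conf_factor y"
    by (auto simp: stereo_north_conf)
  with conf_factor_pos[of x] show "x = y" by simp
qed

lemma stereo_north_in_punctured_sphere: "stereo_north y \<in> punctured_sphere \<longleftrightarrow> y \<noteq> 0"
proof -
  have "conf_factor y * conf_factor y * (y \<bullet> y) + (1 - conf_factor y) * (1 - conf_factor y)
      = conf_factor y * (conf_factor y * (y \<bullet> y + 1)) + 1 - 2 * conf_factor y"
    by (simp add: algebra_simps)
  also have "\<dots> = 1" by (simp add: conf_factor_sq)
  finally have 1: "norm (stereo_north y) = 1"
    by (simp add: norm_eq_sqrt_inner stereo_north_conf)
  have 2: "stereo_north y \<noteq> north"
    using conf_factor_pos[of y] by (auto simp: stereo_north_conf north_def)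
  have "stereo_north y = south \<longleftrightarrow> y = 0"
    using conf_factor_pos[of y] by (auto simp: stereo_north_conf south_def) (simp add: conf_factor_def)
  with 1 2 show ?thesis by (auto simp: punctured_sphere_def unit_sphere_def)
qed

lemma conf_factor_has_derivative:
  "(conf_factor has_derivative (\<lambda>h. - (conf_factor y)\<^sup>2 * (y \<bullet> h))) (at (y::'a::real_inner))"
proof -
  have "y \<bullet> y + 1 > 0" by (simp add: add_nonneg_pos)
  then show ?thesis
    unfolding conf_factor_def[abs_def]
    by (auto intro!: derivative_eq_intros simp: inner_commute field_simps power2_eq_square)
qed

lemma metric_coeffs_stereo_north:
  "metric_coeffs stereo_north y = (conf_factor y)\<^sup>2 *\<^sub>R (mat 1 :: real ^ 'n::finite ^ 'n)"
proof -
  define w where "w = conf_factor y"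
  have "(stereo_north has_derivative
      (\<lambda>h. (w *\<^sub>R h + (- w\<^sup>2 * (y \<bullet> h)) *\<^sub>R y, w\<^sup>2 * (y \<bullet> h)))) (at y)"
    unfolding stereo_north_conf[abs_def] w_def
    by (auto intro!: derivative_eq_intros conf_factor_has_derivative)
  then have pd: "partial_deriv i stereo_north y = 
      (w *\<^sub>R axis i 1 + (- w\<^sup>2 * (y $ i)) *\<^sub>R y, w\<^sup>2 * (y $ i))" for i
    unfolding partial_deriv_def by (simp add: frechet_derivative_at[symmetric] inner_axis)
  have "partial_deriv i stereo_north y \<bullet> partial_deriv j stereo_north y = (if i = j then w\<^sup>2 else 0)" for i j
  proof -
    have "axis i (1::real) \<bullet> axis j 1 = (if i = j then 1 else (0::real))" by (simp add: inner_axis_axis)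
    then have "partial_deriv i stereo_north y \<bullet> partial_deriv j stereo_north y
       = (if i = j then w\<^sup>2 else 0) + w ^ 3 * (y $ i) * (y $ j) * (w * (y \<bullet> y + 1) - 2)"
      unfolding pd by (simp add: inner_add_left inner_add_right inner_axis inner_commute[of "axis _ _" y] algebra_simps power2_eq_square power3_eq_cube)
    then show ?thesis by (simp add: w_def conf_factor_sq)
  qed
  then show ?thesis
    by (simp add: metric_coeffs_def mat_def vec_eq_iff w_def)
qed

lemma matrix_inv_scaled_identity:
  fixes s :: real
  assumes "s \<noteq> 0"
  shows "matrix_inv (s *\<^sub>R (mat 1 :: real ^ 'n::finite ^ 'n)) = (1 / s) *\<^sub>R mat 1"
proof -
  let ?A = "s *\<^sub>R (mat 1 :: real ^ 'n ^ 'n)"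
  have "?A ** ((1 / s) *\<^sub>R mat 1) = mat 1" "((1 / s) *\<^sub>R mat 1) ** ?A = mat 1"
    using assms by (simp_all add: matrix_scalar_ac scalar_matrix_assoc[symmetric])
  then have "?A ** matrix_inv ?A = mat 1 \<and> matrix_inv ?A ** ?A = mat 1"
    unfolding matrix_inv_def by (intro someI) auto
  then have "s *\<^sub>R matrix_inv ?A = mat 1" by (simp add: scalar_matrix_assoc[symmetric])
  then have "(1 / s) *\<^sub>R (s *\<^sub>R matrix_inv ?A) = (1 / s) *\<^sub>R mat 1" by simp
  then show ?thesis using assms by simp
qed

lemma det_scaled_identity: "det (s *\<^sub>R (mat 1 :: real ^ 'n::finite ^ 'n)) = s ^ CARD('n)"
  by (subst det_diagonal) (auto simp: mat_def)

text \<open>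
  For a metric \<open>\<psi>\<^sup>2\<close> times the flat one the divergence form reads \<open>\<psi>\<^sup>-\<^sup>n \<Sum>\<^sub>i \<partial>\<^sub>i (\<psi>\<^sup>n\<^sup>-\<^sup>2 \<partial>\<^sub>i f)\<close>,
  and \<open>\<psi>\<close> has the gradient \<open>-\<psi>\<^sup>2 x\<close>.
\<close>

lemma laplace_beltrami_stereo_north:
  fixes v :: "'n::finite ambient \<Rightarrow> real"
  assumes dim: "CARD('n) \<ge> 3" and f: "has_hess (v \<circ> stereo_north) G H x"
  shows "(conf_factor x)\<^sup>2 * laplace_beltrami_coords stereo_north v x
     = lin_trace H - (real CARD('n) - 2) * conf_factor x * (x \<bullet> G x)"
proof -
  (* Natural number exponents make the power rule applicable; m - 1 is a genuine difference as n \<ge> 3. *)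
  define m where "m = CARD('n) - 2"
  have m: "CARD('n) = m + 2" "m \<ge> 1" using dim by (auto simp: m_def)
  define w where "w = conf_factor x"
  have w: "w > 0" using conf_factor_pos by (simp add: w_def)
  have sq: "sqrt (det (metric_coeffs stereo_north y)) = conf_factor y ^ (m + 2)" for y :: "real ^ 'n"
  proof -
    have "det (metric_coeffs stereo_north y) = (conf_factor y ^ (m + 2))\<^sup>2"
      unfolding metric_coeffs_stereo_north det_scaled_identity m(1) by (simp only: power_mult[symmetric] mult.commute)
    then show ?thesis using conf_factor_pos[of y] by simp
  qed
  define flux where "flux = (\<lambda>i y. sqrt (det (metric_coeffs stereo_north y)) *
      (\<Sum>j\<in>UNIV. matrix_inv (metric_coeffs stereo_north y) $ i $ j * partial_deriv j (v \<circ> stereo_north) y))"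
  have ev: "\<forall>\<^sub>F y in nhds x. \<forall>i. flux i y
      = conf_factor y ^ m * (G y $ i)"
    using conjunct1[OF f[unfolded has_hess_def]]
  proof eventually_elim
    case (elim y)
    have "frechet_derivative (v \<circ> stereo_north) (at y) = (\<lambda>h. G y \<bullet> h)"
      using frechet_derivative_at[OF elim] by simp
    then have pd: "partial_deriv j (v \<circ> stereo_north) y = G y $ j" for j
      by (simp add: partial_deriv_def inner_axis)
    have nz: "(conf_factor y)\<^sup>2 \<noteq> 0" using conf_factor_pos[of y] by simp
    have "(\<Sum>j\<in>UNIV. matrix_inv (metric_coeffs stereo_north y) $ i $ j * partial_deriv j (v \<circ> stereo_north) y)
        = 1 / (conf_factor y)\<^sup>2 * (G y $ i)" for i
      unfolding metric_coeffs_stereo_north pd matrix_inv_scaled_identity[OF nz]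
      by (simp add: mat_def if_distrib[of "\<lambda>z. _ * z"] if_distrib[of "\<lambda>z. z * _"] cong: if_cong)
    then show ?case
      using conf_factor_pos[of y] by (simp add: flux_def sq power_add power2_eq_square)
  qed
  have pd: "partial_deriv i (flux i) x
      = - real m * w ^ (m + 1) * (x $ i * G x $ i) + w ^ m * (H (axis i 1) $ i)" for i
  proof -
    have GH: "(G has_derivative H) (at x)" using f by (simp add: has_hess_def)
    have "((\<lambda>y. conf_factor y ^ m * (G y $ i)) has_derivative
        (\<lambda>h. w ^ m * (H h $ i) + (real m * (- w\<^sup>2 * (x \<bullet> h)) * w ^ (m - 1)) * (G x $ i))) (at x)"
      unfolding w_def
      by (intro has_derivative_mult has_derivative_power conf_factor_has_derivative
          bounded_linear.has_derivative[OF bounded_linear_vec_nth GH])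
    moreover have e: "\<forall>\<^sub>F y in nhds x. conf_factor y ^ m * (G y $ i) = flux i y"
      using ev by eventually_elim simp
    ultimately have "((flux i) has_derivative
        (\<lambda>h. w ^ m * (H h $ i) + (real m * (- w\<^sup>2 * (x \<bullet> h)) * w ^ (m - 1)) * (G x $ i))) (at x)"
      using e by (auto intro: has_derivative_transform_eventually simp: eventually_nhds_conv_at)
    from frechet_derivative_at[OF this] m(2) show ?thesis
      unfolding partial_deriv_def
      by (cases m) (simp_all add: fun_eq_iff inner_axis power2_eq_square algebra_simps)
  qed
  have "laplace_beltrami_coords stereo_north v x
      = 1 / sqrt (det (metric_coeffs stereo_north x)) * (\<Sum>i\<in>UNIV. partial_deriv i (flux i) x)"
    by (simp only: laplace_beltrami_coords_def flux_def)
  also have "\<dots>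
     = 1 / w ^ (m + 2) * (\<Sum>i\<in>UNIV. - real m * w ^ (m + 1) * (x $ i * G x $ i) + w ^ m * (H (axis i 1) $ i))"
    unfolding pd sq w_def ..
  also have "(\<Sum>i\<in>UNIV. - real m * w ^ (m + 1) * (x $ i * G x $ i) + w ^ m * (H (axis i 1) $ i))
     = - real m * w ^ (m + 1) * (x \<bullet> G x) + w ^ m * lin_trace H"
  proof -
    have "lin_trace H = (\<Sum>i\<in>UNIV. H (axis i 1) $ i)"
      by (simp add: lin_trace_def sum_Basis_vec inner_axis)
    then show ?thesis
      by (simp only: sum.distrib sum_distrib_left[symmetric] inner_vec_def inner_real_def)
  qed
  also have "\<dots> = w ^ m * (lin_trace H - real m * w * (x \<bullet> G x))"
    by (simp add: algebra_simps)
  finally have "w\<^sup>2 * laplace_beltrami_coords stereo_north v x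
      = w\<^sup>2 * (1 / w ^ (m + 2) * (w ^ m * (lin_trace H - real m * w * (x \<bullet> G x))))"
    by simp
  also have "\<dots> = lin_trace H - real m * w * (x \<bullet> G x)"
    using w by (simp add: power_add power2_eq_square)
  finally show ?thesis by (simp add: w_def m(1))
qed

section \<open>The flat equation and rotational symmetry\<close>

text \<open>
  This function corresponds to the constant \<open>1\<close> on the sphere, which the conformal Laplacian
  multiplies by \<open>k (k + 1) = n (n - 2) / 4\<close>.
\<close>

lemma conf_factor_powr_hess:
  fixes y :: "'a::euclidean_space" and k :: real
  defines "k \<equiv> (real DIM('a) - 2) / 2"
  obtains H where "has_hess (\<lambda>y. conf_factor y powr k) (\<lambda>y. (- k * conf_factor y powr (k + 1)) *\<^sub>R y) H y"
    "lin_trace H = - k * (k + 1) * conf_factor y powr (k + 2)"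
proof -
  define w where "w = (\<lambda>t::real. 2 / (t + 1))"
  have wd: "((\<lambda>t. w t powr s) has_real_derivative - s / 2 * w t powr (s + 1)) (at t)" if "t > -1" for s t
  proof -
    have "w t > 0" using that by (simp add: w_def)
    have w': "(w has_real_derivative - (w t)\<^sup>2 / 2) (at t)"
      unfolding w_def using that by (auto intro!: derivative_eq_intros simp: power2_eq_square)
    have eq: "w t powr (s + 1) = w t powr (s - 1) * (w t)\<^sup>2"
      using powr_add[of "w t" "s - 1" 2] \<open>w t > 0\<close> by (simp add: add.commute)
    show ?thesis
      unfolding eq using DERIV_fun_powr[OF w' \<open>w t > 0\<close>, of s] by (simp add: mult_ac)
  qed
  define t where "t = sq_dist 0 y"
  have t: "t > -1" using inner_ge_zero[of y] unfolding t_def by (simp del: inner_ge_zero)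
  have "\<forall>\<^sub>F t in nhds t. t \<in> {-1<..}" using t by (intro eventually_nhds_in_open) auto
  then have 1: "\<forall>\<^sub>F t in nhds t. ((\<lambda>t. w t powr k) has_real_derivative - k / 2 * w t powr (k + 1)) (at t)"
    by eventually_elim (rule wd, simp)
  have 2: "((\<lambda>t. - k / 2 * w t powr (k + 1)) has_real_derivative - k / 2 * (- (k + 1) / 2 * w t powr (k + 2))) (at t)"
    using DERIV_cmult[OF wd[OF t, of "k + 1"], of "- k / 2"] by (simp add: add.assoc)
  define H where "H = (\<lambda>h. (4 * (- k / 2 * (- (k + 1) / 2 * w t powr (k + 2))) * ((y - 0) \<bullet> h)) *\<^sub>R (y - 0)
      + (2 * (- k / 2 * w t powr (k + 1))) *\<^sub>R h)"
  have cw: "conf_factor z = w (sq_dist 0 z)" for z :: 'a by (simp add: conf_factor_def w_def)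
  have hess: "has_hess (\<lambda>y. conf_factor y powr k) (\<lambda>y. (- k * conf_factor y powr (k + 1)) *\<^sub>R y) H y"
    using has_hess_radial[OF 1[unfolded t_def] 2[unfolded t_def]]
    unfolding H_def cw t_def by simp
  have "t + 1 > 0" using t by simp
  then have "t + 1 \<noteq> 0" by simp
  then have "2 * (t + 1) / (t + 1) = 2" by (rule nonzero_mult_div_cancel_right)
  then have wt: "w t * (t + 1) = 2" "w t > 0"
    using \<open>t + 1 > 0\<close> by (simp_all only: w_def times_divide_eq_left) simp
  have wk: "w t powr (k + 2) = w t powr (k + 1) * w t" using powr_add[of "w t" "k + 1" 1] wt(2) by (simp add: add.assoc)
  have "lin_trace H = 4 * (- k / 2 * (- (k + 1) / 2 * w t powr (k + 2))) * t + 2 * (- k / 2 * w t powr (k + 1)) * real DIM('a)"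
    unfolding H_def t_def by (simp only: lin_trace_add lin_trace_scaleR lin_trace_rank1' lin_trace_id)
  also have "\<dots> = k * (k + 1) * w t powr (k + 1) * (w t * (t + 1)) - k * (k + 1) * w t powr (k + 2)
      - k * real DIM('a) * w t powr (k + 1)"
    unfolding wk by (simp add: algebra_simps)
  also have "\<dots> = - k * (k + 1) * w t powr (k + 2)"
  proof -
    have n: "real DIM('a) = 2 * k + 2" by (simp add: k_def field_simps)
    show ?thesis unfolding wt(1) n by (simp add: algebra_simps)
  qed
  finally have "lin_trace H = - k * (k + 1) * conf_factor y powr (k + 2)" by (simp add: cw t_def)
  with hess show thesis by (rule that)
qed

text \<open>
  The weight for which the first order term of \<open>laplace_beltrami_stereo_north\<close> disappears.
\<close>

definition flatten :: "('n::finite ambient \<Rightarrow> real) \<Rightarrow> real ^ 'n \<Rightarrow> real" where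
  "flatten v y = conf_factor y powr ((real CARD('n) - 2) / 2) * v (stereo_north y)"

lemma flatten_lap:
  fixes v :: "'n::finite ambient \<Rightarrow> real" and k :: real
  defines "k \<equiv> (real CARD('n) - 2) / 2"
  assumes dim: "CARD('n) \<ge> 3" and f: "has_hess (v \<circ> stereo_north) G H y"
  shows "has_lap (flatten v) (conf_factor y powr (k + 2) *
     (laplace_beltrami_coords stereo_north v y - real CARD('n) * (real CARD('n) - 2) / 4 * v (stereo_north y))) y"
proof -
  define w where "w = conf_factor y"
  have w: "w > 0" using conf_factor_pos by (simp add: w_def)
  obtain K where K: "has_hess (\<lambda>y :: real ^ 'n. conf_factor y powr k) (\<lambda>y. (- k * conf_factor y powr (k + 1)) *\<^sub>R y) K y"
    "lin_trace K = - k * (k + 1) * w powr (k + 2)"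
    using conf_factor_powr_hess[of y] by (auto simp: k_def w_def)
  have "flatten v = (\<lambda>y. conf_factor y powr k * (v \<circ> stereo_north) y)"
    by (simp add: flatten_def fun_eq_iff k_def)
  then have "has_lap (flatten v) (w powr k * lin_trace H + 2 * ((- k * w powr (k + 1)) *\<^sub>R y \<bullet> G y)
      + v (stereo_north y) * (- k * (k + 1) * w powr (k + 2))) y"
    using has_lap_mult[OF K(1) f] K(2) by (simp add: w_def)
  moreover have "w powr k * lin_trace H + 2 * ((- k * w powr (k + 1)) *\<^sub>R y \<bullet> G y)
      + v (stereo_north y) * (- k * (k + 1) * w powr (k + 2))
    = w powr (k + 2) * (laplace_beltrami_coords stereo_north v y - real CARD('n) * (real CARD('n) - 2) / 4 * v (stereo_north y))"
  proof -
    have 1: "w powr (k + 1) = w powr k * w" and 2: "w powr (k + 2) = w powr k * w\<^sup>2"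
      using w by (simp_all add: powr_add)
    have 3: "lin_trace H = w\<^sup>2 * laplace_beltrami_coords stereo_north v y + 2 * k * w * (y \<bullet> G y)"
      using laplace_beltrami_stereo_north[OF dim f] by (simp add: w_def k_def)
    have 4: "real CARD('n) * (real CARD('n) - 2) / 4 = k * (k + 1)"
      by (simp add: k_def field_simps)
    show ?thesis unfolding 1 2 3 4 by (simp add: algebra_simps)
  qed
  ultimately show ?thesis by (simp only: w_def)
qed

lemma stereo_north_vimage: "stereo_north -` punctured_sphere = - {0}"
  by (simp add: set_eq_iff stereo_north_in_punctured_sphere)

lemma laplace_sphere_stereo_north:
  fixes y :: "real ^ 'n::finite"
  shows "laplace_sphere v (stereo_north y) = laplace_beltrami_coords stereo_north v y"
proof -
  have "stereo_north y \<noteq> north"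
    using conf_factor_pos[of y] by (auto simp: stereo_north_conf north_def)
  then show ?thesis
    unfolding laplace_sphere_def using inv_f_f[OF inj_stereo_north, of y] by simp
qed

lemma punctured_sphere_stereo_north:
  fixes q :: "'n::finite ambient"
  assumes "q \<in> punctured_sphere"
  obtains y where "y \<noteq> 0" "q = stereo_north y"
proof -
  obtain x t where q: "q = (x, t)" by (cases q)
  have "norm q = 1" "q \<noteq> (0, 1)" "q \<noteq> (0, -1)"
    using assms by (auto simp: punctured_sphere_def unit_sphere_def north_def south_def)
  then have xt: "x \<bullet> x + t * t = 1" by (simp add: q norm_eq_sqrt_inner)
  have "t \<noteq> 1" using \<open>q \<noteq> (0, 1)\<close> xt by (auto simp: q)
  moreover have "t * t \<le> 1" using xt inner_ge_zero[of x] by linarith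
  then have "\<bar>t\<bar> \<le> 1" by (simp add: abs_square_le_1 power2_eq_square[symmetric])
  ultimately have t: "t < 1" by auto
  define y where "y = (1 / (1 - t)) *\<^sub>R x"
  have "y \<bullet> y = (1 - t * t) / ((1 - t) * (1 - t))" using xt by (simp add: y_def)
  also have "1 - t * t = (1 - t) * (1 + t)" by (simp add: algebra_simps)
  also have "(1 - t) * (1 + t) / ((1 - t) * (1 - t)) = (1 + t) / (1 - t)" using t by simp
  finally have "y \<bullet> y + 1 = 2 / (1 - t)" using t by (simp add: field_simps)
  then have "conf_factor y = 1 - t" using t by (simp add: conf_factor_def)
  then have "q = stereo_north y" using t by (simp add: q stereo_north_conf y_def)
  moreover from this have "y \<noteq> 0" using assms stereo_north_in_punctured_sphere[of y] by simp
  ultimately show thesis by (intro that)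
qed

lemma solution_imp_flat_solution:
  fixes v :: "'n::finite ambient \<Rightarrow> real"
  assumes dim: "CARD('n) \<ge> 3" and sol: "solution \<beta> v"
    and \<beta>: "\<beta> < real CARD('n) * (real CARD('n) - 2) / 4"
  shows "flat_solution (flatten v) (real CARD('n) * (real CARD('n) - 2) / 4 - \<beta>)
     ((real CARD('n) - 2) / 2) ((real CARD('n) + 2) / (real CARD('n) - 2))"
proof
  fix y :: "real ^ 'n" assume y: "y \<noteq> 0"
  define k where "k = (real CARD('n) - 2) / 2"
  define p where "p = (real CARD('n) + 2) / (real CARD('n) - 2)"
  define c0 where "c0 = real CARD('n) * (real CARD('n) - 2) / 4"
  define w where "w = conf_factor y"
  define V where "V = v (stereo_north y)"
  have w: "w > 0" using conf_factor_pos by (simp add: w_def)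
  have q: "stereo_north y \<in> punctured_sphere" using y by (simp add: stereo_north_in_punctured_sphere)
  have V: "V > 0" and eq: "laplace_beltrami_coords stereo_north v y = \<beta> * V - V powr p"
    using sol q unfolding solution_def by (auto simp: V_def p_def laplace_sphere_stereo_north)
  have fv: "flatten v y = w powr k * V" by (simp add: flatten_def w_def k_def V_def)
  show "0 < flatten v y" using V w by (simp add: fv)
  have "C2_on (- {0}) (v \<circ> stereo_north)"
    using sol by (simp add: solution_def C2_on_sphere_def stereo_north_vimage)
  then obtain G H where "has_hess (v \<circ> stereo_north) G H y"
    using C2_on_imp_has_hess[of "- {0}" "v \<circ> stereo_north" y] y by auto
  from flatten_lap[OF dim this]
  have "has_lap (flatten v) (w powr (k + 2) * ((\<beta> * V - V powr p) - c0 * V)) y"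
    by (simp only: w_def k_def V_def eq c0_def)
  moreover have 1: "w powr (k + 2) * V powr p = flatten v y powr p"
  proof -
    have "k * p = k + 2" using dim by (simp add: k_def p_def field_simps)
    then show ?thesis using w V by (simp add: fv powr_mult powr_powr)
  qed
  moreover have 2: "w powr (k + 2) * V = w\<^sup>2 * flatten v y"
    using w by (simp add: fv powr_add)
  moreover have "w powr (k + 2) * ((\<beta> * V - V powr p) - c0 * V)
      = - (w powr (k + 2) * V powr p + (c0 - \<beta>) * (w powr (k + 2) * V))"
    by (simp add: algebra_simps)
  ultimately have "has_lap (flatten v) (- (flatten v y powr p + (c0 - \<beta>) * w\<^sup>2 * flatten v y)) y"
    by (simp add: mult.assoc)
  then show "has_lap (flatten v)
         (- (flatten v y powr ((real CARD('n) + 2) / (real CARD('n) - 2)) +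
             (real CARD('n) * (real CARD('n) - 2) / 4 - \<beta>) * (conf_factor y)\<^sup>2 * flatten v y)) y"
    by (simp add: p_def c0_def w_def)
qed (use dim \<beta> in auto)

theorem solution_rotationally_symmetric:
  fixes v :: "'n::finite ambient \<Rightarrow> real"
  assumes dim: "CARD('n) \<ge> 3" and sol: "solution \<beta> v"
    and \<beta>: "\<beta> < real CARD('n) * (real CARD('n) - 2) / 4"
  shows "rotationally_symmetric v"
  unfolding rotationally_symmetric_def
proof (intro allI impI)
  fix A :: "real ^ 'n ^ 'n" and x :: "real ^ 'n" and t
  assume A: "rotation_matrix A" and xt: "(x, t) \<in> punctured_sphere"
  interpret flat_solution "flatten v" "real CARD('n) * (real CARD('n) - 2) / 4 - \<beta>"
     "(real CARD('n) - 2) / 2" "(real CARD('n) + 2) / (real CARD('n) - 2)"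
    by (rule solution_imp_flat_solution[OF assms])
  obtain y where y: "y \<noteq> 0" "(x, t) = stereo_north y"
    by (rule punctured_sphere_stereo_north[OF xt])
  have "orthogonal_transformation ((*v) A)"
    using A by (simp add: rotation_matrix_def orthogonal_transformation_matrix)
  then have n: "norm (A *v y) = norm y" by (rule orthogonal_transformation_norm)
  then have cf: "conf_factor (A *v y) = conf_factor y" by (simp add: conf_factor_def dot_square_norm)
  have "flatten v y = flatten v (A *v y)" using radial[of y "A *v y"] n y(1) by simp
  then have "v (stereo_north y) = v (stereo_north (A *v y))"
    using conf_factor_pos[of y] by (simp add: flatten_def cf)
  moreover have "stereo_north (A *v y) = (A *v x, t)"
    using y(2) by (simp add: stereo_north_conf cf matrix_vector_mult_scaleR)
  ultimately show "v (A *v x, t) = v (x, t)" using y(2) by simp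
qed

section \<open>Nonexistence\<close>

context flat_solution begin

text \<open>
  On the sphere, \<open>(u + \<epsilon> H) / \<psi>\<^sup>k\<close> is \<open>v + \<epsilon> b\<close>, where \<open>b\<close> is a power of the distance to the axis
  that is infinite at both poles. It attains its minimum, and there it has a nonnegative
  Laplacian. If \<open>c \<ge> k (k + 1)\<close>, then \<open>v\<close> has the Laplacian \<open>-v\<^sup>p\<close> or less. The barrier \<open>b\<close> is
  superharmonic outside the compact annulus \<open>W\<close>; on \<open>W\<close> the power term is bounded below, and a
  small \<open>\<epsilon>\<close> makes it prevail.
\<close>

lemma coupling_below_conformal: "c < k * (k + 1)"
proof (rule ccontr)
  assume "\<not> c < k * (k + 1)"
  then have c: "k * (k + 1) \<le> c" by simp
  define psi where "psi = (\<lambda>y :: 'a. conf_factor y powr k)"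
  define H where "H = (\<lambda>y :: 'a. (sq_dist 0 y) powr (- k / 2))"
  have psi_pos: "psi y > 0" for y using conf_factor_pos[of y] by (simp add: psi_def)
  have H_pos: "H y > 0" if "y \<noteq> 0" for y using that by (simp add: H_def)
  have psi_lap: "has_lap psi (- k * (k + 1) * (conf_factor y)\<^sup>2 * psi y) y" for y
  proof -
    have "conf_factor y powr (k + 2) = (conf_factor y)\<^sup>2 * psi y"
      using conf_factor_pos[of y] by (simp add: psi_def powr_add)
    moreover obtain K where "has_hess psi (\<lambda>y. (- k * conf_factor y powr (k + 1)) *\<^sub>R y) K y"
      "lin_trace K = - k * (k + 1) * conf_factor y powr (k + 2)"
      using conf_factor_powr_hess[of y] by (auto simp: psi_def[abs_def] k_def)
    ultimately show ?thesis unfolding has_lap_def by (auto simp: mult.assoc)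
  qed
  have H_lap: "has_lap H (- k\<^sup>2 / (y \<bullet> y) * H y) y" if "y \<noteq> 0" for y
  proof -
    have "(y \<bullet> y) powr (- k / 2 - 1) = H y / (y \<bullet> y)"
      using that powr_diff[of "y \<bullet> y" "- k / 2" 1] by (simp add: H_def)
    moreover have "2 * (- k / 2) * (2 * (- k / 2) - 2 + real DIM('a)) = - k\<^sup>2"
      by (simp add: k_def power2_eq_square field_simps)
    ultimately show ?thesis
      using has_lap_powr_dist[OF that, of "- k / 2"] by (simp add: H_def[abs_def])
  qed
  (* W is the set where |y| \<psi>(y) is at least 1 / B. Outside, k (k + 1) \<psi>(y)^2 < k^2 / |y|^2. *)
  define B where "B = sqrt ((k + 1) / k)"
  have B: "B > 0" "B\<^sup>2 = (k + 1) / k" using k_ge_half by (auto simp: B_def)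
  define W where "W = {y :: 'a. y \<bullet> y + 1 \<le> 2 * B * norm y}"
  have cW: "compact W" unfolding W_def using B(1) by (rule compact_annulus)
  have W0: "W \<subseteq> - {0}" by (auto simp: W_def)
  obtain e :: 'a where e: "norm e = 1" using vector_choose_size[of 1] by auto
  have "1 \<le> B" using k_ge_half by (simp add: B_def)
  then have "e \<in> W" using e by (simp add: W_def dot_square_norm)
  have "u y \<noteq> 0" if "y \<in> W" for y using pos[of y] that W0 by force
  then have "continuous_on W (\<lambda>y. u y powr p)"
    using W0 by (intro continuous_intros continuous_on_subset[OF cont_u]) auto
  then obtain z0 where z0: "z0 \<in> W" "\<And>y. y \<in> W \<Longrightarrow> u z0 powr p \<le> u y powr p"
    using continuous_attains_inf[OF cW] \<open>e \<in> W\<close> by blast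
  define d where "d = u z0 powr p"
  have "z0 \<noteq> 0" using z0(1) W0 by auto
  then have d: "d > 0" using pos[of z0] by (simp add: d_def)
  have "continuous_on W (\<lambda>y. k * (k + 1) * (conf_factor y)\<^sup>2 * H y)"
  proof -
    have "y \<bullet> y + 1 \<noteq> 0" for y :: 'a using inner_plus_one_pos[of y] by simp
    then show ?thesis unfolding conf_factor_def H_def using W0 by (intro continuous_intros) auto
  qed
  then obtain z1 where z1: "z1 \<in> W"
    "\<And>y. y \<in> W \<Longrightarrow> k * (k + 1) * (conf_factor y)\<^sup>2 * H y \<le> k * (k + 1) * (conf_factor z1)\<^sup>2 * H z1"
    using continuous_attains_sup[OF cW] \<open>e \<in> W\<close> by blast
  define C where "C = k * (k + 1) * (conf_factor z1)\<^sup>2 * H z1"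
  have "z1 \<noteq> 0" using z1(1) W0 by auto
  then have C: "C > 0" using conf_factor_pos[of z1] H_pos[of z1] k_ge_half by (simp add: C_def)
  define \<epsilon> where "\<epsilon> = d / (2 * C)"
  have \<epsilon>: "\<epsilon> > 0" "\<epsilon> * C < d" using d C by (auto simp: \<epsilon>_def)
  define Q where "Q = (\<lambda>y. (u y + \<epsilon> * H y) / psi y)"
  have e0: "e \<noteq> 0" using e by auto
  have Qe: "Q e > 0" using pos[OF e0] H_pos[OF e0] psi_pos[of e] \<epsilon> by (simp add: Q_def add_pos_pos)
  (* Outside the annulus X the barrier alone exceeds the value Q e, so the minimum is attained in X. *)
  define b where "b = max 1 ((Q e / \<epsilon>) powr (1 / k))"
  define X where "X = {y :: 'a. y \<bullet> y + 1 \<le> 2 * b * norm y}"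
  have X0: "X \<subseteq> - {0}" by (auto simp: X_def)
  have eX: "e \<in> X" using e by (simp add: X_def dot_square_norm b_def)
  have cX: "compact X" unfolding X_def by (rule compact_annulus) (simp add: b_def)
  have outside: "Q e < Q y" if "y \<notin> X" "y \<noteq> 0" for y
  proof -
    have n: "norm y > 0" using that by simp
    have cf: "conf_factor y * norm y = 2 * norm y / (y \<bullet> y + 1)" by (simp add: conf_factor_def)
    have yy: "y \<bullet> y + 1 > 0" by (simp add: add_nonneg_pos)
    have "b * (conf_factor y * norm y) < 1" 
      using that(1) yy unfolding cf X_def by (simp add: field_simps)
    then have "b < 1 / (conf_factor y * norm y)"
      using n conf_factor_pos[of y] by (simp add: pos_less_divide_eq)
    then have "(Q e / \<epsilon>) powr (1 / k) < 1 / (conf_factor y * norm y)" by (simp add: b_def)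
    then have "((Q e / \<epsilon>) powr (1 / k)) powr k < (1 / (conf_factor y * norm y)) powr k"
      using k_ge_half by (intro powr_less_mono2) auto
    then have "Q e / \<epsilon> < (1 / (conf_factor y * norm y)) powr k"
      using k_ge_half Qe \<epsilon> by (simp add: powr_powr)
    also have "\<dots> = H y / psi y"
    proof -
      have "(norm y)\<^sup>2 = norm y powr 2" using n by simp
      then have "H y = norm y powr (- k)"
        using n by (simp only: H_def dot_square_norm diff_0_right powr_powr) simp
      then show ?thesis
        using n conf_factor_pos[of y] by (simp add: psi_def powr_divide powr_mult powr_minus_divide)
    qed
    finally have "Q e < \<epsilon> * H y / psi y" using \<epsilon> by (simp add: pos_divide_less_eq mult.commute)
    also have "\<dots> < Q y" unfolding Q_def using pos[OF that(2)] psi_pos[of y] by (simp add: divide_strict_right_mono)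
    finally show ?thesis .
  qed
  have "continuous_on X Q"
  proof -
    have "y \<bullet> y + 1 \<noteq> 0" for y :: 'a using inner_plus_one_pos[of y] by simp
    then show ?thesis unfolding Q_def psi_def conf_factor_def H_def using X0
      by (intro continuous_intros continuous_on_subset[OF cont_u]) auto
  qed
  then obtain z where z: "z \<in> X" and zmin: "\<And>y. y \<in> X \<Longrightarrow> Q z \<le> Q y"
    using continuous_attains_inf[OF cX] eX by blast
  define m where "m = Q z"
  have min: "m \<le> Q y" if "y \<noteq> 0" for y
    using zmin[of y] zmin[OF eX] outside[of y] that by (cases "y \<in> X") (auto simp: m_def)
  have zn: "z \<noteq> 0" using z X0 by auto
  have mz: "u z + \<epsilon> * H z = m * psi z" using psi_pos[of z] by (simp add: m_def Q_def)
  have ev: "\<forall>\<^sub>F y in nhds z. y \<in> - {0}" using zn by (intro eventually_nhds_in_open) auto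
  have "\<forall>\<^sub>F y in nhds z. u z + \<epsilon> * H z - m * psi z \<le> u y + \<epsilon> * H y - m * psi y"
    using ev
  proof eventually_elim
    case (elim y)
    with min[of y] psi_pos[of y] have "m * psi y \<le> u y + \<epsilon> * H y" by (simp add: Q_def pos_le_divide_eq)
    with mz show ?case by simp
  qed
  from has_lap_local_min[OF has_lap_diff[OF has_lap_add[OF lap[OF zn] has_lap_cmul[OF H_lap[OF zn]]] has_lap_cmul[OF psi_lap]] this]
  have "0 \<le> - (u z powr p + c * (conf_factor z)\<^sup>2 * u z) + \<epsilon> * (- k\<^sup>2 / (z \<bullet> z) * H z)
      - m * (- k * (k + 1) * (conf_factor z)\<^sup>2 * psi z)" .
  also have "m * (- k * (k + 1) * (conf_factor z)\<^sup>2 * psi z) = - k * (k + 1) * (conf_factor z)\<^sup>2 * (u z + \<epsilon> * H z)"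
    unfolding mz by simp
  finally have "u z powr p + (c - k * (k + 1)) * ((conf_factor z)\<^sup>2 * u z)
      \<le> \<epsilon> * H z * (k * (k + 1) * (conf_factor z)\<^sup>2 - k\<^sup>2 / (z \<bullet> z))"
    by (simp add: algebra_simps)
  moreover have "0 \<le> (c - k * (k + 1)) * ((conf_factor z)\<^sup>2 * u z)"
    using c pos[OF zn] by simp
  ultimately have le: "u z powr p \<le> \<epsilon> * H z * (k * (k + 1) * (conf_factor z)\<^sup>2 - k\<^sup>2 / (z \<bullet> z))"
    by linarith
  have zz: "z \<bullet> z > 0" using zn by simp
  have up: "u z powr p > 0" using pos[OF zn] by simp
  show False
  proof (cases "z \<in> W")
    case True
    have "k * (k + 1) * (conf_factor z)\<^sup>2 - k\<^sup>2 / (z \<bullet> z) \<le> k * (k + 1) * (conf_factor z)\<^sup>2"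
      using zz by simp
    then have "\<epsilon> * H z * (k * (k + 1) * (conf_factor z)\<^sup>2 - k\<^sup>2 / (z \<bullet> z)) \<le> \<epsilon> * H z * (k * (k + 1) * (conf_factor z)\<^sup>2)"
      using \<epsilon> H_pos[OF zn] by (intro mult_left_mono) auto
    also have "\<dots> \<le> \<epsilon> * C" using z1(2)[OF True] \<epsilon> by (simp add: C_def mult_ac)
    also have "\<dots> < u z powr p" using \<epsilon>(2) z0(2)[OF True] by (simp add: d_def)
    finally show False using le by simp
  next
    case False
    have yy: "z \<bullet> z + 1 > 0" by (simp add: add_nonneg_pos)
    have "B * (conf_factor z * norm z) < 1"
      using False yy by (simp add: W_def conf_factor_def field_simps)
    moreover have "0 \<le> B * (conf_factor z * norm z)" using B(1) conf_factor_pos[of z] by simp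
    ultimately have "(B * (conf_factor z * norm z))\<^sup>2 < 1" by (simp add: power_less_one_iff abs_square_less_1)
    then have "(k + 1) / k * ((conf_factor z)\<^sup>2 * (z \<bullet> z)) < 1"
      by (simp add: power_mult_distrib B(2) dot_square_norm)
    then have "k\<^sup>2 * ((k + 1) / k * ((conf_factor z)\<^sup>2 * (z \<bullet> z))) < k\<^sup>2 * 1"
      using k_ge_half by (intro mult_strict_left_mono) auto
    moreover have "k\<^sup>2 * ((k + 1) / k) = k * (k + 1)" using k_ge_half by (simp add: power2_eq_square)
    ultimately have "k * (k + 1) * (conf_factor z)\<^sup>2 * (z \<bullet> z) < k\<^sup>2"
      by (simp only: mult.assoc[symmetric] mult_1_right)
    then have "k * (k + 1) * (conf_factor z)\<^sup>2 - k\<^sup>2 / (z \<bullet> z) < 0" using zz by (simp add: pos_less_divide_eq)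
    then have "\<epsilon> * H z * (k * (k + 1) * (conf_factor z)\<^sup>2 - k\<^sup>2 / (z \<bullet> z)) < 0"
      using \<epsilon> H_pos[OF zn] by (intro mult_pos_neg) auto
    with le up show False by simp
  qed
qed

end

theorem no_solution:
  assumes dim: "CARD('n::finite) \<ge> 3" and \<beta>: "\<beta> \<le> 0"
  shows "\<not> solution \<beta> (v :: 'n ambient \<Rightarrow> real)"
proof
  assume sol: "solution \<beta> v"
  have "real CARD('n) * (real CARD('n) - 2) / 4 > 0" using dim by simp
  with \<beta> have "\<beta> < real CARD('n) * (real CARD('n) - 2) / 4" by linarith
  then interpret flat_solution "flatten v" "real CARD('n) * (real CARD('n) - 2) / 4 - \<beta>"
     "(real CARD('n) - 2) / 2" "(real CARD('n) + 2) / (real CARD('n) - 2)"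
    by (rule solution_imp_flat_solution[OF dim sol])
  show False using coupling_below_conformal \<beta> by (simp add: field_simps)
qed

section \<open>Global solutions of Lipschitz differential equations\<close>

lemma integral_exp_bound:
  fixes F :: "real \<Rightarrow> 'a::euclidean_space"
  assumes cont: "continuous_on {0..t} F" and "0 \<le> t" "\<kappa> > 0" and C: "C \<ge> 0"
    and bound: "\<And>s. s \<in> {0..t} \<Longrightarrow> norm (F s) \<le> C * exp (\<kappa> * s)"
  shows "norm (integral {0..t} F) \<le> C / \<kappa> * exp (\<kappa> * t)"
proof -
  have "((\<lambda>s. C * exp (\<kappa> * s)) has_integral (C / \<kappa> * exp (\<kappa> * t) - C / \<kappa> * exp (\<kappa> * 0))) {0..t}"
    using assms(2,3)
    by (intro fundamental_theorem_of_calculus)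
       (auto intro!: derivative_eq_intros simp: has_real_derivative_iff_has_vector_derivative[symmetric])
  then have "norm (integral {0..t} F) \<le> C / \<kappa> * exp (\<kappa> * t) - C / \<kappa> * exp (\<kappa> * 0)"
    using integral_norm_bound_integral[of F "{0..t}" "\<lambda>s. C * exp (\<kappa> * s)"] bound
      integrable_continuous_real[OF cont] by (metis has_integral_integrable integral_unique)
  moreover have "0 \<le> C / \<kappa> * exp (\<kappa> * 0)" using C assms(3) by simp
  ultimately show ?thesis by linarith
qed

lemma integral_has_vector_derivative_half_line:
  fixes F :: "real \<Rightarrow> 'a::euclidean_space"
  assumes cont: "continuous_on {0..} F" and t: "0 \<le> t"
  shows "((\<lambda>t. integral {0..t} F) has_vector_derivative F t) (at t within {0..})"
proof -
  have "((\<lambda>t. integral {0..t} F) has_vector_derivative F t) (at t within {0..t + 1})"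
    using t by (intro integral_has_vector_derivative continuous_on_subset[OF cont]) auto
  moreover have "at t within {0..t + 1} = at t within {0..}"
    by (rule at_within_nhd[of t "{..<t + 1}"]) auto
  ultimately show ?thesis by simp
qed

text \<open>
  Picard iteration on the whole half-line at once. After multiplication with \<open>exp (-\<kappa> t)\<close> the
  unknown lives in the space of bounded continuous functions, and in its norm the integral
  operator contracts by the factor \<open>L / \<kappa>\<close>. Functions on the half-line are extended to negative
  times by their value at \<open>0\<close> (hence \<open>max 0 t\<close>).
\<close>

theorem global_ode_solution:
  fixes f :: "real \<Rightarrow> 'a::euclidean_space \<Rightarrow> 'a"
  assumes cont: "continuous_on UNIV (\<lambda>(t, x). f t x)"
    and lip: "\<And>t x y. norm (f t x - f t y) \<le> L * norm (x - y)"
    and bd: "\<And>t. norm (f t 0) \<le> M"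
  obtains z where "z 0 = z0"
    "\<And>t. 0 \<le> t \<Longrightarrow> (z has_vector_derivative f t (z t)) (at t within {0..})"
proof -
  obtain b :: 'a where "norm b = 1" using vector_choose_size[of 1] by auto
  then have L: "L \<ge> 0" using lip[of 0 b 0] norm_ge_zero[of "f 0 b - f 0 0"] by (simp only: diff_0_right)
  have M: "M \<ge> 0" using bd[of 0] norm_ge_zero order_trans by blast
  define \<kappa> where "\<kappa> = L + 1"
  have \<kappa>: "\<kappa> > 0" "L / \<kappa> < 1" "0 \<le> L / \<kappa>" using L by (auto simp: \<kappa>_def)
  define F where "F = (\<lambda>(u :: real \<Rightarrow>\<^sub>C 'a) s. f s (exp (\<kappa> * s) *\<^sub>R u s))"
  define T where "T = (\<lambda>u t. exp (- \<kappa> * max 0 t) *\<^sub>R (z0 + integral {0..max 0 t} (F u)))"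
  have contF: "continuous_on S (F u)" for S u
    unfolding F_def
    by (rule continuous_on_compose2[OF cont, of S "\<lambda>s. (s, exp (\<kappa> * s) *\<^sub>R u s)", simplified])
       (intro continuous_intros continuous_on_apply_bcontfun)
  have contT: "continuous_on UNIV (T u)" for u
  proof -
    have "continuous_on {0..} (\<lambda>t. integral {0..t} (F u))"
      using integral_has_vector_derivative_half_line[OF contF]
      by (intro continuous_on_vector_derivative) auto
    then have "continuous_on UNIV (\<lambda>t. integral {0..max 0 t} (F u))"
      by (rule continuous_on_compose2) (auto intro!: continuous_intros)
    then show ?thesis unfolding T_def by (intro continuous_intros)
  qed
  have exp1: "exp (- \<kappa> * t) * (C / \<kappa> * exp (\<kappa> * t)) = C / \<kappa>" for C t
    by (simp add: exp_minus)
  have bddT: "T u \<in> bcontfun" for u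
  proof -
    obtain B where B: "\<And>s. norm (u s) \<le> B"
      using bounded_apply_bcontfun[of u] by (auto simp: bounded_iff)
    then have "B \<ge> 0" using norm_ge_zero order_trans by blast
    have Fb: "norm (F u s) \<le> (M + L * B) * exp (\<kappa> * s)" if "0 \<le> s" for s
    proof -
      have "norm (F u s) \<le> norm (f s 0) + norm (F u s - f s 0)"
        by (metis norm_triangle_sub)
      also have "\<dots> \<le> M + L * norm (exp (\<kappa> * s) *\<^sub>R u s)"
        using bd[of s] lip[of s "exp (\<kappa> * s) *\<^sub>R u s" 0] by (simp add: F_def)
      also have "\<dots> \<le> M * exp (\<kappa> * s) + L * (exp (\<kappa> * s) * B)"
      proof (rule add_mono)
        show "M \<le> M * exp (\<kappa> * s)" using M \<kappa>(1) that by (simp add: mult_le_cancel_left1)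
        show "L * norm (exp (\<kappa> * s) *\<^sub>R u s) \<le> L * (exp (\<kappa> * s) * B)"
          using L B[of s] by (intro mult_left_mono) auto
      qed
      finally show ?thesis by (simp add: algebra_simps)
    qed
    have "norm (T u t) \<le> norm z0 + (M + L * B) / \<kappa>" for t
    proof -
      define r where "r = max 0 t"
      have r: "0 \<le> r" by (simp add: r_def)
      have "norm (integral {0..r} (F u)) \<le> (M + L * B) / \<kappa> * exp (\<kappa> * r)"
        using Fb M L \<open>B \<ge> 0\<close> r \<kappa>(1) by (intro integral_exp_bound contF) auto
      then have "norm (z0 + integral {0..r} (F u)) \<le> norm z0 + (M + L * B) / \<kappa> * exp (\<kappa> * r)"
        using norm_triangle_ineq order_trans add_left_mono by metis
      then have "norm (T u t) \<le> exp (- \<kappa> * r) * (norm z0 + (M + L * B) / \<kappa> * exp (\<kappa> * r))"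
        unfolding T_def r_def[symmetric] by simp
      also have "\<dots> = exp (- \<kappa> * r) * norm z0 + (M + L * B) / \<kappa>"
        by (simp only: distrib_left exp1)
      also have "exp (- \<kappa> * r) * norm z0 \<le> 1 * norm z0"
        using \<kappa>(1) r by (intro mult_right_mono) auto
      finally show ?thesis by simp
    qed
    with contT show ?thesis by (rule bcontfun_normI)
  qed
  have appT: "apply_bcontfun (Bcontfun (T u)) = T u" for u
    using bddT by (simp add: Bcontfun_inverse)
  have "dist (Bcontfun (T u)) (Bcontfun (T w)) \<le> L / \<kappa> * dist u w" for u w
  proof (rule dist_bound)
    fix t :: real
    define r where "r = max 0 t"
    have r: "0 \<le> r" by (simp add: r_def)
    have "norm (integral {0..r} (\<lambda>s. F u s - F w s)) \<le> (L * dist u w) / \<kappa> * exp (\<kappa> * r)"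
    proof (intro integral_exp_bound)
      fix s
      have "norm (F u s - F w s) \<le> L * norm (exp (\<kappa> * s) *\<^sub>R u s - exp (\<kappa> * s) *\<^sub>R w s)"
        unfolding F_def by (rule lip)
      also have "norm (exp (\<kappa> * s) *\<^sub>R u s - exp (\<kappa> * s) *\<^sub>R w s) = exp (\<kappa> * s) * dist (u s) (w s)"
        by (simp add: scaleR_diff_right[symmetric] dist_norm)
      also have "L * (exp (\<kappa> * s) * dist (u s) (w s)) \<le> L * (exp (\<kappa> * s) * dist u w)"
        using L dist_bounded[of u s w] by (intro mult_left_mono) auto
      finally show "norm (F u s - F w s) \<le> L * dist u w * exp (\<kappa> * s)" by (simp add: mult_ac)
    qed (use L r \<kappa>(1) in \<open>auto intro!: continuous_intros contF\<close>)
    then have "norm (integral {0..r} (F u) - integral {0..r} (F w)) \<le> (L * dist u w) / \<kappa> * exp (\<kappa> * r)"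
      using integral_diff[OF integrable_continuous_real[OF contF] integrable_continuous_real[OF contF]] by metis
    then have "exp (- \<kappa> * r) * norm (integral {0..r} (F u) - integral {0..r} (F w))
        \<le> exp (- \<kappa> * r) * ((L * dist u w) / \<kappa> * exp (\<kappa> * r))"
      by (rule mult_left_mono) simp
    moreover have "dist (T u t) (T w t) = exp (- \<kappa> * r) * norm (integral {0..r} (F u) - integral {0..r} (F w))"
      unfolding T_def r_def[symmetric] dist_norm by (simp add: scaleR_diff_right[symmetric])
    ultimately show "dist (Bcontfun (T u) t) (Bcontfun (T w) t) \<le> L / \<kappa> * dist u w"
      unfolding appT by (simp only: exp1) simp
  qed
  then obtain u where u: "Bcontfun (T u) = u"
    using banach_fix_type[OF \<kappa>(3,2), of "\<lambda>u. Bcontfun (T u)"] by blast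
  define z where "z = (\<lambda>t. exp (\<kappa> * t) *\<^sub>R u t)"
  have z: "z t = z0 + integral {0..t} (F u)" if "0 \<le> t" for t
  proof -
    have "u t = T u t" using appT[of u] u by simp
    then show ?thesis using that by (simp add: z_def T_def exp_minus)
  qed
  show thesis
  proof
    show "z 0 = z0" using z[of 0] by simp
    fix t :: real assume t: "0 \<le> t"
    have "((\<lambda>t. z0 + integral {0..t} (F u)) has_vector_derivative 0 + F u t) (at t within {0..})"
      using integral_has_vector_derivative_half_line[OF contF t] by (intro derivative_intros)
    then have "((\<lambda>t. z0 + integral {0..t} (F u)) has_vector_derivative f t (z t)) (at t within {0..})"
      by (simp add: F_def z_def)
    then show "(z has_vector_derivative f t (z t)) (at t within {0..})"
      using z t by (rule_tac has_vector_derivative_transform[of t "{0..}"]) auto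
  qed
qed

text \<open>
  The even extension for \<open>\<sigma> = 1\<close> and the odd one for \<open>\<sigma> = -1\<close>; differentiation exchanges them.
\<close>

definition parity_ext :: "real \<Rightarrow> (real \<Rightarrow> real) \<Rightarrow> real \<Rightarrow> real" where
  "parity_ext \<sigma> g t = (if 0 \<le> t then g t else \<sigma> * g (- t))"

text \<open>
  The conditions at \<open>0\<close> say that the extension and its one-sided derivatives match there.
\<close>

lemma parity_ext_has_derivative:
  assumes g: "\<And>t. 0 \<le> t \<Longrightarrow> (g has_real_derivative g' t) (at t within {0..})"
    and 0: "g 0 = \<sigma> * g 0" "g' 0 = - \<sigma> * g' 0"
  shows "(parity_ext \<sigma> g has_real_derivative parity_ext (- \<sigma>) g' t) (at t)"
proof -
  have right: "(parity_ext \<sigma> g has_real_derivative parity_ext (- \<sigma>) g' t) (at t within {0..})" if "0 \<le> t" for t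
  proof -
    have "(parity_ext \<sigma> g has_real_derivative g' t) (at t within {0..})"
      by (rule has_field_derivative_transform_within[OF g[OF that], of 1]) (use that in \<open>auto simp: parity_ext_def\<close>)
    then show ?thesis using that by (simp add: parity_ext_def)
  qed
  have left: "(parity_ext \<sigma> g has_real_derivative parity_ext (- \<sigma>) g' t) (at t within {..0})" if "t \<le> 0" for t
  proof -
    have "(g has_real_derivative g' (- t)) (at (- t) within uminus ` {..0})"
      using g[of "- t"] that by simp
    then have "(g \<circ> uminus has_real_derivative g' (- t) * (- 1)) (at t within {..0})"
      by (rule DERIV_image_chain) (auto intro!: derivative_eq_intros)
    then have "((\<lambda>t. \<sigma> * (g \<circ> uminus) t) has_real_derivative \<sigma> * (g' (- t) * (- 1))) (at t within {..0})"
      by (rule DERIV_cmult)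
    then have "(parity_ext \<sigma> g has_real_derivative \<sigma> * (g' (- t) * (- 1))) (at t within {..0})"
      by (rule has_field_derivative_transform_within[where d = 1]) (use that 0 in \<open>auto simp: parity_ext_def\<close>)
    moreover have "\<sigma> * (g' (- t) * (- 1)) = parity_ext (- \<sigma>) g' t" using that 0 by (auto simp: parity_ext_def)
    ultimately show ?thesis by simp
  qed
  consider "t > 0" | "t < 0" | "t = 0" by linarith
  then show ?thesis
  proof cases
    case 1
    then have "at t within {0..} = at t" by (intro at_within_interior) (simp add: interior_real_atLeast)
    with right[of t] 1 show ?thesis by simp
  next
    case 2
    then have "at t within {..0} = at t" by (intro at_within_interior) (simp add: interior_real_atMost)
    with left[of t] 2 show ?thesis by simp
  next
    case 3
    have "{0..} \<union> {..0} = (UNIV :: real set)" by auto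
    with Lim_within_Un[of _ _ 0 "{0..}" "{..0 :: real}"] right[of 0] left[of 0] show ?thesis
      unfolding 3 has_field_derivative_iff by (metis order_refl)
  qed
qed

section \<open>The Emden--Fowler equation on the line\<close>

definition potential :: "real \<Rightarrow> real \<Rightarrow> real \<Rightarrow> real" where
  "potential k c t = k\<^sup>2 - c / (cosh t)\<^sup>2"

lemma potential_bounds:
  assumes "0 < c" "c < k\<^sup>2"
  shows "0 < potential k c t" "potential k c t \<le> k\<^sup>2"
proof -
  have "1 \<le> (cosh t)\<^sup>2" using cosh_real_ge_1[of t] by (simp add: one_le_power)
  then have "c / (cosh t)\<^sup>2 \<le> c" using assms by (simp add: divide_le_eq mult_le_cancel_left1)
  then show "0 < potential k c t" "potential k c t \<le> k\<^sup>2"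
    using assms by (auto simp: potential_def)
qed

lemma potential_has_derivative:
  "(potential k c has_real_derivative 2 * c * sinh t / (cosh t) ^ 3) (at t)"
  unfolding potential_def[abs_def]
  by (auto intro!: derivative_eq_intros simp: field_simps power2_eq_square power3_eq_cube)

text \<open>
  The power is cut off outside \<open>[0, B]\<close> in order to be globally Lipschitz; the solutions of
  interest stay inside.
\<close>

definition truncated_power :: "real \<Rightarrow> real \<Rightarrow> real \<Rightarrow> real" where
  "truncated_power p B x = max 0 (min x B) powr p"

lemma truncated_power_lipschitz:
  assumes p: "p > 1" and B: "B > 0"
  shows "\<bar>truncated_power p B x - truncated_power p B y\<bar> \<le> p * B powr (p - 1) * \<bar>x - y\<bar>"
proof -
  have one_sided: "a powr p - b powr p \<le> p * B powr (p - 1) * \<bar>a - b\<bar>"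
    if ab: "0 \<le> a" "a \<le> B" "0 \<le> b" for a b
  proof (cases "b < a")
    case True
    have "a powr p - b powr p \<le> p * a powr (p - 1) * (a - b)"
    proof (cases "b = 0")
      case True
      have "a powr p = a powr (p - 1) * a" using \<open>b < a\<close> ab powr_add[of a "p - 1" 1] by simp
      moreover have "1 * (a powr (p - 1) * a) \<le> p * (a powr (p - 1) * a)"
        using p ab by (intro mult_right_mono) auto
      ultimately show ?thesis using True p by (simp add: mult_ac)
    next
      case False
      then show ?thesis using powr_tangent_le[of a b p] ab True p by (simp add: algebra_simps)
    qed
    also have "\<dots> \<le> p * B powr (p - 1) * (a - b)"
      using True ab p by (intro mult_right_mono mult_left_mono powr_mono2) auto
    finally show ?thesis using True by simp
  next
    case False
    then have "a powr p \<le> b powr p" using ab p by (intro powr_mono2) auto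
    moreover have "0 \<le> p * B powr (p - 1) * \<bar>a - b\<bar>" using p by simp
    ultimately show ?thesis by linarith
  qed
  define a where "a = max 0 (min x B)"
  define b where "b = max 0 (min y B)"
  have ab: "0 \<le> a" "a \<le> B" "0 \<le> b" "b \<le> B" using B by (auto simp: a_def b_def)
  have "\<bar>a - b\<bar> \<le> \<bar>x - y\<bar>" by (auto simp: a_def b_def)
  then have "p * B powr (p - 1) * \<bar>a - b\<bar> \<le> p * B powr (p - 1) * \<bar>x - y\<bar>"
    using p by (intro mult_left_mono) auto
  moreover have "\<bar>a powr p - b powr p\<bar> \<le> p * B powr (p - 1) * \<bar>a - b\<bar>"
    using one_sided[of a b] one_sided[of b a] ab by (auto simp: abs_le_iff abs_minus_commute)
  ultimately show ?thesis by (simp add: truncated_power_def a_def b_def)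
qed

lemma continuous_truncated_power: "p > 0 \<Longrightarrow> continuous_on S (truncated_power p B)"
  unfolding truncated_power_def by (intro continuous_on_powr' continuous_intros) auto

lemma truncated_equation_solution:
  assumes c: "0 < c" "c < k\<^sup>2" and p: "p > 1" and B: "B > 0"
  obtains w w1 where "w 0 = \<alpha>" "w1 0 = 0"
    "\<And>t. 0 \<le> t \<Longrightarrow> (w has_real_derivative w1 t) (at t within {0..})"
    "\<And>t. 0 \<le> t \<Longrightarrow> (w1 has_real_derivative potential k c t * w t - truncated_power p B (w t)) (at t within {0..})"
proof -
  define f where "f = (\<lambda>t (x :: real \<times> real). (snd x, potential k c t * fst x - truncated_power p B (fst x)))"
  define L where "L = 1 + k\<^sup>2 + p * B powr (p - 1)"
  have contP: "continuous_on S (potential k c)" for S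
    using potential_has_derivative by (intro continuous_at_imp_continuous_on ballI DERIV_isCont)
  have "continuous_on UNIV (\<lambda>z. truncated_power p B (fst (snd z)))"
    using p by (intro continuous_on_compose2[OF continuous_truncated_power[of p UNIV]] continuous_intros) auto
  moreover have "continuous_on UNIV (\<lambda>z. potential k c (fst z))"
    by (intro continuous_on_compose2[OF contP[of UNIV]] continuous_intros) auto
  ultimately have cont: "continuous_on UNIV (\<lambda>(t, x). f t x)"
    unfolding f_def split_def by (intro continuous_intros)
  have lip: "norm (f t x - f t y) \<le> L * norm (x - y)" for t x y
  proof -
    define d where "d = norm (x - y)"
    have d1: "\<bar>fst x - fst y\<bar> \<le> d" using norm_fst_le[of "fst x - fst y" "snd x - snd y"] by (simp add: d_def minus_prod_def)
    have d2: "\<bar>snd x - snd y\<bar> \<le> d" using norm_snd_le[of "snd x - snd y" "fst x - fst y"] by (simp add: d_def minus_prod_def)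
    have "norm (f t x - f t y) \<le> \<bar>snd x - snd y\<bar> + \<bar>potential k c t * (fst x - fst y)
        - (truncated_power p B (fst x) - truncated_power p B (fst y))\<bar>"
      using norm_Pair_le[of "fst (f t x - f t y)" "snd (f t x - f t y)"]
      by (simp add: f_def algebra_simps)
    also have "\<dots> \<le> \<bar>snd x - snd y\<bar> + (\<bar>potential k c t * (fst x - fst y)\<bar>
        + \<bar>truncated_power p B (fst x) - truncated_power p B (fst y)\<bar>)"
      by (intro add_left_mono abs_triangle_ineq4)
    also have "\<bar>potential k c t * (fst x - fst y)\<bar> \<le> k\<^sup>2 * d"
      unfolding abs_mult using potential_bounds[OF c, of t] d1 by (intro mult_mono) auto
    also have "\<bar>truncated_power p B (fst x) - truncated_power p B (fst y)\<bar> \<le> p * B powr (p - 1) * d"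
      using order_trans[OF truncated_power_lipschitz[OF p B] mult_left_mono[OF d1]] p by simp
    finally show ?thesis using d2 by (simp add: L_def d_def algebra_simps)
  qed
  have "norm (f t 0) \<le> 0" for t using B by (simp add: f_def truncated_power_def)
  from global_ode_solution[OF cont lip this] obtain z where z: "z 0 = (\<alpha>, 0)"
    "\<And>t. 0 \<le> t \<Longrightarrow> (z has_vector_derivative f t (z t)) (at t within {0..})" by metis
  show thesis
  proof (rule that[of "\<lambda>t. fst (z t)" "\<lambda>t. snd (z t)"])
    fix t :: real assume "0 \<le> t"
    from z(2)[OF this] have zd: "(z has_derivative (\<lambda>h. h *\<^sub>R f t (z t))) (at t within {0..})"
      by (simp add: has_vector_derivative_def)
    show "((\<lambda>t. fst (z t)) has_real_derivative snd (z t)) (at t within {0..})"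
      using has_derivative_fst[OF zd] by (rule has_derivative_imp_has_field_derivative) (simp add: f_def)
    show "((\<lambda>t. snd (z t)) has_real_derivative potential k c t * fst (z t) - truncated_power p B (fst (z t)))
      (at t within {0..})"
      using has_derivative_snd[OF zd] by (rule has_derivative_imp_has_field_derivative) (simp add: f_def)
  qed (simp_all add: z)
qed

text \<open>
  The energy \<open>E = w'\<^sup>2 / 2 - P w\<^sup>2 / 2 + w\<^bsup>p+1\<^esup> / (p + 1)\<close>, with \<open>P\<close> the potential, has the
  derivative \<open>-P' w\<^sup>2 / 2 \<le> 0\<close> as long as \<open>w\<close> stays in \<open>(0, B)\<close>, and \<open>E(0) < 0\<close> by the smallness
  of \<open>\<alpha>\<close>. At the first exit time \<open>w\<close> would be \<open>0\<close>, where \<open>E \<ge> 0\<close>, or \<open>B\<close>, where \<open>E < 0\<close> forces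
  \<open>w < W < B\<close>. Negative energy also gives \<open>P w\<^sup>2 \<ge> -2 E(0)\<close>, the lower bound.
\<close>

lemma emden_fowler_half_line:
  fixes k c p \<alpha> :: real
  assumes k: "k > 0" and c: "0 < c" "c < k\<^sup>2" and p: "p > 1" and \<alpha>: "\<alpha> > 0"
    and small: "\<alpha> powr (p - 1) < (k\<^sup>2 - c) * (p + 1) / 2"
  obtains w w1 m where "w 0 = \<alpha>" "w1 0 = 0" "m > 0"
    "\<And>t. 0 \<le> t \<Longrightarrow> m \<le> w t"
    "\<And>t. 0 \<le> t \<Longrightarrow> (w has_real_derivative w1 t) (at t within {0..})"
    "\<And>t. 0 \<le> t \<Longrightarrow> (w1 has_real_derivative potential k c t * w t - w t powr p) (at t within {0..})"
proof -
  define W where "W = (k\<^sup>2 * (p + 1) / 2) powr (1 / (p - 1))"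
  define B where "B = W + 1"
  have Wp: "W powr (p - 1) = k\<^sup>2 * (p + 1) / 2" using k p by (simp add: W_def powr_powr)
  have W: "W > 0" using k p by (simp add: W_def)
  have B: "B > 0" using W by (simp add: B_def)
  have less_W: "x < W" if "0 < x" "x powr (p - 1) < k\<^sup>2 * (p + 1) / 2" for x
  proof (rule ccontr)
    assume "\<not> x < W"
    then have "W powr (p - 1) \<le> x powr (p - 1)" using W p by (intro powr_mono2) auto
    with that Wp show False by simp
  qed
  obtain w w1 where w0: "w 0 = \<alpha>" "w1 0 = 0"
    and dw: "\<And>t. 0 \<le> t \<Longrightarrow> (w has_real_derivative w1 t) (at t within {0..})"
    and dw1: "\<And>t. 0 \<le> t \<Longrightarrow> (w1 has_real_derivative potential k c t * w t - truncated_power p B (w t)) (at t within {0..})"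
    using truncated_equation_solution[OF c p B] by metis
  have interior: "at t within {0..} = at t" if "0 < t" for t :: real
    using that by (intro at_within_interior) (simp add: interior_real_atLeast)
  have contw: "continuous_on {0..} w" and contw1: "continuous_on {0..} w1"
    by (rule DERIV_continuous_on[OF dw], simp) (rule DERIV_continuous_on[OF dw1], simp)
  have contP: "continuous_on S (potential k c)" for S
    using potential_has_derivative by (intro continuous_at_imp_continuous_on ballI DERIV_isCont)
  define E where "E = (\<lambda>t. (w1 t)\<^sup>2 / 2 - potential k c t * (w t)\<^sup>2 / 2 + w t powr (p + 1) / (p + 1))"
  define \<eta> where "\<eta> = - E 0"
  have pw: "x powr (p + 1) = x powr (p - 1) * x\<^sup>2" if "x \<ge> 0" for x :: real
  proof (cases "x = 0")
    case False
    then show ?thesis using that powr_add[of x "p - 1" 2] by (simp add: add.commute)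
  qed simp
  have \<eta>: "\<eta> > 0"
  proof -
    have "\<alpha> powr (p - 1) / (p + 1) < (k\<^sup>2 - c) / 2" using small p by (simp add: field_simps)
    then have "\<alpha> powr (p - 1) / (p + 1) * \<alpha>\<^sup>2 < (k\<^sup>2 - c) / 2 * \<alpha>\<^sup>2" using \<alpha> by (intro mult_strict_right_mono) auto
    then show ?thesis using \<alpha> by (simp add: \<eta>_def E_def w0 potential_def pw)
  qed
  have energy: "E t \<le> - \<eta>" if t: "0 \<le> t" and range: "\<And>s. 0 \<le> s \<Longrightarrow> s < t \<Longrightarrow> 0 < w s \<and> w s < B" and "0 \<le> w t" for t
  proof -
    have "continuous_on {0..t} E"
    proof -
      have "\<forall>s\<in>{0..t}. 0 \<le> w s" using range \<open>0 \<le> w t\<close> by (metis atLeastAtMost_iff less_eq_real_def)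
      moreover have "continuous_on {0..t} w" "continuous_on {0..t} w1"
        using contw contw1 by (auto elim: continuous_on_subset)
      ultimately show ?thesis
        unfolding E_def using p by (intro continuous_intros contP continuous_on_powr') auto
    qed
    moreover have "\<exists>y. (E has_real_derivative y) (at s) \<and> y \<le> 0" if s: "0 < s" "s < t" for s
    proof -
      have ws: "0 < w s" "w s < B" using range[of s] s by auto
      have d: "(w has_real_derivative w1 s) (at s)"
        and d1: "(w1 has_real_derivative potential k c s * w s - w s powr p) (at s)"
        using dw[of s] dw1[of s] s ws by (auto simp: interior truncated_power_def)
      define A' where "A' = 2 * c * sinh s / (cosh s) ^ 3"
      have "((\<lambda>t. w t powr (p + 1)) has_real_derivative (p + 1) * w s powr p * w1 s) (at s)"
        using DERIV_fun_powr[OF d ws(1), of "p + 1"] by simp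
      then have "((\<lambda>t. w t powr (p + 1) / (p + 1)) has_real_derivative (p + 1) * w s powr p * w1 s / (p + 1)) (at s)"
        by (rule DERIV_cdivide)
      moreover have "((\<lambda>t. (w1 t)\<^sup>2 / 2) has_real_derivative w1 s * (potential k c s * w s - w s powr p)) (at s)"
        by (auto intro!: derivative_eq_intros d1)
      moreover have "((\<lambda>t. potential k c t * (w t)\<^sup>2 / 2) has_real_derivative
          A' * (w s)\<^sup>2 / 2 + potential k c s * w s * w1 s) (at s)"
        unfolding A'_def by (auto intro!: derivative_eq_intros d potential_has_derivative)
      ultimately have "(E has_real_derivative w1 s * (potential k c s * w s - w s powr p)
          - (A' * (w s)\<^sup>2 / 2 + potential k c s * w s * w1 s) + (p + 1) * w s powr p * w1 s / (p + 1)) (at s)"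
        unfolding E_def by (intro DERIV_add DERIV_diff)
      moreover have "(p + 1) * w s powr p * w1 s / (p + 1) = w s powr p * w1 s" using p by simp
      ultimately have "(E has_real_derivative - A' * (w s)\<^sup>2 / 2) (at s)"
        by (simp add: algebra_simps)
      then have "(E has_real_derivative - (2 * c * sinh s / (cosh s) ^ 3) * (w s)\<^sup>2 / 2) (at s)"
        unfolding A'_def .
      moreover have "- (2 * c * sinh s / (cosh s) ^ 3) * (w s)\<^sup>2 / 2 \<le> 0" using c s by simp
      ultimately show ?thesis by blast
    qed
    ultimately have "E t \<le> E 0" using t
    proof (cases "t = 0")
      case False
      with t have "0 < t" by simp
      from DERIV_nonpos_imp_decreasing_open[of 0 t E] show ?thesis
        using \<open>continuous_on {0..t} E\<close> t
          \<open>\<And>s. 0 < s \<Longrightarrow> s < t \<Longrightarrow> \<exists>y. (E has_real_derivative y) (at s) \<and> y \<le> 0\<close> by blast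
    qed simp
    then show ?thesis by (simp add: \<eta>_def)
  qed
  have range: "0 < w t \<and> w t < B" if "0 \<le> t" for t
  proof (rule ccontr)
    assume bad: "\<not> (0 < w t \<and> w t < B)"
    define S where "S = {0..} \<inter> w -` ({..0} \<union> {B..})"
    have "closed S" unfolding S_def by (intro continuous_closed_preimage contw closed_Un) auto
    have "t \<in> S" using bad that by (auto simp: S_def)
    have bS: "bdd_below S" by (auto simp: S_def bdd_below_def)
    define r where "r = Inf S"
    have rS: "r \<in> S" unfolding r_def using \<open>closed S\<close> \<open>t \<in> S\<close> bS by (intro closed_contains_Inf) auto
    have before: "0 < w s \<and> w s < B" if "0 \<le> s" "s < r" for s
    proof -
      have "s \<notin> S" using cInf_lower[OF _ bS, of s] that(2) unfolding r_def by linarith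
      with that(1) show ?thesis by (auto simp: S_def)
    qed
    have "\<alpha> < W"
    proof (rule less_W[OF \<alpha>])
      have "(k\<^sup>2 - c) * (p + 1) / 2 \<le> k\<^sup>2 * (p + 1) / 2" using c p by simp
      with small show "\<alpha> powr (p - 1) < k\<^sup>2 * (p + 1) / 2" by linarith
    qed
    then have "r \<noteq> 0" using rS w0 \<alpha> W by (auto simp: S_def B_def)
    then have r: "0 < r" using rS by (auto simp: S_def)
    have contr: "continuous_on {0..r} w" using contw by (rule continuous_on_subset) auto
    have "0 \<le> w r"
    proof (rule ccontr)
      assume "\<not> 0 \<le> w r"
      then obtain s where "0 \<le> s" "s \<le> r" "w s = 0"
        using IVT2'[of w r 0 0] contr r \<alpha> w0 by auto
      with before[of s] \<open>\<not> 0 \<le> w r\<close> show False by (cases "s = r") auto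
    qed
    have "w r \<le> B"
    proof (rule ccontr)
      assume "\<not> w r \<le> B"
      then obtain s where "0 \<le> s" "s \<le> r" "w s = B"
        using IVT'[of w 0 B r] contr r \<open>\<alpha> < W\<close> w0 by (auto simp: B_def)
      with before[of s] \<open>\<not> w r \<le> B\<close> show False by (cases "s = r") auto
    qed
    then have cases: "w r = 0 \<or> w r = B" using rS \<open>0 \<le> w r\<close> by (auto simp: S_def)
    have Er: "E r < 0" using energy[of r] before r \<open>0 \<le> w r\<close> \<eta> by force
    from cases show False
    proof
      assume "w r = 0"
      with Er show False by (simp add: E_def not_less[symmetric])
    next
      assume wr: "w r = B"
      have "0 \<le> (w1 r)\<^sup>2 / 2" by simp
      with Er have "B powr (p + 1) / (p + 1) < potential k c r * B\<^sup>2 / 2" unfolding E_def wr by linarith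
      also have "\<dots> \<le> k\<^sup>2 * B\<^sup>2 / 2" using potential_bounds[OF c, of r] by (simp add: mult_right_mono)
      finally have "B powr (p - 1) / (p + 1) * B\<^sup>2 < k\<^sup>2 / 2 * B\<^sup>2" using B by (simp add: pw)
      then have "B powr (p - 1) / (p + 1) < k\<^sup>2 / 2" by (rule mult_right_less_imp_less) simp
      then have "B < W" using p B by (intro less_W) (auto simp: field_simps)
      then show False by (simp add: B_def)
    qed
  qed
  define m where "m = sqrt (2 * \<eta>) / k"
  have m: "m > 0" using \<eta> k by (simp add: m_def)
  have lower: "m \<le> w t" if "0 \<le> t" for t
  proof -
    have wt: "0 < w t" using range[OF that] by simp
    have "E t \<le> - \<eta>"
      by (rule energy[OF that _ less_imp_le[OF wt]]) (rule range)
    moreover have "0 \<le> (w1 t)\<^sup>2 / 2" "0 \<le> w t powr (p + 1) / (p + 1)" using p by auto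
    ultimately have "\<eta> \<le> potential k c t * (w t)\<^sup>2 / 2" unfolding E_def by linarith
    also have "\<dots> \<le> k\<^sup>2 * (w t)\<^sup>2 / 2" using potential_bounds[OF c, of t] by (simp add: mult_right_mono)
    finally have "2 * \<eta> \<le> (k * w t)\<^sup>2" by (simp add: power_mult_distrib)
    then have "sqrt (2 * \<eta>) \<le> k * w t" using k wt by (intro real_le_lsqrt) auto
    then show ?thesis using k by (simp add: m_def pos_divide_le_eq mult.commute)
  qed
  show thesis
  proof (rule that[OF w0 m lower dw])
    fix t :: real assume t: "0 \<le> t"
    have "truncated_power p B (w t) = w t powr p" using range[OF t] by (simp add: truncated_power_def)
    with dw1[OF t] show "(w1 has_real_derivative potential k c t * w t - w t powr p) (at t within {0..})" by simp
  qed
qed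

lemma emden_fowler_solution:
  fixes k c p \<alpha> :: real
  assumes k: "k > 0" and c: "0 < c" "c < k\<^sup>2" and p: "p > 1" and \<alpha>: "\<alpha> > 0"
    and small: "\<alpha> powr (p - 1) < (k\<^sup>2 - c) * (p + 1) / 2"
  obtains w w1 m where "w 0 = \<alpha>" "m > 0" "\<And>t. w (- t) = w t" "\<And>t. m \<le> w t"
    "\<And>t. (w has_real_derivative w1 t) (at t)"
    "\<And>t. (w1 has_real_derivative potential k c t * w t - w t powr p) (at t)"
proof -
  obtain w w1 m where w: "w 0 = \<alpha>" "w1 0 = 0" "m > 0" "\<And>t. 0 \<le> t \<Longrightarrow> m \<le> w t"
    and dw: "\<And>t. 0 \<le> t \<Longrightarrow> (w has_real_derivative w1 t) (at t within {0..})"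
    and dw1: "\<And>t. 0 \<le> t \<Longrightarrow> (w1 has_real_derivative potential k c t * w t - w t powr p) (at t within {0..})"
    using emden_fowler_half_line[OF assms] by metis
  show thesis
  proof
    show "parity_ext 1 w 0 = \<alpha>" using w by (simp add: parity_ext_def)
    show "parity_ext 1 w (- t) = parity_ext 1 w t" for t by (auto simp: parity_ext_def)
    show "m \<le> parity_ext 1 w t" for t using w(4) by (simp add: parity_ext_def)
    show "(parity_ext 1 w has_real_derivative parity_ext (- 1) w1 t) (at t)" for t
      using dw by (rule parity_ext_has_derivative) (simp_all add: w)
    have "(parity_ext (- 1) w1 has_real_derivative
        parity_ext (- (- 1)) (\<lambda>t. potential k c t * w t - w t powr p) t) (at t)" for t
      using dw1 by (rule parity_ext_has_derivative) (simp_all add: w)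
    moreover have "parity_ext (- (- 1)) (\<lambda>t. potential k c t * w t - w t powr p) t
        = potential k c t * parity_ext 1 w t - parity_ext 1 w t powr p" for t
      by (simp add: parity_ext_def potential_def)
    ultimately show "(parity_ext (- 1) w1 has_real_derivative
        potential k c t * parity_ext 1 w t - parity_ext 1 w t powr p) (at t)" for t
      by simp
  qed (use w in auto)
qed

section \<open>Solutions that are singular at both poles\<close>

lemma C2_on_cong:
  assumes "C2_on U f" "\<And>x. x \<in> U \<Longrightarrow> g x = f x"
  shows "C2_on U g"
proof -
  obtain f' f'' where U: "open U"
    and d: "\<forall>x\<in>U. (f has_derivative blinfun_apply (f' x)) (at x)"
      "\<forall>x\<in>U. (f' has_derivative blinfun_apply (f'' x)) (at x)" "continuous_on U f''"
    using assms(1) unfolding C2_on_def by blast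
  have "\<forall>x\<in>U. (g has_derivative blinfun_apply (f' x)) (at x)"
    using d(1) U assms(2) by (metis has_derivative_transform_within_open)
  with U d show ?thesis unfolding C2_on_def by blast
qed

lemma C2_on_imp_isCont:
  assumes "C2_on U f" "x \<in> U"
  shows "isCont f x"
  using assms unfolding C2_on_def by (metis has_derivative_continuous)

lemma C2_on_radial:
  fixes \<Phi> :: "real \<Rightarrow> real"
  assumes d1: "\<And>s. 0 < s \<Longrightarrow> (\<Phi> has_real_derivative \<Phi>1 s) (at s)"
    and d2: "\<And>s. 0 < s \<Longrightarrow> (\<Phi>1 has_real_derivative \<Phi>2 s) (at s)"
    and cont: "continuous_on {0<..} \<Phi>2"
  shows "C2_on (- {0}) (\<lambda>y :: 'a::euclidean_space. \<Phi> (y \<bullet> y))"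
proof -
  define f' where "f' = (\<lambda>y :: 'a. (2 * \<Phi>1 (y \<bullet> y)) *\<^sub>R blinfun_inner_left y)"
  define g where "g = (\<lambda>(y :: 'a) h. (4 * \<Phi>2 (y \<bullet> y) * (y \<bullet> h)) *\<^sub>R blinfun_inner_left y
      + (2 * \<Phi>1 (y \<bullet> y)) *\<^sub>R blinfun_inner_left h)"
  define f'' where "f'' = (\<lambda>y. Blinfun (g y))"
  have "bounded_linear (g y)" for y
    unfolding g_def
    by (intro bounded_linear_add bounded_linear_scaleR_const bounded_linear_const_mult
        bounded_linear_inner_right bounded_linear_const_scaleR bounded_linear_blinfun_inner_left)
  then have f'': "blinfun_apply (f'' y) = g y" for y
    by (simp add: f''_def bounded_linear_Blinfun_apply)
  have sq: "((\<lambda>y. y \<bullet> y) has_derivative (\<lambda>h. 2 * (y \<bullet> h))) (at y)" for y :: 'a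
    by (auto intro!: derivative_eq_intros simp: inner_commute)
  have pos: "0 < y \<bullet> y" if "y \<in> - {0}" for y :: 'a using that by simp
  have e1: "((\<lambda>y. \<Phi> (y \<bullet> y)) has_derivative blinfun_apply (f' y)) (at y)" if "y \<in> - {0}" for y
    using has_derivative_compose[OF sq d1[OF pos[OF that], unfolded has_field_derivative_def]]
    by (rule has_derivative_eq_rhs) (simp add: f'_def fun_eq_iff blinfun.scaleR_left inner_commute mult_ac)
  have e2: "(f' has_derivative blinfun_apply (f'' y)) (at y)" if "y \<in> - {0}" for y
  proof -
    have "((\<lambda>y. \<Phi>1 (y \<bullet> y)) has_derivative (\<lambda>h. \<Phi>2 (y \<bullet> y) * (2 * (y \<bullet> h)))) (at y)"
      using has_derivative_compose[OF sq d2[OF pos[OF that], unfolded has_field_derivative_def]] .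
    then have "((\<lambda>y. 2 * \<Phi>1 (y \<bullet> y)) has_derivative (\<lambda>h. 2 * (\<Phi>2 (y \<bullet> y) * (2 * (y \<bullet> h))))) (at y)"
      by (rule has_derivative_mult_right)
    from has_derivative_scaleR[OF this bounded_linear.has_derivative[OF bounded_linear_blinfun_inner_left has_derivative_ident]]
    show ?thesis unfolding f'' f'_def
      by (rule has_derivative_eq_rhs) (simp add: g_def fun_eq_iff add.commute mult.assoc[symmetric])
  qed
  have sqc: "continuous_on (- {0}) (\<lambda>y. \<Psi> (y \<bullet> y))" if "continuous_on {0<..} \<Psi>" for \<Psi> :: "real \<Rightarrow> real"
    by (rule continuous_on_compose2[OF that]) (auto intro!: continuous_intros)
  have "continuous_on {0<..} \<Phi>1"
    using d2 by (intro continuous_at_imp_continuous_on ballI DERIV_isCont) auto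
  then have contg: "continuous_on (- {0}) (\<lambda>y. g y h)" for h
    unfolding g_def
    by (intro continuous_intros sqc cont bounded_linear.continuous_on[OF bounded_linear_blinfun_inner_left])
  have "continuous_on (- {0}) f''"
    by (rule continuous_on_blinfun_componentwise) (simp only: f'' contg)
  with e1 e2 show ?thesis unfolding C2_on_def by (intro conjI exI[of _ f'] exI[of _ f'']) auto
qed

lemma cosh_half_ln: "0 < s \<Longrightarrow> cosh (ln s / 2) = (s + 1) / (2 * sqrt s)"
proof -
  assume s: "0 < s"
  have e: "exp (ln s / 2) = sqrt s" using s by (simp add: ln_sqrt[symmetric])
  have "sqrt s * sqrt s = s" using s by simp
  then show ?thesis using s by (simp add: cosh_def exp_minus e field_simps)
qed

text \<open>
  The value of \<open>v\<close> at a point whose stereographic coordinate has squared norm \<open>s\<close>: since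
  \<open>\<psi>(y) = 1 / (|y| cosh (ln |y|))\<close>, dividing \<open>|y|\<^sup>-\<^sup>k w(ln |y|)\<close> by \<open>\<psi>\<^sup>k\<close> leaves \<open>cosh\<^sup>k w\<close>.
\<close>

definition profile :: "real \<Rightarrow> (real \<Rightarrow> real) \<Rightarrow> real \<Rightarrow> real" where
  "profile k w s = cosh (ln s / 2) powr k * w (ln s / 2)"

text \<open>
  At height \<open>z\<close> on the sphere the stereographic coordinate has squared norm \<open>(1 + z) / (1 - z)\<close>.
\<close>

definition cyl_solution :: "(real \<Rightarrow> real) \<Rightarrow> 'n::finite ambient \<Rightarrow> real" where
  "cyl_solution w = restrict (\<lambda>q. profile ((real CARD('n) - 2) / 2) w ((1 + snd q) / (1 - snd q))) punctured_sphere"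

lemma stereo_south_conf: "stereo_south y = (conf_factor y *\<^sub>R y, conf_factor y - 1)"
proof -
  have "y \<bullet> y + 1 > 0" by (simp add: add_nonneg_pos)
  then show ?thesis by (simp add: stereo_south_def conf_factor_def field_simps)
qed

lemma stereo_south_in_punctured_sphere: "stereo_south y \<in> punctured_sphere \<longleftrightarrow> y \<noteq> 0"
proof -
  have "stereo_south y = (fst (stereo_north y), - snd (stereo_north y))"
    by (simp add: stereo_south_conf stereo_north_conf)
  moreover have "(a, - b) \<in> punctured_sphere \<longleftrightarrow> (a, b) \<in> (punctured_sphere :: 'a ambient set)" for a b
    by (auto simp: punctured_sphere_def unit_sphere_def north_def south_def norm_Pair)
  ultimately show ?thesis using stereo_north_in_punctured_sphere[of y] by simp
qed

lemma cyl_solution_stereo_north: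
  fixes y :: "real ^ 'n::finite"
  assumes "y \<noteq> 0"
  shows "cyl_solution w (stereo_north y) = profile ((real CARD('n) - 2) / 2) w (y \<bullet> y)"
proof -
  have "y \<bullet> y + 1 > 0" by (simp add: add_nonneg_pos)
  then have "(1 + (1 - conf_factor y)) / (1 - (1 - conf_factor y)) = y \<bullet> y"
    by (simp add: conf_factor_def field_simps)
  then show ?thesis
    using assms by (simp add: cyl_solution_def stereo_north_in_punctured_sphere stereo_north_conf[THEN arg_cong[of _ _ snd], simplified])
qed

text \<open>
  The transition between the two charts replaces \<open>s\<close> by \<open>1 / s\<close>, hence \<open>t\<close> by \<open>-t\<close>; evenness of
  \<open>w\<close> makes the function look alike in both.
\<close>

lemma cyl_solution_stereo_south:
  fixes y :: "real ^ 'n::finite"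
  assumes "y \<noteq> 0" and even: "\<And>t. w (- t) = w t"
  shows "cyl_solution w (stereo_south y) = profile ((real CARD('n) - 2) / 2) w (y \<bullet> y)"
proof -
  have p: "y \<bullet> y + 1 > 0" "y \<bullet> y > 0" using assms(1) by (simp_all add: add_nonneg_pos)
  have "1 - (conf_factor y - 1) = conf_factor y * (y \<bullet> y)"
    using conf_factor_sq[of y] by (simp add: algebra_simps)
  then have "(1 + (conf_factor y - 1)) / (1 - (conf_factor y - 1)) = 1 / (y \<bullet> y)"
    using conf_factor_pos[of y] by simp
  moreover have "profile k w (1 / (y \<bullet> y)) = profile k w (y \<bullet> y)" for k
    using p(2) even[of "ln (y \<bullet> y) / 2"] cosh_minus[of "ln (y \<bullet> y) / 2"] by (simp add: profile_def ln_div)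
  ultimately show ?thesis
    using assms by (simp add: cyl_solution_def stereo_south_in_punctured_sphere stereo_south_conf[THEN arg_cong[of _ _ snd], simplified])
qed

locale cylinder_solution =
  fixes w w1 w2 :: "real \<Rightarrow> real" and m :: real
  assumes d1: "(w has_real_derivative w1 t) (at t)"
    and d2: "(w1 has_real_derivative w2 t) (at t)"
    and even: "w (- t) = w t"
    and m_pos: "m > 0" and lower: "m \<le> w t"
begin

lemma cont_w: "continuous_on S w" and cont_w1: "continuous_on S w1"
  using d1 d2 by (auto intro!: continuous_at_imp_continuous_on DERIV_isCont)

lemma profile_C2:
  assumes contw2: "continuous_on UNIV w2"
  shows "C2_on (- {0}) (\<lambda>y :: 'a::euclidean_space. profile k w (y \<bullet> y))"
proof -
  define C where "C = (\<lambda>t::real. cosh t powr k)"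
  define C1 where "C1 = (\<lambda>t::real. k * cosh t powr (k - 1) * sinh t)"
  define C2 where "C2 = (\<lambda>t::real. k * (k - 1) * cosh t powr (k - 2) * (sinh t)\<^sup>2 + k * cosh t powr (k - 1) * cosh t)"
  have c1: "(C has_real_derivative C1 t) (at t)" for t
    unfolding C_def C1_def
    by (rule DERIV_cong[OF DERIV_fun_powr[of cosh "sinh t" t k]]) (auto intro!: derivative_eq_intros)
  have c2: "(C1 has_real_derivative C2 t) (at t)" for t
  proof -
    have "((\<lambda>t::real. cosh t powr (k - 1)) has_real_derivative (k - 1) * cosh t powr (k - 2) * sinh t) (at t)"
      by (rule DERIV_cong[OF DERIV_fun_powr[of cosh "sinh t" t "k - 1"]]) (auto intro!: derivative_eq_intros)
    then show ?thesis unfolding C1_def C2_def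
      by (auto intro!: derivative_eq_intros simp: algebra_simps power2_eq_square)
  qed
  define P where "P = (\<lambda>t. C t * w t)"
  define P1 where "P1 = (\<lambda>t. C1 t * w t + C t * w1 t)"
  define P2 where "P2 = (\<lambda>t. C2 t * w t + C1 t * w1 t + (C1 t * w1 t + C t * w2 t))"
  have p1: "(P has_real_derivative P1 t) (at t)" for t
    unfolding P_def P1_def by (auto intro!: derivative_eq_intros c1 d1)
  have p2: "(P1 has_real_derivative P2 t) (at t)" for t
    unfolding P1_def P2_def by (auto intro!: derivative_eq_intros c1 c2 d1 d2)
  have l: "((\<lambda>s. ln s / 2) has_real_derivative 1 / (2 * s)) (at s)" if "0 < s" for s :: real
    using that by (auto intro!: derivative_eq_intros)
  show ?thesis
  proof (rule C2_on_radial)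
    fix s :: real assume s: "0 < s"
    show "(profile k w has_real_derivative P1 (ln s / 2) / (2 * s)) (at s)"
      using DERIV_chain2[OF p1 l[OF s]] by (simp add: profile_def[abs_def] P_def C_def)
    show "((\<lambda>s. P1 (ln s / 2) / (2 * s)) has_real_derivative
        (P2 (ln s / 2) / 2 - P1 (ln s / 2)) / (2 * s\<^sup>2)) (at s)"
      using DERIV_chain2[OF p2 l[OF s]] s
      by (auto intro!: derivative_eq_intros simp: power2_eq_square field_simps)
  next
    have nz: "cosh t \<noteq> 0" for t :: real using cosh_real_pos[of t] by simp
    have "continuous_on UNIV P2"
      unfolding P2_def C_def C1_def C2_def
      by (intro continuous_intros cont_w cont_w1 contw2) (simp_all add: nz)
    then have c2: "continuous_on {0<..} (\<lambda>s. P2 (ln s / 2))"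
      by (rule continuous_on_compose2) (auto intro!: continuous_intros)
    have "continuous_on UNIV P1"
      using p2 by (intro continuous_at_imp_continuous_on ballI DERIV_isCont)
    then have "continuous_on {0<..} (\<lambda>s. P1 (ln s / 2))"
      by (rule continuous_on_compose2) (auto intro!: continuous_intros)
    with c2 show "continuous_on {0<..} (\<lambda>s. (P2 (ln s / 2) / 2 - P1 (ln s / 2)) / (2 * s\<^sup>2))"
      by (intro continuous_intros) auto
  qed
qed

text \<open>
  With \<open>|y|\<^sup>-\<^sup>k\<close> as weight and \<open>t = ln |y|\<close>, the first order terms of the radial Laplacian cancel.
\<close>

lemma flat_lap:
  fixes y :: "'a::euclidean_space" and k :: real
  defines "k \<equiv> (real DIM('a) - 2) / 2"
  assumes y: "y \<noteq> 0"
  shows "has_lap (\<lambda>y :: 'a. (y \<bullet> y) powr (- k / 2) * w (ln (y \<bullet> y) / 2))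
    ((y \<bullet> y) powr (- k / 2 - 1) * (w2 (ln (y \<bullet> y) / 2) - k\<^sup>2 * w (ln (y \<bullet> y) / 2))) y"
proof -
  define \<Theta> where "\<Theta> = (\<lambda>s. s powr (- k / 2) * w (ln s / 2))"
  define T1 where "T1 = (\<lambda>s. s powr (- k / 2 - 1) * ((w1 (ln s / 2) - k * w (ln s / 2)) / 2))"
  define T2 where "T2 = (\<lambda>s. s powr (- k / 2 - 2) * ((- k / 2 - 1) * ((w1 (ln s / 2) - k * w (ln s / 2)) / 2)
      + (w2 (ln s / 2) - k * w1 (ln s / 2)) / 4))"
  have l: "((\<lambda>s. ln s / 2) has_real_derivative 1 / (2 * s)) (at s)" if "0 < s" for s :: real
    using that by (auto intro!: derivative_eq_intros)
  have pw: "s powr (- k / 2 - 1) = s powr (- k / 2 - 2) * s" if "0 < s" for s :: real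
  proof -
    have "- k / 2 - 1 = (- k / 2 - 2) + 1" by simp
    then show ?thesis using that by (simp only: powr_add powr_one)
  qed
  have t1: "(\<Theta> has_real_derivative T1 s) (at s)" if s: "0 < s" for s
  proof -
    have "(\<Theta> has_real_derivative (- k / 2) * s powr (- k / 2 - 1) * w (ln s / 2)
        + w1 (ln s / 2) * (1 / (2 * s)) * s powr (- k / 2)) (at s)"
      unfolding \<Theta>_def by (rule DERIV_mult[OF has_real_derivative_powr[OF s] DERIV_chain2[OF d1 l[OF s]]])
    moreover have "s powr (- k / 2) = s powr (- k / 2 - 1) * s" using s powr_add[of s "- k / 2 - 1" 1] by simp
    ultimately show ?thesis using s by (simp add: T1_def algebra_simps diff_divide_distrib)
  qed
  have t2: "(T1 has_real_derivative T2 s) (at s)" if s: "0 < s" for s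
  proof -
    have "((\<lambda>s. (w1 (ln s / 2) - k * w (ln s / 2)) / 2) has_real_derivative
        (w2 (ln s / 2) * (1 / (2 * s)) - k * (w1 (ln s / 2) * (1 / (2 * s)))) / 2) (at s)"
      by (intro DERIV_cdivide DERIV_diff DERIV_cmult DERIV_chain2[OF d1 l[OF s]] DERIV_chain2[OF d2 l[OF s]])
    moreover have "((\<lambda>s. s powr (- k / 2 - 1)) has_real_derivative (- k / 2 - 1) * s powr (- k / 2 - 2)) (at s)"
      by (rule DERIV_cong[OF has_real_derivative_powr[OF s]]) (simp only: diff_diff_eq one_add_one)
    ultimately have d: "(T1 has_real_derivative (- k / 2 - 1) * s powr (- k / 2 - 2) * ((w1 (ln s / 2) - k * w (ln s / 2)) / 2)
        + (w2 (ln s / 2) * (1 / (2 * s)) - k * (w1 (ln s / 2) * (1 / (2 * s)))) / 2 * s powr (- k / 2 - 1)) (at s)"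
      unfolding T1_def by (intro DERIV_mult)
    from pw[OF s] have e: "(w2 (ln s / 2) * (1 / (2 * s)) - k * (w1 (ln s / 2) * (1 / (2 * s)))) / 2 * s powr (- k / 2 - 1)
        = s powr (- k / 2 - 2) * ((w2 (ln s / 2) - k * w1 (ln s / 2)) / 4)"
      using s by (simp add: field_simps)
    have alg: "a * X * Y + X * Z = X * (a * Y + Z)" for a X Y Z :: real by (simp add: algebra_simps)
    show ?thesis using d unfolding e alg T2_def .
  qed
  define s where "s = sq_dist 0 y"
  have s: "0 < s" using y by (simp add: s_def)
  have "\<forall>\<^sub>F t in nhds s. t \<in> {0<..}" using s by (intro eventually_nhds_in_open) auto
  then have "\<forall>\<^sub>F t in nhds s. (\<Theta> has_real_derivative T1 t) (at t)"
    by eventually_elim (rule t1, simp)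
  from has_lap_radial[OF this[unfolded s_def] t2[OF s, unfolded s_def]]
  have "has_lap (\<lambda>y. \<Theta> (y \<bullet> y)) (4 * T2 s * s + 2 * real DIM('a) * T1 s) y" by (simp add: s_def)
  moreover have "4 * T2 s * s + 2 * real DIM('a) * T1 s = s powr (- k / 2 - 1) * (w2 (ln s / 2) - k\<^sup>2 * w (ln s / 2))"
  proof -
    note e = pw[OF s]
    have n: "real DIM('a) = 2 * k + 2" by (simp add: k_def field_simps)
    show ?thesis unfolding T1_def T2_def e n by (simp add: field_simps power2_eq_square)
  qed
  ultimately show ?thesis by (simp add: \<Theta>_def s_def)
qed

lemma profile_conf_factor:
  fixes y :: "'a::euclidean_space"
  assumes "y \<noteq> 0"
  shows "conf_factor y powr k * profile k w (y \<bullet> y) = (y \<bullet> y) powr (- k / 2) * w (ln (y \<bullet> y) / 2)"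
proof -
  define s where "s = y \<bullet> y"
  have s: "s > 0" using assms by (simp add: s_def)
  have "2 / b * (b / (2 * d)) = 1 / d" if "b \<noteq> 0" for b d :: real using that by simp
  from this[of "s + 1" "sqrt s"] have "conf_factor y * cosh (ln s / 2) = 1 / sqrt s"
    using s by (simp only: cosh_half_ln conf_factor_def s_def[symmetric])
  then have "conf_factor y powr k * cosh (ln s / 2) powr k = (1 / sqrt s) powr k"
    using conf_factor_pos[of y] by (simp add: powr_mult[symmetric])
  also have "1 / sqrt s = s powr (- 1 / 2)" using s by (simp add: powr_half_sqrt[symmetric] powr_minus_divide)
  finally show ?thesis using s by (simp add: profile_def s_def[symmetric] powr_powr mult.assoc[symmetric])
qed

lemma profile_pos: "0 < profile k w s"
  using m_pos lower[of "ln s / 2"] by (auto simp: profile_def intro!: mult_pos_pos)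

text \<open>
  The Laplacian of the flattened function is computed twice, from \<open>flat_lap\<close> and from
  \<open>flatten_lap\<close>. Comparing the results determines the Laplace--Beltrami operator;
  \<open>1 / cosh\<^sup>2 t = \<psi>\<^sup>2 |y|\<^sup>2\<close> identifies the linear terms.
\<close>

theorem cyl_solution_is_solution:
  assumes dim: "CARD('n::finite) \<ge> 3"
    and eq: "\<And>t. w2 t = potential ((real CARD('n) - 2) / 2) (real CARD('n) * (real CARD('n) - 2) / 4 - \<beta>) t * w t
        - w t powr ((real CARD('n) + 2) / (real CARD('n) - 2))"
  shows "solution \<beta> (cyl_solution w :: 'n ambient \<Rightarrow> real)"
proof -
  define k where "k = (real CARD('n) - 2) / 2"
  define p where "p = (real CARD('n) + 2) / (real CARD('n) - 2)"
  define c0 where "c0 = real CARD('n) * (real CARD('n) - 2) / 4"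
  define c where "c = c0 - \<beta>"
  let ?v = "cyl_solution w :: 'n ambient \<Rightarrow> real"
  have eq': "w2 t = potential k c t * w t - w t powr p" for t
    using eq[of t] by (simp only: k_def c_def c0_def p_def)
  have kp: "k * p = k + 2" using dim by (simp add: k_def p_def field_simps)
  have wpos: "w t > 0" for t using m_pos lower[of t] by linarith
  have contP: "continuous_on UNIV (potential k c)"
    using potential_has_derivative by (intro continuous_at_imp_continuous_on ballI DERIV_isCont)
  have "continuous_on UNIV w2"
    unfolding eq'[abs_def] using wpos
    by (intro continuous_intros contP cont_w) (auto simp: less_imp_neq[THEN not_sym])
  note C2 = profile_C2[OF this]
  have north_eq: "(?v \<circ> stereo_north) y = profile k w (y \<bullet> y)" if "y \<in> - {0}" for y
    using that cyl_solution_stereo_north[of y w] by (simp add: k_def)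
  have south_eq: "(?v \<circ> stereo_south) y = profile k w (y \<bullet> y)" if "y \<in> - {0}" for y
    using that cyl_solution_stereo_south[of y w, OF _ even] by (simp add: k_def)
  have C2n: "C2_on (- {0}) (?v \<circ> stereo_north)" by (rule C2_on_cong[OF C2 north_eq])
  have C2s: "C2_on (- {0}) (?v \<circ> stereo_south)" by (rule C2_on_cong[OF C2 south_eq])
  have south_vimage: "stereo_south -` punctured_sphere = - {0 :: real ^ 'n}"
    by (simp add: set_eq_iff stereo_south_in_punctured_sphere)
  have "openin (top_of_set unit_sphere) (punctured_sphere :: 'n ambient set)"
    unfolding punctured_sphere_def by (intro openin_diff) (auto intro: closed_subset simp: unit_sphere_def north_def south_def norm_Pair)
  with C2n C2s have "C2_on_sphere punctured_sphere ?v"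
    by (simp add: C2_on_sphere_def south_vimage stereo_north_vimage)
  moreover have "?v q > 0 \<and> - laplace_sphere ?v q + \<beta> * ?v q = ?v q powr p" if q: "q \<in> punctured_sphere" for q
  proof -
    obtain y where y: "y \<noteq> 0" "q = stereo_north y" using punctured_sphere_stereo_north[OF q] .
    define s where "s = y \<bullet> y"
    define \<tau> where "\<tau> = ln s / 2"
    define \<psi> where "\<psi> = conf_factor y"
    define V where "V = profile k w s"
    define U where "U = s powr (- k / 2) * w \<tau>"
    define LB where "LB = laplace_beltrami_coords stereo_north ?v y"
    have s: "s > 0" using y by (simp add: s_def)
    have \<psi>: "\<psi> > 0" using conf_factor_pos by (simp add: \<psi>_def)
    have V: "V > 0" using profile_pos by (simp add: V_def)
    have vq: "?v q = V" using north_eq[of y] y by (simp add: V_def s_def)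
    have U: "U = \<psi> powr k * V" using profile_conf_factor[OF y(1), of k] by (simp add: U_def V_def \<psi>_def s_def \<tau>_def)
    obtain G H where "has_hess (?v \<circ> stereo_north) G H y"
      using C2_on_imp_has_hess[OF C2n, of y] y by auto
    from flatten_lap[OF dim this]
    have 1: "has_lap (flatten ?v) (\<psi> powr (k + 2) * (LB - c0 * V)) y"
      using vq y(2) by (simp add: k_def \<psi>_def LB_def c0_def)
    have ev: "\<forall>\<^sub>F z in nhds y. z \<in> - {0}" using y(1) by (intro eventually_nhds_in_open) auto
    have ev2: "\<forall>\<^sub>F z in nhds y. flatten ?v z = (z \<bullet> z) powr (- k / 2) * w (ln (z \<bullet> z) / 2)"
      using ev
    proof eventually_elim
      case (elim z)
      then show ?case
        using profile_conf_factor[of z k] north_eq[of z] by (simp add: flatten_def k_def)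
    qed
    have lap2: "has_lap (\<lambda>z. (z \<bullet> z) powr (- k / 2) * w (ln (z \<bullet> z) / 2))
        (s powr (- k / 2 - 1) * (w2 \<tau> - k\<^sup>2 * w \<tau>)) y"
      using flat_lap[OF y(1)] by (simp add: s_def \<tau>_def k_def)
    have 2: "has_lap (flatten ?v) (s powr (- k / 2 - 1) * (w2 \<tau> - k\<^sup>2 * w \<tau>)) y"
      by (rule has_lap_cong[OF lap2 ev2])
    have "s powr (- k / 2 - 1) * (w2 \<tau> - k\<^sup>2 * w \<tau>) = - (U powr p + c * \<psi>\<^sup>2 * U)"
    proof -
      have e: "s powr (- k / 2 - 1) = s powr (- k / 2) / s" using s powr_diff[of s "- k / 2" 1] by simp
      have "U powr p = s powr (- k / 2 * p) * w \<tau> powr p" using wpos[of \<tau>] s by (simp add: U_def powr_mult powr_powr)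
      also have "- k / 2 * p = - k / 2 - 1" using kp by (simp add: field_simps)
      finally have Up: "U powr p = s powr (- k / 2 - 1) * w \<tau> powr p" .
      have "1 / (cosh \<tau>)\<^sup>2 = \<psi>\<^sup>2 * s"
      proof -
        have "(cosh \<tau>)\<^sup>2 = (s + 1)\<^sup>2 / (4 * s)" using s by (simp add: \<tau>_def cosh_half_ln power_divide power_mult_distrib)
        then show ?thesis using s by (simp add: \<psi>_def conf_factor_def s_def[symmetric] power_divide)
      qed
      then have eqw: "w2 \<tau> - k\<^sup>2 * w \<tau> = - c * (\<psi>\<^sup>2 * s) * w \<tau> - w \<tau> powr p"
        unfolding eq' potential_def by (simp add: algebra_simps divide_inverse)
      show ?thesis unfolding Up eqw e using s by (simp add: U_def field_simps)
    qed
    also have "\<dots> = - (\<psi> powr (k + 2) * (V powr p + c * V))"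
    proof -
      have "U powr p = \<psi> powr (k + 2) * V powr p" using \<psi> V by (simp add: U powr_mult powr_powr kp)
      moreover have "\<psi>\<^sup>2 * U = \<psi> powr (k + 2) * V" using \<psi> by (simp add: U powr_add)
      ultimately show ?thesis by (simp add: algebra_simps)
    qed
    finally have "\<psi> powr (k + 2) * (LB - c0 * V) = - (\<psi> powr (k + 2) * (V powr p + c * V))"
      using has_lap_unique[OF 1 2] by simp
    then have "\<psi> powr (k + 2) * ((LB - c0 * V) + (V powr p + c * V)) = 0"
      by (simp only: distrib_left)
    then have "(LB - c0 * V) + (V powr p + c * V) = 0" using \<psi> by simp
    then have "- LB + \<beta> * V = V powr p" by (simp add: c_def algebra_simps)
    with V show ?thesis unfolding vq by (simp add: y(2) laplace_sphere_stereo_north LB_def)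
  qed
  ultimately show ?thesis by (simp add: solution_def p_def)
qed

lemma profile_at_0:
  assumes "k > 0"
  shows "filterlim (profile k w) at_top (at_right 0)"
proof -
  have "filterlim (\<lambda>s::real. cosh (ln s / 2) powr k) at_top (at_right 0)"
    using assms unfolding cosh_field_def by real_asymp
  then have "filterlim (\<lambda>s::real. m * cosh (ln s / 2) powr k) at_top (at_right 0)"
    using m_pos by (intro filterlim_tendsto_pos_mult_at_top[OF tendsto_const])
  then show ?thesis
  proof (rule filterlim_at_top_mono)
    show "\<forall>\<^sub>F s in at_right 0. m * cosh (ln s / 2) powr k \<le> profile k w s"
      by (intro always_eventually allI) (simp add: profile_def mult.commute mult_right_mono lower)
  qed
qed

text \<open>
  A function that is continuous at the pole is bounded near it, but the profile tends to infinity.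
\<close>

lemma no_continuous_extension:
  fixes g :: "'a::euclidean_space \<Rightarrow> real"
  assumes "k > 0" "isCont g 0" "open U" "0 \<in> U" "\<And>y. y \<in> U \<Longrightarrow> y \<noteq> 0 \<Longrightarrow> g y = profile k w (y \<bullet> y)"
  shows False
proof -
  have "filterlim (\<lambda>y::'a. y \<bullet> y) (at_right 0) (at 0)"
    unfolding filterlim_at
  proof
    show "\<forall>\<^sub>F y::'a in at 0. y \<bullet> y \<in> {0<..} \<and> y \<bullet> y \<noteq> 0"
      by (auto simp: eventually_at_filter)
    show "((\<lambda>y::'a. y \<bullet> y) \<longlongrightarrow> 0) (at 0)"
      using tendsto_inner[OF tendsto_ident_at tendsto_ident_at, of "0 :: 'a" UNIV] by simp
  qed
  from filterlim_compose[OF profile_at_0[OF assms(1)] this]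
  have "filterlim (\<lambda>y::'a. profile k w (y \<bullet> y)) at_top (at 0)" .
  moreover have "\<forall>\<^sub>F y in at 0. profile k w (y \<bullet> y) = g y"
    using eventually_nhds_in_open[OF assms(3,4)] unfolding eventually_at_filter
    by eventually_elim (use assms(5) in auto)
  note eq = filterlim_cong[OF refl refl this, of at_top]
  ultimately have "filterlim g at_top (at 0)" unfolding eq by simp
  then have "filterlim g at_infinity (at 0)" by (rule filterlim_at_top_imp_at_infinity)
  moreover have "(g \<longlongrightarrow> g 0) (at 0)" using assms(2) by (simp add: isCont_def)
  ultimately show False
    using not_tendsto_and_filterlim_at_infinity[of "at (0 :: 'a)" g "g 0"] by simp
qed

lemma cyl_solution_has_singularity:
  assumes dim: "CARD('n::finite) \<ge> 3" and q: "q \<in> {north, south}"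
  shows "has_singularity (cyl_solution w :: 'n ambient \<Rightarrow> real) q"
  unfolding has_singularity_def
proof
  let ?v = "cyl_solution w :: 'n ambient \<Rightarrow> real"
  have k: "(real CARD('n) - 2) / 2 > 0" using dim by simp
  assume "\<exists>U f. q \<in> U \<and> C2_on_sphere U f \<and> (\<forall>x\<in>U \<inter> punctured_sphere. f x = ?v x)"
  then obtain U f where U: "q \<in> U" "C2_on_sphere U f" "\<And>x. x \<in> U \<inter> punctured_sphere \<Longrightarrow> f x = ?v x" by blast
  have s0: "stereo_south (0 :: real ^ 'n) = north" by (simp add: stereo_south_def north_def)
  have n0: "stereo_north (0 :: real ^ 'n) = south" by (simp add: stereo_north_def south_def)
  have contra: False if C: "C2_on (\<phi> -` U) (f \<circ> \<phi>)" and 0: "\<phi> 0 = q"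
    and \<phi>: "\<And>y. y \<noteq> 0 \<Longrightarrow> \<phi> y \<in> punctured_sphere \<and> ?v (\<phi> y) = profile ((real CARD('n) - 2) / 2) w (y \<bullet> y)"
    for \<phi> :: "real ^ 'n \<Rightarrow> 'n ambient"
  proof -
    have 0: "0 \<in> \<phi> -` U" using U(1) 0 by simp
    show False
    proof (rule no_continuous_extension[OF k C2_on_imp_isCont[OF C 0] _ 0])
      show "open (\<phi> -` U)" using C by (simp add: C2_on_def)
      fix y :: "real ^ 'n" assume "y \<in> \<phi> -` U" "y \<noteq> 0"
      then show "(f \<circ> \<phi>) y = profile ((real CARD('n) - 2) / 2) w (y \<bullet> y)"
        using U(3)[of "\<phi> y"] \<phi>[of y] by simp
    qed
  qed
  from q consider "q = north" | "q = south" by blast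
  then show False
  proof cases
    case 1
    show False
      by (rule contra[of stereo_south])
        (use U(2) s0 1 cyl_solution_stereo_south[of _ w, OF _ even] in
          \<open>auto simp: C2_on_sphere_def stereo_south_in_punctured_sphere\<close>)
  next
    case 2
    show False
      by (rule contra[of stereo_north])
        (use U(2) n0 2 cyl_solution_stereo_north in
          \<open>auto simp: C2_on_sphere_def stereo_north_in_punctured_sphere\<close>)
  qed
qed

lemma cyl_solution_equator:
  "cyl_solution w (axis i 1, 0) = w 0"
proof -
  have "(axis i 1, 0) \<in> punctured_sphere"
    by (auto simp: punctured_sphere_def unit_sphere_def north_def south_def norm_Pair)
  then show ?thesis by (simp add: cyl_solution_def profile_def)
qed

end

text \<open>
  Evaluation at a point of the equator recovers \<open>w(0) = \<alpha>\<close>, and \<open>\<alpha>\<close> ranges over an interval.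
\<close>

theorem infinitely_many_solutions:
  assumes dim: "CARD('n::finite) \<ge> 3"
    and \<beta>: "(real CARD('n) - 2) / 2 < \<beta>" "\<beta> < real CARD('n) * (real CARD('n) - 2) / 4"
  shows "infinite {v :: 'n ambient \<Rightarrow> real. v \<in> extensional punctured_sphere \<and> solution \<beta> v \<and>
          {q \<in> {north, south}. has_singularity v q} = {north, south}}" (is "infinite ?X")
proof
  assume fin: "finite ?X"
  define k where "k = (real CARD('n) - 2) / 2"
  define p where "p = (real CARD('n) + 2) / (real CARD('n) - 2)"
  define c where "c = real CARD('n) * (real CARD('n) - 2) / 4 - \<beta>"
  have k: "k > 0" using dim by (simp add: k_def)
  have p: "p > 1" using dim by (simp add: p_def field_simps)
  have c: "0 < c" "c < k\<^sup>2" using \<beta> by (auto simp: c_def k_def power2_eq_square field_simps)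
  define a where "a = ((k\<^sup>2 - c) * (p + 1) / 2) powr (1 / (p - 1))"
  have a: "a > 0" using c p by (simp add: a_def)
  have ap: "a powr (p - 1) = (k\<^sup>2 - c) * (p + 1) / 2" using c p by (simp add: a_def powr_powr)
  obtain i :: 'n where "i \<in> UNIV" by blast
  have "{0<..<a} \<subseteq> (\<lambda>v. v (axis i 1, 0)) ` ?X"
  proof
    fix \<alpha> assume "\<alpha> \<in> {0<..<a}"
    then have \<alpha>: "0 < \<alpha>" "\<alpha> < a" by auto
    have "\<alpha> powr (p - 1) < (k\<^sup>2 - c) * (p + 1) / 2"
      unfolding ap[symmetric] using \<alpha> p by (intro powr_less_mono2) auto
    from emden_fowler_solution[OF k c p \<alpha>(1) this] obtain w w1 m where w: "w 0 = \<alpha>" "m > 0"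
      "\<And>t. w (- t) = w t" "\<And>t. m \<le> w t" "\<And>t. (w has_real_derivative w1 t) (at t)"
      "\<And>t. (w1 has_real_derivative potential k c t * w t - w t powr p) (at t)" by blast
    interpret cylinder_solution w w1 "\<lambda>t. potential k c t * w t - w t powr p" m
      by unfold_locales (use w in auto)
    let ?v = "cyl_solution w :: 'n ambient \<Rightarrow> real"
    have "?v \<in> extensional punctured_sphere" by (simp add: cyl_solution_def)
    moreover have "solution \<beta> ?v"
      by (rule cyl_solution_is_solution[OF dim]) (simp add: k_def c_def p_def)
    ultimately have "?v \<in> ?X" using cyl_solution_has_singularity[OF dim] by auto
    moreover have "?v (axis i 1, 0) = \<alpha>" using cyl_solution_equator w(1) by simp
    ultimately show "\<alpha> \<in> (\<lambda>v. v (axis i 1, 0)) ` ?X" by (intro image_eqI[of _ _ ?v]) auto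
  qed
  with fin have "finite {0<..<a}" by (meson finite_imageI finite_subset)
  with a show False by (simp add: infinite_Ioo)
qed

theorem corollary1p4:
  fixes \<beta> :: real
  assumes "CARD('n::finite) \<ge> 3"
  shows
    "(\<beta> < real CARD('n) * (real CARD('n) - 2) / 4 \<longrightarrow>
        (\<forall>v :: 'n ambient \<Rightarrow> real. solution \<beta> v \<longrightarrow> rotationally_symmetric v))
     \<and> (\<beta> \<le> 0 \<longrightarrow> \<not> (\<exists>v :: 'n ambient \<Rightarrow> real. solution \<beta> v))
     \<and> ((real CARD('n) - 2) / 2 < \<beta> \<and> \<beta> < real CARD('n) * (real CARD('n) - 2) / 4 \<longrightarrow>
        infinite {v :: 'n ambient \<Rightarrow> real. v \<in> extensional punctured_sphere \<and> solution \<beta> v \<and>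
          {q \<in> {north, south}. has_singularity v q} = {north, south}})"
proof (intro conjI impI allI)
  show "rotationally_symmetric v" if "\<beta> < real CARD('n) * (real CARD('n) - 2) / 4" "solution \<beta> v"
    for v :: "'n ambient \<Rightarrow> real"
    using solution_rotationally_symmetric[OF assms that(2,1)] .
  show "\<not> (\<exists>v :: 'n ambient \<Rightarrow> real. solution \<beta> v)" if "\<beta> \<le> 0"
    using no_solution[OF assms that] by blast
  show "infinite {v :: 'n ambient \<Rightarrow> real. v \<in> extensional punctured_sphere \<and> solution \<beta> v \<and>
          {q \<in> {north, south}. has_singularity v q} = {north, south}}"
    if "(real CARD('n) - 2) / 2 < \<beta> \<and> \<beta> < real CARD('n) * (real CARD('n) - 2) / 4"
    using infinitely_many_solutions[OF assms] that by blast
qed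

end
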